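(* Let $H=2P_2+P_1$ or $H\subseteq_i P_2 + 3P_1$, $P_3+2P_1$, or $P_4 + P_1$, and let $\mathcal{G}$ be the class of (connected) $H$-free graphs. Then the $d_{\max}(\mathcal{G})$-Diameter problem can be solved in $O(n+m)$ time.
   Context: Graphs are connected, undirected and unweighted; $n$ is the number of vertices and $m$ the number of edges. A graph is $H$-free if it does not contain $H$ as an induced subgraph. $H \subseteq_i H'$ means $H$ is an induced subgraph of $H'$. $P_t$ denotes the path on $t$ vertices, $sP_t$ the disjoint union of $s$ copies of $P_t$, and $G+H$ the disjoint union of $G$ and $H$. For a graph class $\mathcal{G}$, $d_{\max}(\mathcal{G}) = \sup_{G\in\mathcal{G}} \mathrm{diam}(G)$. The $d_{\max}(\mathcal{G})$-Diameter problem asks, for a given graph $G\in\mathcal{G}$, whether $\mathrm{diam}(G) = d_{\max}(\mathcal{G})$. For connected $H$-free graphs with $H=\sum_{i=1}^k P_{a_i}$ a linear forest, $d_{\max} = k-3+\sum_{i=1}^k a_i$. *)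

theory Defs
  imports Main "HOL-Library.Extended_Nat"
begin

section \<open>Finite simple graphs\<close>

datatype 'a ugraph = Graph (vertices: "'a set") (edges: "'a set set")

definition simple_graph :: "'a ugraph \<Rightarrow> bool" where
  "simple_graph G \<longleftrightarrow>
     finite (vertices G) \<and>
     (\<forall>e\<in>edges G. \<exists>u\<in>vertices G. \<exists>v\<in>vertices G. u \<noteq> v \<and> e = {u, v})"

definition neighbours :: "'a ugraph \<Rightarrow> 'a \<Rightarrow> 'a set" where
  "neighbours G v = {u. {u, v} \<in> edges G}"

definition induced_on :: "'a ugraph \<Rightarrow> 'a set \<Rightarrow> 'a ugraph" where
  "induced_on G S = Graph S {e \<in> edges G. e \<subseteq> S}"

definition isomorphic :: "'a ugraph \<Rightarrow> 'b ugraph \<Rightarrow> bool" where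
  "isomorphic G H \<longleftrightarrow>
     (\<exists>f. bij_betw f (vertices G) (vertices H) \<and> (\<lambda>e. f ` e) ` edges G = edges H)"

definition induced_subgraph_of :: "'a ugraph \<Rightarrow> 'b ugraph \<Rightarrow> bool" (infix \<open>\<subseteq>\<^sub>i\<close> 50) where
  "H \<subseteq>\<^sub>i G \<longleftrightarrow> (\<exists>S\<subseteq>vertices G. isomorphic H (induced_on G S))"

definition path_graph :: "nat \<Rightarrow> nat ugraph" where
  "path_graph t = Graph {..<t} {{i, Suc i} | i. Suc i < t}"

definition graph_sum :: "'a ugraph \<Rightarrow> 'b ugraph \<Rightarrow> ('a + 'b) ugraph" where
  "graph_sum G H =
     Graph (vertices G <+> vertices H)
       ((\<lambda>e. Inl ` e) ` edges G \<union> (\<lambda>e. Inr ` e) ` edges H)"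

definition copies :: "nat \<Rightarrow> 'a ugraph \<Rightarrow> (nat \<times> 'a) ugraph" where
  "copies s G = Graph ({..<s} \<times> vertices G) {Pair i ` e | i e. i < s \<and> e \<in> edges G}"


section \<open>Distance and diameter\<close>

definition walk :: "'a ugraph \<Rightarrow> 'a \<Rightarrow> 'a list \<Rightarrow> 'a \<Rightarrow> bool" where
  "walk G u p v \<longleftrightarrow>
     p \<noteq> [] \<and> hd p = u \<and> last p = v \<and> set p \<subseteq> vertices G \<and>
     successively (\<lambda>x y. {x, y} \<in> edges G) p"

text \<open>The graph without vertices does not count as connected.\<close>

definition connected_graph :: "'a ugraph \<Rightarrow> bool" where
  "connected_graph G \<longleftrightarrow>
     vertices G \<noteq> {} \<and> (\<forall>u\<in>vertices G. \<forall>v\<in>vertices G. \<exists>p. walk G u p v)"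

definition distance :: "'a ugraph \<Rightarrow> 'a \<Rightarrow> 'a \<Rightarrow> enat" where
  "distance G u v = (INF p\<in>{p. walk G u p v}. enat (length p - 1))"

definition diameter :: "'a ugraph \<Rightarrow> enat" where
  "diameter G = (SUP u\<in>vertices G. SUP v\<in>vertices G. distance G u v)"

definition d_max :: "'a ugraph set \<Rightarrow> enat" where
  "d_max \<G> = (SUP G\<in>\<G>. diameter G)"

text \<open>Vertices are natural numbers; up to isomorphism this covers every finite graph.\<close>

definition connected_free :: "'h ugraph \<Rightarrow> nat ugraph set" where
  "connected_free H = {G. simple_graph G \<and> connected_graph G \<and> \<not> H \<subseteq>\<^sub>i G}"


section \<open>A word RAM\<close>

text \<open>
  The machine model is a unit-cost word RAM with words of \<open>w\<close> bits, programmed by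
  while-programs. A program mentions finitely many registers and finitely many arrays, each
  by a fixed number; arrays are addressed indirectly by a computed word. Every node of an
  expression that is evaluated and every command that is executed costs one time step.
  Addition and multiplication are modulo \<open>2 ^ w\<close>; subtraction is truncated at \<open>0\<close>.
\<close>

datatype aexp = Lit nat | Reg nat | Load nat aexp | Add aexp aexp | Sub aexp aexp | Mul aexp aexp

datatype bexp = Less aexp aexp | Equal aexp aexp | Neg bexp | Conj bexp bexp

datatype com =
    Skip
  | Assign nat aexp
  | Store nat aexp aexp
  | Seq com com
  | Cond bexp com com
  | While bexp com

datatype state = State (regs: "nat \<Rightarrow> nat") (arrays: "nat \<Rightarrow> nat \<Rightarrow> nat")

fun aval :: "nat \<Rightarrow> aexp \<Rightarrow> state \<Rightarrow> nat" where
  "aval w (Lit k) s = k mod 2 ^ w"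
| "aval w (Reg r) s = regs s r"
| "aval w (Load a i) s = arrays s a (aval w i s)"
| "aval w (Add x y) s = (aval w x s + aval w y s) mod 2 ^ w"
| "aval w (Sub x y) s = aval w x s - aval w y s"
| "aval w (Mul x y) s = (aval w x s * aval w y s) mod 2 ^ w"

fun acost :: "aexp \<Rightarrow> nat" where
  "acost (Lit k) = 1"
| "acost (Reg r) = 1"
| "acost (Load a i) = 1 + acost i"
| "acost (Add x y) = 1 + acost x + acost y"
| "acost (Sub x y) = 1 + acost x + acost y"
| "acost (Mul x y) = 1 + acost x + acost y"

fun bval :: "nat \<Rightarrow> bexp \<Rightarrow> state \<Rightarrow> bool" where
  "bval w (Less x y) s \<longleftrightarrow> aval w x s < aval w y s"
| "bval w (Equal x y) s \<longleftrightarrow> aval w x s = aval w y s"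
| "bval w (Neg b) s \<longleftrightarrow> \<not> bval w b s"
| "bval w (Conj b c) s \<longleftrightarrow> bval w b s \<and> bval w c s"

fun bcost :: "bexp \<Rightarrow> nat" where
  "bcost (Less x y) = 1 + acost x + acost y"
| "bcost (Equal x y) = 1 + acost x + acost y"
| "bcost (Neg b) = 1 + bcost b"
| "bcost (Conj b c) = 1 + bcost b + bcost c"

fun set_reg :: "nat \<Rightarrow> nat \<Rightarrow> state \<Rightarrow> state" where
  "set_reg r x (State R A) = State (R(r := x)) A"

fun set_array :: "nat \<Rightarrow> nat \<Rightarrow> nat \<Rightarrow> state \<Rightarrow> state" where
  "set_array a i x (State R A) = State R (A(a := (A a)(i := x)))"

text \<open>\<open>exec w c s t s'\<close>: started in \<open>s\<close>, the program \<open>c\<close> halts after \<open>t\<close> steps in \<open>s'\<close>.\<close>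

inductive exec :: "nat \<Rightarrow> com \<Rightarrow> state \<Rightarrow> nat \<Rightarrow> state \<Rightarrow> bool" for w :: nat where
  Skip: "exec w Skip s 1 s"
| Assign: "exec w (Assign r x) s (1 + acost x) (set_reg r (aval w x s) s)"
| Store: "exec w (Store a i x) s (1 + acost i + acost x)
            (set_array a (aval w i s) (aval w x s) s)"
| Seq: "exec w c s t s' \<Longrightarrow> exec w d s' t' s'' \<Longrightarrow> exec w (Seq c d) s (1 + t + t') s''"
| CondTrue: "bval w b s \<Longrightarrow> exec w c s t s' \<Longrightarrow> exec w (Cond b c d) s (1 + bcost b + t) s'"
| CondFalse: "\<not> bval w b s \<Longrightarrow> exec w d s t s' \<Longrightarrow> exec w (Cond b c d) s (1 + bcost b + t) s'"
| WhileFalse: "\<not> bval w b s \<Longrightarrow> exec w (While b c) s (1 + bcost b) s"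
| WhileTrue: "bval w b s \<Longrightarrow> exec w c s t s' \<Longrightarrow> exec w (While b c) s' t' s'' \<Longrightarrow>
    exec w (While b c) s (1 + bcost b + t + t') s''"

inductive_cases exec_SkipE: "exec w Skip s t s'"
inductive_cases exec_AssignE: "exec w (Assign r x) s t s'"
inductive_cases exec_StoreE: "exec w (Store a i x) s t s'"
inductive_cases exec_SeqE: "exec w (Seq c d) s t s'"
inductive_cases exec_CondE: "exec w (Cond b c d) s t s'"
inductive_cases exec_WhileE: "exec w (While b c) s t s'"

lemma exec_deterministic:
  "exec w c s t s' \<Longrightarrow> exec w c s u r \<Longrightarrow> u = t \<and> r = s'"
proof (induction arbitrary: u r rule: exec.induct)
  case (Skip s)
  then show ?case by (auto elim: exec_SkipE)
next
  case (Assign r x s)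
  then show ?case by (auto elim: exec_AssignE)
next
  case (Store a i x s)
  then show ?case by (auto elim: exec_StoreE)
next
  case (Seq c s t s' d t' s'')
  from Seq.prems obtain t1 r1 t2
    where "exec w c s t1 r1" and d: "exec w d r1 t2 r" and u: "u = Suc (t1 + t2)"
    by (rule exec_SeqE)
  with Seq.IH(1) have "t1 = t" "r1 = s'" by auto
  with d u Seq.IH(2) show ?case by auto
next
  case (CondTrue b s c t s' d)
  from CondTrue.prems obtain t1 where "exec w c s t1 r" "u = Suc (bcost b + t1)"
    by (rule exec_CondE) (use CondTrue.hyps in auto)
  with CondTrue.IH show ?case by auto
next
  case (CondFalse b s d t s' c)
  from CondFalse.prems obtain t1 where "exec w d s t1 r" "u = Suc (bcost b + t1)"
    by (rule exec_CondE) (use CondFalse.hyps in auto)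
  with CondFalse.IH show ?case by auto
next
  case (WhileFalse b s c)
  from WhileFalse.prems show ?case
    by (rule exec_WhileE) (use WhileFalse.hyps in auto)
next
  case (WhileTrue b s c t s' t' s'')
  from WhileTrue.prems obtain t1 r1 t2
    where "exec w c s t1 r1" and l: "exec w (While b c) r1 t2 r"
      and u: "u = Suc (bcost b + t1 + t2)"
    by (rule exec_WhileE) (use WhileTrue.hyps in auto)
  with WhileTrue.IH(1) have "t1 = t" "r1 = s'" by auto
  with l u WhileTrue.IH(2) show ?case by auto
qed


section \<open>Linear-time decision problems on graphs\<close>

text \<open>The lists of neighbours may be in any order.\<close>

definition adjacency_lists :: "nat ugraph \<Rightarrow> nat list list \<Rightarrow> bool" where
  "adjacency_lists G L \<longleftrightarrow>
     vertices G = {..<length L} \<and>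
     (\<forall>v<length L. distinct (L ! v) \<and> set (L ! v) = neighbours G v)"

text \<open>
  Register \<open>0\<close> holds the number of vertices. Array \<open>1\<close> holds the adjacency lists one after
  the other, and the list of \<open>v\<close> occupies the cells from entry \<open>v\<close> of array \<open>0\<close> up to, but
  not including, entry \<open>v + 1\<close> of array \<open>0\<close>. All other registers and cells are \<open>0\<close>.
\<close>

definition input_state :: "nat list list \<Rightarrow> state" where
  "input_state L = State
     (\<lambda>r. if r = 0 then length L else 0)
     (\<lambda>a i. if a = 0 \<and> i \<le> length L then length (concat (take i L))
            else if a = 1 \<and> i < length (concat L) then concat L ! i
            else 0)"

text \<open>
  A single program has to work for all inputs from the class and for all word lengths \<open>w\<close>
  that are at least a fixed multiple \<open>k\<close> of \<open>log\<^sub>2 (n + m + 1)\<close>; so \<open>O(log (n + m))\<close> bits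
  per word suffice. The answer is left in register \<open>0\<close>. Nothing is required on inputs
  outside the class.
\<close>

definition solvable_in_linear_time :: "nat ugraph set \<Rightarrow> (nat ugraph \<Rightarrow> bool) \<Rightarrow> bool" where
  "solvable_in_linear_time \<G> P \<longleftrightarrow>
     (\<exists>prog k c. \<forall>G\<in>\<G>. \<forall>L w.
        let n = card (vertices G); m = card (edges G) in
          adjacency_lists G L \<and> (n + m + 1) ^ k \<le> 2 ^ w \<longrightarrow>
          (\<exists>t s. exec w prog (input_state L) t s \<and> t \<le> c * (n + m) \<and>
                 regs s 0 = (if P G then 1 else 0)))"

definition d_max_diameter :: "nat ugraph set \<Rightarrow> nat ugraph \<Rightarrow> bool" where
  "d_max_diameter \<G> G \<longleftrightarrow> diameter G = d_max \<G>"

end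

theory Submission
  imports Defs
begin

text \<open>
  If \<open>t\<close> is the order of the smallest path containing \<open>H\<close>, then \<open>D = d_max = t - 2\<close>. For \<open>D \<le> 2\<close> the
  question is answered by \<open>n\<close> and the sum of the degrees. Otherwise start from any vertex and move
  twice to a vertex at maximal distance that, among those, has the fewest neighbours closer to the
  current vertex. If \<open>u\<close> and \<open>v\<close> are at distance \<open>D\<close>, then forbidding \<open>H\<close> leaves few possible pairs of
  distances from \<open>u\<close> and \<open>v\<close> to a vertex of eccentricity less than \<open>D\<close>, and a comparison with the
  neighbours of \<open>u\<close> or \<open>v\<close> shows that one of the three vertices seen has eccentricity \<open>D\<close>. Only for
  \<open>H = P_4 + P_1\<close> is the second move needed. As \<open>D \<le> 6\<close>, all distances from a vertex are found in
  \<open>D\<close> passes over the adjacency lists.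
\<close>

section \<open>Induced subgraphs and linear forests\<close>

text \<open>The obstacle is a tie: an end \<open>v\<close> of a diametral pair \<open>u\<close>,
  \<open>v\<close> may be only one of several vertices farthest from \<open>x\<close>. The rule of
  fewest inner neighbours settles this by strict inclusion: where a tie could do harm, the inner
  neighbours of one of the two ends are all adjacent to the chosen \<open>y\<close>, and
  \<open>y\<close> has a further one, so that end would have been preferred. This is used for
  \<open>P_3 + P_1\<close>, \<open>P_4 + P_1\<close> and \<open>2P_2 + P_1\<close>; for
  \<open>P_3 + 2P_1\<close> and \<open>P_2 + 3P_1\<close>, bounds on distances suffice. The many
  possible \<open>H\<close> reduce to few: an induced subgraph of \<open>P_2 + 3P_1\<close>,
  \<open>P_3 + 2P_1\<close> or \<open>P_4 + P_1\<close> embeds into a forest that depends only on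
  \<open>t\<close>. The graph \<open>2P_2 + P_1\<close> stands alone: its subgraph
  \<open>2P_2\<close> has \<open>t = 5\<close> but is not contained in
  \<open>P_3 + P_1\<close>.\<close>

lemma simple_graph_edge: "simple_graph G \<Longrightarrow> {u, v} \<in> edges G \<Longrightarrow> u \<in> vertices G \<and> v \<in> vertices G \<and> u \<noteq> v"
  unfolding simple_graph_def by (metis doubleton_eq_iff)

lemma simple_graph_edgeE:
  assumes "simple_graph G" "e \<in> edges G"
  obtains u v where "u \<in> vertices G" "v \<in> vertices G" "u \<noteq> v" "e = {u, v}"
  using assms unfolding simple_graph_def by blast

text \<open>In simple graphs every edge is a doubleton, so equality of the two edge sets comes down
  to a test on pairs of vertices. Later embeddings are verified in this form.\<close>

lemma induced_subgraph_iff: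
  assumes H: "simple_graph H" and G: "simple_graph G"
  shows "H \<subseteq>\<^sub>i G \<longleftrightarrow> (\<exists>f. inj_on f (vertices H) \<and> f ` vertices H \<subseteq> vertices G \<and>
    (\<forall>x\<in>vertices H. \<forall>y\<in>vertices H. {x, y} \<in> edges H \<longleftrightarrow> {f x, f y} \<in> edges G))"
proof
  assume "H \<subseteq>\<^sub>i G"
  then obtain S f where S: "S \<subseteq> vertices G" and f: "bij_betw f (vertices H) S"
    and E: "(\<lambda>e. f ` e) ` edges H = {e \<in> edges G. e \<subseteq> S}"
    unfolding induced_subgraph_of_def isomorphic_def induced_on_def by auto
  have inj: "inj_on f (vertices H)" and im: "f ` vertices H = S"
    using f unfolding bij_betw_def by auto
  have "{x, y} \<in> edges H \<longleftrightarrow> {f x, f y} \<in> edges G" if x: "x \<in> vertices H" and y: "y \<in> vertices H" for x y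
  proof
    assume "{x, y} \<in> edges H"
    then have "f ` {x, y} \<in> (\<lambda>e. f ` e) ` edges H" by (rule imageI)
    then show "{f x, f y} \<in> edges G" unfolding E by simp
  next
    assume "{f x, f y} \<in> edges G"
    then have "f ` {x, y} \<in> (\<lambda>e. f ` e) ` edges H" unfolding E using x y im by auto
    then obtain e where e: "e \<in> edges H" "f ` {x, y} = f ` e" by (rule imageE)
    have "e \<subseteq> vertices H" using H e(1) by (auto elim: simple_graph_edgeE)
    then have "{x, y} = e" using e(2) inj x y by (simp add: inj_on_image_eq_iff del: image_insert)
    then show "{x, y} \<in> edges H" using e(1) by simp
  qed
  then show "\<exists>f. inj_on f (vertices H) \<and> f ` vertices H \<subseteq> vertices G \<and>
    (\<forall>x\<in>vertices H. \<forall>y\<in>vertices H. {x, y} \<in> edges H \<longleftrightarrow> {f x, f y} \<in> edges G)"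
    using inj im S by blast
next
  assume "\<exists>f. inj_on f (vertices H) \<and> f ` vertices H \<subseteq> vertices G \<and>
    (\<forall>x\<in>vertices H. \<forall>y\<in>vertices H. {x, y} \<in> edges H \<longleftrightarrow> {f x, f y} \<in> edges G)"
  then obtain f where inj: "inj_on f (vertices H)" and im: "f ` vertices H \<subseteq> vertices G"
    and E: "\<And>x y. x \<in> vertices H \<Longrightarrow> y \<in> vertices H \<Longrightarrow> {x, y} \<in> edges H \<longleftrightarrow> {f x, f y} \<in> edges G"
    by blast
  have "(\<lambda>e. f ` e) ` edges H = {e \<in> edges G. e \<subseteq> f ` vertices H}"
  proof (intro equalityI subsetI)
    fix e' assume "e' \<in> (\<lambda>e. f ` e) ` edges H"
    then obtain e where e: "e \<in> edges H" "e' = f ` e" by blast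
    obtain u v where "u \<in> vertices H" "v \<in> vertices H" "e = {u, v}"
      using H e(1) by (rule simple_graph_edgeE)
    then show "e' \<in> {e \<in> edges G. e \<subseteq> f ` vertices H}" using e E by auto
  next
    fix e assume e: "e \<in> {e \<in> edges G. e \<subseteq> f ` vertices H}"
    then obtain a b where ab: "e = {a, b}" using G by (auto elim: simple_graph_edgeE)
    then obtain x y where "x \<in> vertices H" "y \<in> vertices H" "a = f x" "b = f y" using e by auto
    then have "{x, y} \<in> edges H" "e = f ` {x, y}" using E e ab by auto
    then show "e \<in> (\<lambda>e. f ` e) ` edges H" by blast
  qed
  then have "isomorphic H (induced_on G (f ` vertices H))"
    unfolding isomorphic_def induced_on_def using inj by (auto simp: bij_betw_def)
  then show "H \<subseteq>\<^sub>i G" unfolding induced_subgraph_of_def using im by blast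
qed

lemma induced_subgraph_trans:
  assumes "simple_graph G" "simple_graph H" "simple_graph K" "G \<subseteq>\<^sub>i H" "H \<subseteq>\<^sub>i K"
  shows "G \<subseteq>\<^sub>i K"
proof -
  obtain f where f: "inj_on f (vertices G)" "f ` vertices G \<subseteq> vertices H"
    "\<forall>x\<in>vertices G. \<forall>y\<in>vertices G. {x, y} \<in> edges G \<longleftrightarrow> {f x, f y} \<in> edges H"
    using assms induced_subgraph_iff by blast
  obtain g where g: "inj_on g (vertices H)" "g ` vertices H \<subseteq> vertices K"
    "\<forall>x\<in>vertices H. \<forall>y\<in>vertices H. {x, y} \<in> edges H \<longleftrightarrow> {g x, g y} \<in> edges K"
    using assms induced_subgraph_iff by blast
  have "inj_on (g \<circ> f) (vertices G)" using f g by (meson comp_inj_on inj_on_subset)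
  moreover have "(g \<circ> f) ` vertices G \<subseteq> vertices K" using f g by fastforce
  moreover have "\<forall>x\<in>vertices G. \<forall>y\<in>vertices G. {x, y} \<in> edges G \<longleftrightarrow> {(g \<circ> f) x, (g \<circ> f) y} \<in> edges K"
    using f(2,3) g(3) by (simp add: image_subset_iff)
  ultimately show ?thesis using induced_subgraph_iff assms by blast
qed

lemma isomorphic_induced_subgraph: "simple_graph K \<Longrightarrow> isomorphic H K \<Longrightarrow> H \<subseteq>\<^sub>i K"
proof -
  assume "simple_graph K" "isomorphic H K"
  moreover from this have "induced_on K (vertices K) = K"
    unfolding induced_on_def by (cases K) (auto elim: simple_graph_edgeE)
  ultimately show ?thesis unfolding induced_subgraph_of_def by (metis order_refl)
qed

text \<open>A finite set of natural numbers encodes a linear forest: consecutive numbers are adjacent.\<close>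

definition linear_forest :: "nat set \<Rightarrow> nat ugraph" where
  "linear_forest T = Graph T {{i, Suc i} | i. i \<in> T \<and> Suc i \<in> T}"

lemma vertices_linear_forest [simp]: "vertices (linear_forest T) = T"
  by (simp add: linear_forest_def)

lemma edges_linear_forest:
  "{x, y} \<in> edges (linear_forest T) \<longleftrightarrow> x \<in> T \<and> y \<in> T \<and> (y = Suc x \<or> x = Suc y)"
  unfolding linear_forest_def by (auto simp: doubleton_eq_iff)

lemma simple_linear_forest: "finite T \<Longrightarrow> simple_graph (linear_forest T)"
  unfolding simple_graph_def linear_forest_def by simp (metis n_not_Suc_n)

lemma path_graph_linear_forest: "path_graph t = linear_forest {..<t}"
  unfolding path_graph_def linear_forest_def by (auto simp: Suc_lessD)

lemma linear_forest_mono: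
  assumes "finite T" "S \<subseteq> T" shows "linear_forest S \<subseteq>\<^sub>i linear_forest T"
  using assms finite_subset[OF assms(2)]
  by (subst induced_subgraph_iff) (auto simp: simple_linear_forest edges_linear_forest intro!: exI[of _ id])

text \<open>Shifting the image \<open>S\<close> of \<open>H\<close> by one gives a set that meets
  \<open>S\<close> in one point per edge, and \<open>S\<close> and its shift together lie in
  \<open>{..t}\<close>, which has \<open>t + 1\<close> elements.\<close>

lemma induced_subgraph_path_graph_card:
  assumes H: "simple_graph H" and sub: "H \<subseteq>\<^sub>i path_graph t"
  shows "2 * card (vertices H) \<le> card (edges H) + t + 1"
proof -
  obtain S f where S: "S \<subseteq> {..<t}" and f: "bij_betw f (vertices H) S"
    and E: "(\<lambda>e. f ` e) ` edges H = {e \<in> edges (linear_forest {..<t}). e \<subseteq> S}"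
    using sub unfolding path_graph_linear_forest induced_subgraph_of_def isomorphic_def induced_on_def
    by auto
  have fin: "finite S" using S finite_subset by blast
  have "edges H \<subseteq> Pow (vertices H)" using H by (auto elim: simple_graph_edgeE)
  moreover have "inj_on (\<lambda>e. f ` e) (Pow (vertices H))"
    using f by (simp add: bij_betw_def inj_on_image_Pow)
  ultimately have cE: "card (edges H) = card {e \<in> edges (linear_forest {..<t}). e \<subseteq> S}"
    unfolding E[symmetric] by (intro card_image[symmetric]) (rule inj_on_subset)
  have "finite (edges H)"
    using \<open>edges H \<subseteq> Pow (vertices H)\<close> H finite_subset unfolding simple_graph_def by blast
  then have fin2: "finite {e \<in> edges (linear_forest {..<t}). e \<subseteq> S}"
    unfolding E[symmetric] by (rule finite_imageI)
  have "(\<lambda>i. {i, Suc i}) ` {i \<in> S. Suc i \<in> S} \<subseteq> {e \<in> edges (linear_forest {..<t}). e \<subseteq> S}"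
    using S by (auto simp: edges_linear_forest)
  moreover have "inj_on (\<lambda>i. {i, Suc i}) {i \<in> S. Suc i \<in> S}"
    by (auto simp: inj_on_def doubleton_eq_iff)
  ultimately have pairs: "card {i \<in> S. Suc i \<in> S} \<le> card (edges H)"
    unfolding cE by (intro card_inj_on_le[OF _ _ fin2])
  have "Suc ` {i \<in> S. Suc i \<in> S} = S \<inter> Suc ` S" by auto
  then have "card (S \<inter> Suc ` S) = card {i \<in> S. Suc i \<in> S}"
    using card_image[of Suc "{i \<in> S. Suc i \<in> S}"] by simp
  then have "card (S \<inter> Suc ` S) \<le> card (edges H)" using pairs by simp
  moreover have "card (S \<union> Suc ` S) + card (S \<inter> Suc ` S) = card S + card (Suc ` S)"
    using fin card_Un_Int[of S "Suc ` S"] by simp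
  moreover have "S \<union> Suc ` S \<subseteq> {..t}" using S by auto
  then have "card (S \<union> Suc ` S) \<le> t + 1" using card_mono[of "{..t}" "S \<union> Suc ` S"] by simp
  moreover have "card (Suc ` S) = card S" by (simp add: card_image)
  moreover have "card S = card (vertices H)" using f by (simp add: bij_betw_same_card)
  ultimately show ?thesis by linarith
qed

text \<open>A backtracking search: \<open>m\<close> is the partial map built so far, and
  \<open>x\<close> may go to \<open>t\<close> only if adjacency and non-adjacency to all mapped
  vertices are preserved. Being executable, it settles the finitely many forests by
  evaluation.\<close>

fun embeddable :: "nat list \<Rightarrow> nat list \<Rightarrow> (nat \<times> nat) list \<Rightarrow> bool" where
  "embeddable [] ts m \<longleftrightarrow> True"
| "embeddable (x # xs) ts m \<longleftrightarrow> (\<exists>t\<in>set ts. (\<forall>(y, s)\<in>set m. t \<noteq> s \<and>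
     ((y = Suc x \<or> x = Suc y) \<longleftrightarrow> (s = Suc t \<or> t = Suc s))) \<and> embeddable xs ts ((x, t) # m))"

lemma embeddable_sound:
  assumes "embeddable xs ts m" "distinct xs" "distinct (map fst m)" "set xs \<inter> fst ` set m = {}"
    and "\<And>x t. (x, t) \<in> set m \<Longrightarrow> t \<in> set ts"
    and "\<And>x t y s. (x, t) \<in> set m \<Longrightarrow> (y, s) \<in> set m \<Longrightarrow> x \<noteq> y \<Longrightarrow>
      t \<noteq> s \<and> ((y = Suc x \<or> x = Suc y) \<longleftrightarrow> (s = Suc t \<or> t = Suc s))"
  shows "\<exists>f. \<forall>x\<in>set xs \<union> fst ` set m. f x \<in> set ts \<and> (\<forall>y\<in>set xs \<union> fst ` set m. x \<noteq> y \<longrightarrow>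
    f x \<noteq> f y \<and> ((y = Suc x \<or> x = Suc y) \<longleftrightarrow> (f y = Suc (f x) \<or> f x = Suc (f y))))"
  using assms
proof (induction xs ts m rule: embeddable.induct)
  case (1 ts m)
  show ?case
  proof (intro exI[of _ "\<lambda>x. the (map_of m x)"] ballI conjI impI)
    fix x assume "x \<in> set [] \<union> fst ` set m"
    then obtain t where "(x, t) \<in> set m" by auto
    then show "the (map_of m x) \<in> set ts" using 1 by simp
  next
    fix x y assume "x \<in> set [] \<union> fst ` set m" "y \<in> set [] \<union> fst ` set m" "x \<noteq> y"
    then obtain t s where "(x, t) \<in> set m" "(y, s) \<in> set m" by auto
    then show "the (map_of m x) \<noteq> the (map_of m y)"
      "(y = Suc x \<or> x = Suc y) = (the (map_of m y) = Suc (the (map_of m x)) \<or>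
         the (map_of m x) = Suc (the (map_of m y)))"
      using 1 \<open>x \<noteq> y\<close> by simp_all
  qed
next
  case (2 x xs ts m)
  from 2(2)[unfolded embeddable.simps] obtain t where t: "t \<in> set ts"
    "\<forall>(y, s)\<in>set m. t \<noteq> s \<and> ((y = Suc x \<or> x = Suc y) \<longleftrightarrow> (s = Suc t \<or> t = Suc s))"
    "embeddable xs ts ((x, t) # m)"
    by (elim bexE conjE) (rule that)
  have set_eq: "set xs \<union> fst ` set ((x, t) # m) = set (x # xs) \<union> fst ` set m" by auto
  show ?case
    unfolding set_eq[symmetric]
  proof (rule 2(1)[OF t(1) t(3)])
    show "\<And>xa ta. (xa, ta) \<in> set ((x, t) # m) \<Longrightarrow> ta \<in> set ts" using 2(6) t(1) by auto
    show "ta \<noteq> s \<and> ((y = Suc xa \<or> xa = Suc y) \<longleftrightarrow> (s = Suc ta \<or> ta = Suc s))"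
      if "(xa, ta) \<in> set ((x, t) # m)" "(y, s) \<in> set ((x, t) # m)" "xa \<noteq> y" for xa ta y s
      using that 2(7) t(2) by auto
  next
    show "distinct xs" "distinct (map fst ((x, t) # m))" "set xs \<inter> fst ` set ((x, t) # m) = {}"
      using 2(3-5) by auto
  qed
qed

text \<open>For each path order \<open>t\<close>, the largest relevant forest: \<open>P_1\<close> to
  \<open>P_4\<close>, then \<open>P_3 + P_1\<close>, \<open>P_4 + P_1\<close>,
  \<open>P_3 + 2P_1\<close> and \<open>P_2 + 3P_1\<close>. The empty forest (\<open>t = 0\<close>)
  shares the entry of \<open>P_1\<close>.\<close>

definition pattern :: "nat \<Rightarrow> nat list" where
  "pattern t = (if t \<le> 1 then [0] else if t = 2 then [0, 1] else if t = 3 then [0, 1, 2]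
     else if t = 4 then [0, 1, 2, 3] else if t = 5 then [0, 1, 2, 4] else if t = 6 then [0, 1, 2, 3, 5]
     else if t = 7 then [0, 1, 2, 4, 6] else [0, 1, 3, 5, 7])"

text \<open>Vertices plus components minus one, the number of components being vertices minus edges:
  in a path, consecutive components are separated by one vertex.\<close>

definition path_order :: "nat list \<Rightarrow> nat" where
  "path_order xs = 2 * length xs - length (filter (\<lambda>i. Suc i \<in> set xs) xs) - 1"

lemma embeddable_patterns:
  "list_all (\<lambda>xs. path_order xs \<le> 8 \<and> embeddable xs (pattern (path_order xs)) [])
     (subseqs [0, 1, 3, 5, 7] @ subseqs [0, 1, 2, 4, 6] @ subseqs [0, 1, 2, 3, 5])"
  by code_simp

section \<open>The given forests as sets of natural numbers\<close>

lemma edges_graph_sum: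
  "{Inl x, Inl y} \<in> edges (graph_sum G H) \<longleftrightarrow> {x, y} \<in> edges G" (is ?l)
  "{Inr x', Inr y'} \<in> edges (graph_sum G H) \<longleftrightarrow> {x', y'} \<in> edges H" (is ?r)
  "{Inl x, Inr y'} \<notin> edges (graph_sum G H)" (is ?lr)
  "{Inr y', Inl x} \<notin> edges (graph_sum G H)" (is ?rl)
proof -
  have l: "Inl ` e = {Inl x, Inl y} \<longleftrightarrow> e = {x, y}" for e :: "'a set" and x y
    using inj_image_eq_iff[OF inj_Inl, of e "{x, y}"] by simp
  have r: "Inr ` e = {Inr x, Inr y} \<longleftrightarrow> e = {x, y}" for e :: "'b set" and x y
    using inj_image_eq_iff[OF inj_Inr, of e "{x, y}"] by simp
  have e: "z \<in> edges (graph_sum G H) \<longleftrightarrow> (\<exists>e\<in>edges G. Inl ` e = z) \<or> (\<exists>e\<in>edges H. Inr ` e = z)" for z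
    unfolding graph_sum_def by auto
  have n: "Inr ` e \<noteq> insert (Inl x) A" "Inl ` e' \<noteq> insert (Inr y) A'" "Inl ` e' \<noteq> {Inl x', Inr y}"
    "Inr ` e \<noteq> {Inr y, Inl x}" for e :: "'b set" and e' :: "'a set" and x x' y A A'
    by auto
  show ?l ?r ?lr ?rl unfolding e by (simp_all add: l r n)
qed

lemma simple_graph_sum:
  assumes "simple_graph G" "simple_graph H" shows "simple_graph (graph_sum G H)"
  unfolding simple_graph_def
proof (intro conjI ballI)
  show "finite (vertices (graph_sum G H))"
    using assms unfolding simple_graph_def graph_sum_def by simp
  fix e assume "e \<in> edges (graph_sum G H)"
  then consider e' where "e' \<in> edges G" "e = Inl ` e'" | e' where "e' \<in> edges H" "e = Inr ` e'"
    unfolding graph_sum_def by auto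
  then show "\<exists>u\<in>vertices (graph_sum G H). \<exists>v\<in>vertices (graph_sum G H). u \<noteq> v \<and> e = {u, v}"
  proof cases
    case 1
    obtain u v where "u \<in> vertices G" "v \<in> vertices G" "u \<noteq> v" "e' = {u, v}"
      using assms(1) 1(1) by (rule simple_graph_edgeE)
    then show ?thesis using 1(2)
      by (intro bexI[of _ "Inl u"] bexI[of _ "Inl v"]) (auto simp: graph_sum_def)
  next
    case 2
    obtain u v where "u \<in> vertices H" "v \<in> vertices H" "u \<noteq> v" "e' = {u, v}"
      using assms(2) 2(1) by (rule simple_graph_edgeE)
    then show ?thesis using 2(2)
      by (intro bexI[of _ "Inr u"] bexI[of _ "Inr v"]) (auto simp: graph_sum_def)
  qed
qed

lemma simple_path_graph: "simple_graph (path_graph t)"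
  unfolding path_graph_linear_forest by (rule simple_linear_forest) simp

lemma edges_copies:
  "{(i, x), (j, y)} \<in> edges (copies s G) \<longleftrightarrow> i < s \<and> i = j \<and> {x, y} \<in> edges G"
proof -
  have r: "Pair i ` e = {(i, x), (i, y)} \<longleftrightarrow> e = {x, y}" for e i
    using inj_image_eq_iff[of "Pair i" e "{x, y}"] by (simp add: inj_on_def)
  have "{(i, x), (j, y)} \<in> edges (copies s G) \<longleftrightarrow> (\<exists>k e. {(i, x), (j, y)} = Pair k ` e \<and> k < s \<and> e \<in> edges G)"
    unfolding copies_def by simp
  also have "\<dots> \<longleftrightarrow> i < s \<and> i = j \<and> {x, y} \<in> edges G"
  proof
    assume "\<exists>k e. {(i, x), (j, y)} = Pair k ` e \<and> k < s \<and> e \<in> edges G"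
    then obtain k e where k: "{(i, x), (j, y)} = Pair k ` e" "k < s" "e \<in> edges G" by auto
    then have "i = k" "j = k" by auto
    then show "i < s \<and> i = j \<and> {x, y} \<in> edges G" using k r[of k e] by auto
  next
    assume "i < s \<and> i = j \<and> {x, y} \<in> edges G"
    then show "\<exists>k e. {(i, x), (j, y)} = Pair k ` e \<and> k < s \<and> e \<in> edges G"
      by (intro exI[of _ i] exI[of _ "{x, y}"]) auto
  qed
  finally show ?thesis .
qed

lemma simple_copies:
  assumes "simple_graph G" shows "simple_graph (copies s G)"
  unfolding simple_graph_def
proof (intro conjI ballI)
  show "finite (vertices (copies s G))"
    using assms unfolding simple_graph_def copies_def by simp
  fix e assume "e \<in> edges (copies s G)"
  then obtain i e' where e: "e' \<in> edges G" "e = Pair i ` e'" "i < s" unfolding copies_def by auto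
  obtain u v where "u \<in> vertices G" "v \<in> vertices G" "u \<noteq> v" "e' = {u, v}"
    using assms e(1) by (rule simple_graph_edgeE)
  then show "\<exists>u\<in>vertices (copies s G). \<exists>v\<in>vertices (copies s G). u \<noteq> v \<and> e = {u, v}"
    using e by (intro bexI[of _ "(i, u)"] bexI[of _ "(i, v)"]) (auto simp: copies_def)
qed

lemma linear_forest_embedI:
  assumes "simple_graph H" "finite T" "\<And>x. x \<in> vertices H \<Longrightarrow> f x \<in> T"
    and "\<And>x y. x \<in> vertices H \<Longrightarrow> y \<in> vertices H \<Longrightarrow> f x = f y \<Longrightarrow> x = y"
    and "\<And>x y. x \<in> vertices H \<Longrightarrow> y \<in> vertices H \<Longrightarrow>
      {x, y} \<in> edges H \<longleftrightarrow> f y = Suc (f x) \<or> f x = Suc (f y)"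
  shows "H \<subseteq>\<^sub>i linear_forest T"
  unfolding induced_subgraph_iff[OF assms(1) simple_linear_forest[OF assms(2)]] vertices_linear_forest
proof (intro exI[of _ f] conjI ballI)
  show "inj_on f (vertices H)" by (rule inj_onI) (rule assms(4))
  show "f ` vertices H \<subseteq> T" using assms(3) by (rule image_subsetI)
  show "{x, y} \<in> edges H \<longleftrightarrow> {f x, f y} \<in> edges (linear_forest T)"
    if "x \<in> vertices H" "y \<in> vertices H" for x y
    unfolding edges_linear_forest using assms(3,5) that by simp
qed

lemma two_P2_P1_linear_forest:
  "graph_sum (copies 2 (path_graph 2)) (path_graph 1) \<subseteq>\<^sub>i linear_forest {0, 1, 3, 4, 6}"
  (is "?G \<subseteq>\<^sub>i _")
proof (rule linear_forest_embedI)
  \<comment> \<open>One number is left out after each component, so that vertices of different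
    components are never consecutive.\<close>
  let ?f = "case_sum (\<lambda>(i, a). 3 * i + a) (\<lambda>_. 6)"
  have v: "x \<in> vertices ?G \<longleftrightarrow>
      x = Inl (0, 0) \<or> x = Inl (0, 1) \<or> x = Inl (1, 0) \<or> x = Inl (1, 1) \<or> x = Inr 0" for x
    unfolding graph_sum_def copies_def path_graph_def
    by (auto simp: less_Suc_eq numeral_2_eq_2)
  show "simple_graph ?G" by (intro simple_graph_sum simple_copies simple_path_graph)
  show "?f x \<in> {0, 1, 3, 4, 6}" if "x \<in> vertices ?G" for x
    using that unfolding v by (elim disjE; simp)
  show "x = y" if "x \<in> vertices ?G" "y \<in> vertices ?G" "?f x = ?f y" for x y
    using that unfolding v by (elim disjE; simp)
  show "{x, y} \<in> edges ?G \<longleftrightarrow> ?f y = Suc (?f x) \<or> ?f x = Suc (?f y)"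
    if "x \<in> vertices ?G" "y \<in> vertices ?G" for x y
    using that unfolding v unfolding path_graph_linear_forest
    by (elim disjE; simp add: edges_graph_sum edges_copies edges_linear_forest del: insert_absorb2)
qed simp

lemma P_plus_P1s_linear_forest:
  "graph_sum (path_graph a) (copies b (path_graph 1)) \<subseteq>\<^sub>i linear_forest ({..<a} \<union> (\<lambda>i. a + 2 * i + 1) ` {..<b})"
  (is "?G \<subseteq>\<^sub>i linear_forest ?T")
proof (rule linear_forest_embedI)
  let ?f = "case_sum (\<lambda>x. x) (\<lambda>(i, x). a + 2 * i + 1)"
  have v: "x \<in> vertices ?G \<longleftrightarrow> (\<exists>i<a. x = Inl i) \<or> (\<exists>i<b. x = Inr (i, 0))" for x
    unfolding graph_sum_def copies_def path_graph_def by auto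
  show "simple_graph ?G" by (intro simple_graph_sum simple_copies simple_path_graph)
  show "?f x \<in> ?T" if "x \<in> vertices ?G" for x
    using that unfolding v by auto
  show "x = y" if "x \<in> vertices ?G" "y \<in> vertices ?G" "?f x = ?f y" for x y
    using that unfolding v by auto
  show "{x, y} \<in> edges ?G \<longleftrightarrow> ?f y = Suc (?f x) \<or> ?f x = Suc (?f y)"
    if "x \<in> vertices ?G" "y \<in> vertices ?G" for x y
    using that unfolding v unfolding path_graph_linear_forest
    by (elim disjE exE conjE; auto simp: edges_graph_sum edges_copies edges_linear_forest simp del: insert_absorb2; presburger)
qed simp

lemma P_plus_P1_linear_forest:
  "graph_sum (path_graph a) (path_graph 1) \<subseteq>\<^sub>i linear_forest (insert (a + 1) {..<a})"
  (is "?G \<subseteq>\<^sub>i linear_forest ?T")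
proof (rule linear_forest_embedI)
  let ?f = "case_sum (\<lambda>x. x) (\<lambda>x. a + 1)"
  have v: "x \<in> vertices ?G \<longleftrightarrow> (\<exists>i<a. x = Inl i) \<or> x = Inr 0" for x
    unfolding graph_sum_def path_graph_def by auto
  show "simple_graph ?G" by (intro simple_graph_sum simple_path_graph)
  show "?f x \<in> ?T" if "x \<in> vertices ?G" for x
    using that unfolding v by auto
  show "x = y" if "x \<in> vertices ?G" "y \<in> vertices ?G" "?f x = ?f y" for x y
    using that unfolding v by auto
  show "{x, y} \<in> edges ?G \<longleftrightarrow> ?f y = Suc (?f x) \<or> ?f x = Suc (?f y)"
    if "x \<in> vertices ?G" "y \<in> vertices ?G" for x y
    using that unfolding v unfolding path_graph_linear_forest
    by (elim disjE exE conjE; auto simp: edges_graph_sum edges_linear_forest simp del: insert_absorb2)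
qed simp

text \<open>The image of an embedding replaces the abstract graph by a concrete set of numbers, for
  which vertices and edges can be counted and all cases enumerated.\<close>

lemma induced_subgraph_linear_forestE:
  assumes H: "simple_graph H" and T: "finite T" and sub: "H \<subseteq>\<^sub>i linear_forest T"
  obtains S where "S \<subseteq> T" "H \<subseteq>\<^sub>i linear_forest S" "card (vertices H) = card S"
    "card (edges H) = card {i \<in> S. Suc i \<in> S}"
proof -
  obtain f where inj: "inj_on f (vertices H)" and im: "f ` vertices H \<subseteq> T"
    and E: "\<And>x y. x \<in> vertices H \<Longrightarrow> y \<in> vertices H \<Longrightarrow>
      {x, y} \<in> edges H \<longleftrightarrow> {f x, f y} \<in> edges (linear_forest T)"
    using sub unfolding induced_subgraph_iff[OF H simple_linear_forest[OF T]] by auto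
  define S where "S = f ` vertices H"
  have E': "{x, y} \<in> edges H \<longleftrightarrow> f y = Suc (f x) \<or> f x = Suc (f y)"
    if "x \<in> vertices H" "y \<in> vertices H" for x y
    using E[OF that] that im unfolding edges_linear_forest by auto
  have fin: "finite S" unfolding S_def using finite_subset[OF im T] .
  have sub_S: "H \<subseteq>\<^sub>i linear_forest S"
    by (rule linear_forest_embedI[OF H fin]) (use inj E' in \<open>auto simp: S_def inj_on_def\<close>)
  have edge_im: "(\<lambda>e. f ` e) ` edges H = (\<lambda>i. {i, Suc i}) ` {i \<in> S. Suc i \<in> S}"
  proof (intro equalityI subsetI)
    fix e' assume "e' \<in> (\<lambda>e. f ` e) ` edges H"
    then obtain e where e: "e \<in> edges H" "e' = f ` e" by (rule imageE) simp
    obtain u v where uv: "u \<in> vertices H" "v \<in> vertices H" "e = {u, v}"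
      using H e(1) by (rule simple_graph_edgeE)
    then have "f v = Suc (f u) \<or> f u = Suc (f v)" using E' e(1) by simp
    moreover have "f u \<in> S" "f v \<in> S" using uv by (simp_all add: S_def)
    ultimately show "e' \<in> (\<lambda>i. {i, Suc i}) ` {i \<in> S. Suc i \<in> S}"
      using e(2) uv(3) by (auto simp: insert_commute)
  next
    fix e' assume "e' \<in> (\<lambda>i. {i, Suc i}) ` {i \<in> S. Suc i \<in> S}"
    then obtain i where i: "e' = {i, Suc i}" "i \<in> S" "Suc i \<in> S" by auto
    then obtain u v where uv: "u \<in> vertices H" "v \<in> vertices H" "f u = i" "f v = Suc i"
      unfolding S_def by (metis imageE)
    then have "{u, v} \<in> edges H" using E' by simp
    moreover have "e' = f ` {u, v}" using i uv by simp
    ultimately show "e' \<in> (\<lambda>e. f ` e) ` edges H" by (rule rev_image_eqI)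
  qed
  have "edges H \<subseteq> Pow (vertices H)" using H by (auto elim: simple_graph_edgeE)
  then have "card (edges H) = card ((\<lambda>e. f ` e) ` edges H)"
    using inj_on_subset[OF inj_on_image_Pow[OF inj]] by (simp add: card_image)
  also have "\<dots> = card {i \<in> S. Suc i \<in> S}"
    unfolding edge_im by (intro card_image) (auto simp: inj_on_def doubleton_eq_iff)
  finally have "card (edges H) = card {i \<in> S. Suc i \<in> S}" .
  moreover have "card (vertices H) = card S" unfolding S_def by (rule card_image[OF inj, symmetric])
  ultimately show thesis using that[of S] im sub_S unfolding S_def by simp
qed

lemma embeddable_linear_forest:
  assumes "distinct xs" "embeddable xs ts []"
  shows "linear_forest (set xs) \<subseteq>\<^sub>i linear_forest (set ts)"
proof -
  obtain f where f: "\<forall>x\<in>set xs. f x \<in> set ts \<and> (\<forall>y\<in>set xs. x \<noteq> y \<longrightarrow>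
    f x \<noteq> f y \<and> ((y = Suc x \<or> x = Suc y) \<longleftrightarrow> (f y = Suc (f x) \<or> f x = Suc (f y))))"
    using embeddable_sound[OF assms(2,1)] by auto
  show ?thesis
  proof (rule linear_forest_embedI)
    show "{x, y} \<in> edges (linear_forest (set xs)) \<longleftrightarrow> f y = Suc (f x) \<or> f x = Suc (f y)"
      if "x \<in> vertices (linear_forest (set xs))" "y \<in> vertices (linear_forest (set xs))" for x y
      unfolding edges_linear_forest using f that by (cases "x = y") auto
    show "x = y" if "x \<in> vertices (linear_forest (set xs))" "y \<in> vertices (linear_forest (set xs))"
      "f x = f y" for x y
      using f that by auto
  qed (use f in \<open>auto intro: simple_linear_forest\<close>)
qed

text \<open>The image of \<open>H\<close> is listed by one of the checked sublists
  \<open>xs\<close>, and \<open>t\<close> is its path order. The search embeds it into the pattern;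
  counting vertices and edges excludes a shorter path.\<close>

lemma pattern_cases:
  assumes H: "simple_graph H" and sub: "H \<subseteq>\<^sub>i linear_forest (set ys)"
    and ys: "ys \<in> {[0, 1, 3, 5, 7], [0, 1, 2, 4, 6], [0, 1, 2, 3, 5]}"
  shows "\<exists>t\<le>8. H \<subseteq>\<^sub>i linear_forest (set (pattern t)) \<and> (t \<le> 1 \<or> \<not> H \<subseteq>\<^sub>i path_graph (t - 1))"
proof -
  obtain S where S: "S \<subseteq> set ys" "H \<subseteq>\<^sub>i linear_forest S" "card (vertices H) = card S"
    "card (edges H) = card {i \<in> S. Suc i \<in> S}"
    using induced_subgraph_linear_forestE[OF H _ sub] by auto
  obtain xs where xs: "xs \<in> set (subseqs ys)" "set xs = S"
    using S(1) subseqs_powset[of ys] by (metis PowI imageE)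
  have dist: "distinct xs" using subseqs_distinctD[OF xs(1)] ys by auto
  define t where "t = path_order xs"
  have t: "t \<le> 8" "embeddable xs (pattern t) []"
    using embeddable_patterns xs(1) ys unfolding t_def list_all_iff set_append by blast+
  have "H \<subseteq>\<^sub>i linear_forest (set (pattern t))"
    using induced_subgraph_trans[OF H _ _ S(2)] embeddable_linear_forest[OF dist t(2)] xs(2)
    by (metis simple_linear_forest List.finite_set)
  moreover have "t \<le> 1 \<or> \<not> H \<subseteq>\<^sub>i path_graph (t - 1)"
  proof (intro disjCI notI)
    assume "\<not> \<not> H \<subseteq>\<^sub>i path_graph (t - 1)"
    then have "2 * card S \<le> card {i \<in> S. Suc i \<in> S} + (t - 1) + 1"
      using induced_subgraph_path_graph_card[OF H, of "t - 1"] S(3,4) by simp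
    moreover have "card S = length xs" using dist xs(2) by (metis distinct_card)
    moreover have "set (filter (\<lambda>i. Suc i \<in> set xs) xs) = {i \<in> S. Suc i \<in> S}" using xs(2) by auto
    then have "card {i \<in> S. Suc i \<in> S} = length (filter (\<lambda>i. Suc i \<in> set xs) xs)"
      using dist distinct_card[of "filter (\<lambda>i. Suc i \<in> set xs) xs"] by simp
    ultimately show "t \<le> 1" unfolding t_def path_order_def by linarith
  qed
  ultimately show ?thesis using t(1) by blast
qed

text \<open>For \<open>t \<ge> 2\<close>, the number \<open>t\<close> is the order of the smallest path that contains \<open>H\<close>,
  and connected \<open>H\<close>-free graphs have diameter at most \<open>t - 2\<close>.\<close>

lemma forbidden_graph_cases:
  assumes H: "simple_graph H"
    and cases: "isomorphic H (graph_sum (copies 2 (path_graph 2)) (path_graph 1)) \<or>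
         H \<subseteq>\<^sub>i graph_sum (path_graph 2) (copies 3 (path_graph 1)) \<or>
         H \<subseteq>\<^sub>i graph_sum (path_graph 3) (copies 2 (path_graph 1)) \<or>
         H \<subseteq>\<^sub>i graph_sum (path_graph 4) (path_graph 1)"
  shows "(H \<subseteq>\<^sub>i linear_forest {0, 1, 3, 4, 6} \<and> \<not> H \<subseteq>\<^sub>i path_graph 6) \<or>
    (\<exists>t\<le>8. H \<subseteq>\<^sub>i linear_forest (set (pattern t)) \<and> (t \<le> 1 \<or> \<not> H \<subseteq>\<^sub>i path_graph (t - 1)))"
proof -
  have via: "H \<subseteq>\<^sub>i linear_forest T" if "H \<subseteq>\<^sub>i K" "simple_graph K" "K \<subseteq>\<^sub>i linear_forest T" "finite T"
    for K :: "'b ugraph" and T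
    using induced_subgraph_trans[OF H that(2) simple_linear_forest[OF that(4)] that(1,3)] .
  consider "isomorphic H (graph_sum (copies 2 (path_graph 2)) (path_graph 1))"
    | "H \<subseteq>\<^sub>i graph_sum (path_graph 2) (copies 3 (path_graph 1))"
    | "H \<subseteq>\<^sub>i graph_sum (path_graph 3) (copies 2 (path_graph 1))"
    | "H \<subseteq>\<^sub>i graph_sum (path_graph 4) (path_graph 1)"
    using cases by blast
  then show ?thesis
  proof cases
    case 1
    let ?K = "graph_sum (copies 2 (path_graph 2)) (path_graph 1)"
    have K: "simple_graph ?K" by (intro simple_graph_sum simple_copies simple_path_graph)
    have sub: "H \<subseteq>\<^sub>i linear_forest {0, 1, 3, 4, 6}"
      by (rule induced_subgraph_trans[OF H K simple_linear_forest isomorphic_induced_subgraph[OF K 1]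
          two_P2_P1_linear_forest]) simp
    have "card (vertices H) = card (vertices ?K)"
      using 1 bij_betw_same_card unfolding isomorphic_def by blast
    also have "\<dots> = 5" unfolding graph_sum_def copies_def path_graph_def
      by (simp add: card_Plus card_cartesian_product)
    finally have c5: "card (vertices H) = 5" .
    obtain S where S: "S \<subseteq> {0, 1, 3, 4, 6}" "card (vertices H) = card S"
      "card (edges H) = card {i \<in> S. Suc i \<in> S}"
      using induced_subgraph_linear_forestE[OF H _ sub] by auto
    have "S = {0, 1, 3, 4, 6}" by (rule card_subset_eq) (use S c5 in auto)
    then have "{i \<in> S. Suc i \<in> S} = {0, 3}" by auto
    then have "card (edges H) = 2" using S(3) by simp
    \<comment> \<open>Five vertices and two edges would require
      \<open>10 \<le> 2 + 6 + 1\<close>.\<close>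
    then have "\<not> H \<subseteq>\<^sub>i path_graph 6" using induced_subgraph_path_graph_card[OF H, of 6] c5 by auto
    then show ?thesis using sub by blast
  next
    case 2
    have "{..<2} \<union> (\<lambda>i. 2 + 2 * i + 1) ` {..<3} = set [0, 1, 3, 5, 7::nat]"
      by (auto simp: lessThan_nat_numeral lessThan_Suc)
    then have "H \<subseteq>\<^sub>i linear_forest (set [0, 1, 3, 5, 7])"
      using via[OF 2 _ P_plus_P1s_linear_forest] simple_graph_sum simple_copies simple_path_graph
      by (metis List.finite_set)
    then show ?thesis using pattern_cases[OF H] by blast
  next
    case 3
    have "{..<3} \<union> (\<lambda>i. 3 + 2 * i + 1) ` {..<2} = set [0, 1, 2, 4, 6::nat]"
      by (auto simp: lessThan_nat_numeral lessThan_Suc)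
    then have "H \<subseteq>\<^sub>i linear_forest (set [0, 1, 2, 4, 6])"
      using via[OF 3 _ P_plus_P1s_linear_forest] simple_graph_sum simple_copies simple_path_graph
      by (metis List.finite_set)
    then show ?thesis using pattern_cases[OF H] by blast
  next
    case 4
    have "insert (4 + 1) {..<4} = set [0, 1, 2, 3, 5::nat]"
      by (auto simp: lessThan_nat_numeral lessThan_Suc)
    then have "H \<subseteq>\<^sub>i linear_forest (set [0, 1, 2, 3, 5])"
      using via[OF 4 _ P_plus_P1_linear_forest] simple_graph_sum simple_path_graph
      by (metis List.finite_set)
    then show ?thesis using pattern_cases[OF H] by blast
  qed
qed

section \<open>Farthest vertices in a geodesic metric\<close>

text \<open>The distances of a connected graph, abstracted. As \<open>d\<close> is total with values
  in \<open>nat\<close>, the arguments below become linear arithmetic; \<open>predecessor\<close> is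
  the source of new vertices and says that distances are realised by paths.\<close>

locale geodesic_metric =
  fixes V :: "'a set" and d :: "'a \<Rightarrow> 'a \<Rightarrow> nat"
  assumes finite_points: "finite V"
    and refl: "d x x = 0"
    and sym: "d x y = d y x"
    and tri: "d x z \<le> d x y + d y z"
    and predecessor: "d x y = Suc k \<Longrightarrow> \<exists>z\<in>V. d x z = k \<and> d z y = 1"
begin

definition inner_degree :: "'a \<Rightarrow> 'a \<Rightarrow> nat" where
  "inner_degree x y = card {z \<in> V. d y z = 1 \<and> d x z < d x y}"

definition far :: "'a \<Rightarrow> 'a \<Rightarrow> bool" where
  "far x y \<longleftrightarrow> y \<in> V \<and>
     (\<forall>z\<in>V. d x z < d x y \<or> d x z = d x y \<and> inner_degree x y \<le> inner_degree x z)"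

definition peripheral :: "nat \<Rightarrow> 'a \<Rightarrow> bool" where
  "peripheral D x \<longleftrightarrow> (\<exists>y\<in>V. d x y = D)"

definition diametral :: "nat \<Rightarrow> 'a \<Rightarrow> 'a \<Rightarrow> bool" where
  "diametral D u v \<longleftrightarrow> u \<in> V \<and> v \<in> V \<and> d u v = D \<and> (\<forall>x y. d x y \<le> D)"

lemma diametralD:
  assumes "diametral D u v" shows "u \<in> V" "v \<in> V" "d u v = D" "d v u = D" "d x y \<le> D"
  using assms sym[of v u] unfolding diametral_def by auto

lemma not_peripheralD: "\<lbrakk>diametral D u v; \<not> peripheral D x; y \<in> V\<rbrakk> \<Longrightarrow> d x y < D"
  unfolding diametral_def peripheral_def by (metis le_neq_implies_less)

lemma farD: "\<lbrakk>far x y; z \<in> V\<rbrakk> \<Longrightarrow> d x z \<le> d x y"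
  unfolding far_def by (metis less_imp_le order_refl)

lemma diametral_sym: "diametral D u v \<Longrightarrow> diametral D v u"
  unfolding diametral_def by (simp add: sym[of v u])

text \<open>Each part mentions the three points in the same order, so that all parts can be instantiated at once.\<close>

lemma levels:
  "d w x \<le> d w y + d x y" "\<not> d w x + d x y < d w y" "\<not> d w x + d w y < d x y"
  "d w x + d x y = d w x + d y x" "d w x + d w y = d x w + d w y" "d w x + d w y = d w x + d y w"
  by (use tri[of w y x] tri[of w x y] tri[of x y w] sym[of x y] sym[of w x] sym[of w y] in linarith)+

lemma down: "\<lbrakk>d x y = k; 0 < k\<rbrakk> \<Longrightarrow> \<exists>z\<in>V. d x z = k - 1 \<and> d z y = 1"
  using predecessor[of x y "k - 1"] by simp

text \<open>The tie-breaking argument: the inner neighbours of \<open>z\<close> form a proper subset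
  of those of \<open>y\<close>, with \<open>q\<close> in the difference, so \<open>z\<close> should
  have been preferred. In the applications \<open>z\<close> is an end of a diametral pair.\<close>

lemma no_smaller_inner_degree:
  assumes "far x y" "z \<in> V" "d x z = d x y"
    and "\<And>p. \<lbrakk>d z p = 1; d x p < d x y\<rbrakk> \<Longrightarrow> d y p = 1"
    and "q \<in> V" "d y q = 1" "d x q < d x y" "d z q \<noteq> 1"
  shows False
proof -
  have "{p \<in> V. d z p = 1 \<and> d x p < d x z} \<subset> {p \<in> V. d y p = 1 \<and> d x p < d x y}"
    using assms(3-8) by auto
  then have "inner_degree x z < inner_degree x y"
    unfolding inner_degree_def by (intro psubset_card_mono) (simp_all add: finite_points)
  then show False using assms(1-3) unfolding far_def by auto
qed


section \<open>Forbidden forests expressed by distances\<close>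

definition P3_P1_free :: bool where
  "P3_P1_free \<longleftrightarrow> \<not> (\<exists>p q r x. d p q = 1 \<and> d q r = 1 \<and>
      2 \<le> d p r \<and> 2 \<le> d p x \<and> 2 \<le> d q x \<and> 2 \<le> d r x)"

text \<open>Every pair is put at distance 1 or at least 2, so the points are automatically distinct
  and the subgraph is induced. The other forests are expressed in the same way.\<close>

definition P4_P1_free :: bool where
  "P4_P1_free \<longleftrightarrow> \<not> (\<exists>p q r s x. d p q = 1 \<and> d q r = 1 \<and> d r s = 1 \<and>
      2 \<le> d p r \<and> 2 \<le> d p s \<and> 2 \<le> d q s \<and> 2 \<le> d p x \<and> 2 \<le> d q x \<and> 2 \<le> d r x \<and> 2 \<le> d s x)"

definition P3_2P1_free :: bool where
  "P3_2P1_free \<longleftrightarrow> \<not> (\<exists>p q r x y. d p q = 1 \<and> d q r = 1 \<and> 2 \<le> d p r \<and>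
      2 \<le> d p x \<and> 2 \<le> d q x \<and> 2 \<le> d r x \<and> 2 \<le> d p y \<and> 2 \<le> d q y \<and> 2 \<le> d r y \<and> 2 \<le> d x y)"

definition two_P2_P1_free :: bool where
  "two_P2_P1_free \<longleftrightarrow> \<not> (\<exists>p q r s x. d p q = 1 \<and> d r s = 1 \<and> 2 \<le> d p r \<and> 2 \<le> d p s \<and>
      2 \<le> d q r \<and> 2 \<le> d q s \<and> 2 \<le> d p x \<and> 2 \<le> d q x \<and> 2 \<le> d r x \<and> 2 \<le> d s x)"

definition P2_3P1_free :: bool where
  "P2_3P1_free \<longleftrightarrow> \<not> (\<exists>p q x y z. d p q = 1 \<and> 2 \<le> d p x \<and> 2 \<le> d p y \<and> 2 \<le> d p z \<and>
      2 \<le> d q x \<and> 2 \<le> d q y \<and> 2 \<le> d q z \<and> 2 \<le> d x y \<and> 2 \<le> d x z \<and> 2 \<le> d y z)"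

lemma P3_P1_freeD: "\<lbrakk>P3_P1_free; d p q = 1; d q r = 1;
      2 \<le> d p r; 2 \<le> d p x; 2 \<le> d q x; 2 \<le> d r x\<rbrakk> \<Longrightarrow> False"
  unfolding P3_P1_free_def by metis

lemma P4_P1_freeD: "\<lbrakk>P4_P1_free; d p q = 1; d q r = 1; d r s = 1;
      2 \<le> d p r; 2 \<le> d p s; 2 \<le> d q s; 2 \<le> d p x; 2 \<le> d q x; 2 \<le> d r x; 2 \<le> d s x\<rbrakk> \<Longrightarrow> False"
  unfolding P4_P1_free_def by metis

lemma P3_2P1_freeD: "\<lbrakk>P3_2P1_free; d p q = 1; d q r = 1; 2 \<le> d p r;
      2 \<le> d p x; 2 \<le> d q x; 2 \<le> d r x; 2 \<le> d p y; 2 \<le> d q y; 2 \<le> d r y; 2 \<le> d x y\<rbrakk> \<Longrightarrow> False"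
  unfolding P3_2P1_free_def by metis

lemma two_P2_P1_freeD: "\<lbrakk>two_P2_P1_free; d p q = 1; d r s = 1; 2 \<le> d p r; 2 \<le> d p s;
      2 \<le> d q r; 2 \<le> d q s; 2 \<le> d p x; 2 \<le> d q x; 2 \<le> d r x; 2 \<le> d s x\<rbrakk> \<Longrightarrow> False"
  unfolding two_P2_P1_free_def by metis

lemma P2_3P1_freeD: "\<lbrakk>P2_3P1_free; d p q = 1; 2 \<le> d p x; 2 \<le> d p y; 2 \<le> d p z;
      2 \<le> d q x; 2 \<le> d q y; 2 \<le> d q z; 2 \<le> d x y; 2 \<le> d x z; 2 \<le> d y z\<rbrakk> \<Longrightarrow> False"
  unfolding P2_3P1_free_def by metis

section \<open>The case \<open>P_3 + P_1\<close>, diameter 3\<close>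

lemma P3_P1_cliques:
  assumes free: P3_P1_free and uv: "diametral 3 u v" and p: "d u p = 1" and q: "d u q = 1"
  shows "d p q \<le> 1"
proof (rule ccontr)
  assume n: "\<not> d p q \<le> 1"
  \<comment> \<open>The path \<open>p\<close>, \<open>u\<close>, \<open>q\<close> would be induced,
    with \<open>v\<close> apart from it.\<close>
  show False
    by (rule P3_P1_freeD[OF free, of p u q v])
      (use n p q diametralD(3)[OF uv] levels[of u p v] levels[of u q v] in linarith)+
qed

text \<open>If \<open>p\<close> were adjacent to \<open>w\<close>, then \<open>u\<close>,
  \<open>p\<close>, \<open>w\<close> would be an induced path apart from \<open>v\<close>.\<close>

lemma P3_P1_outside:
  assumes free: P3_P1_free and uv: "diametral 3 u v" and w: "2 \<le> d u w" "2 \<le> d v w"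
    and p: "d u p = 1"
  shows "2 \<le> d p w"
proof (rule ccontr)
  assume n: "\<not> 2 \<le> d p w"
  have "d p w = 1" using n p w levels[of p u w] by linarith
  then show False
    by - (rule P3_P1_freeD[OF free, of u p w v],
      (use w p diametralD(3)[OF uv] levels[of u p v] levels[of v u w] in linarith)+)
qed

text \<open>A geodesic from \<open>w\<close> back to \<open>u\<close> would have to step from the
  vertices at distance at least 2 from both ends into the neighbourhood of an end, and
  \<open>P3_P1_outside\<close> forbids this step.\<close>

lemma P3_P1_cover:
  assumes free: P3_P1_free and uv: "diametral 3 u v"
  shows "d u w \<le> 1 \<or> d v w \<le> 1"
proof (rule ccontr)
  assume "\<not> ?thesis"
  then have w: "2 \<le> d u w" "2 \<le> d v w" by auto
  note vu = diametral_sym[OF uv]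
  have "d u w \<noteq> 2"
  proof
    assume "d u w = 2"
    then obtain p where "d u p = 1" "d p w = 1" using down[of u w 2] by auto
    then show False using P3_P1_outside[OF free uv w, of p] by simp
  qed
  then have w3: "d u w = 3" using w diametralD(5)[OF uv, of u w] by linarith
  then obtain z where z: "d u z = 2" "d z w = 1" using down[of u w 3] by auto
  obtain p where p: "d u p = 1" "d p z = 1" using down[OF z(1)] by auto
  have "2 \<le> d v z"
  proof (rule ccontr)
    assume "\<not> 2 \<le> d v z"
    then have "d v z = 1" using z diametralD(3)[OF uv] levels[of z u v] by linarith
    then show False using P3_P1_outside[OF free vu w(2,1), of z] z by simp
  qed
  then show False using P3_P1_outside[OF free uv _ _ p(1), of z] z p by simp
qed

text \<open>The closed neighbourhoods of the ends are cliques and cover the graph. With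
  \<open>x\<close> on the side of \<open>u\<close>, a farthest \<open>y\<close> lies on the side of
  \<open>v\<close> and ties with \<open>v\<close>; being at distance 2 from \<open>u\<close>, it has
  an inner neighbour \<open>q\<close> next to \<open>u\<close>, which \<open>v\<close>
  lacks.\<close>

lemma P3_P1_far_side:
  assumes free: P3_P1_free and uv: "diametral 3 u v" and x: "d u x \<le> 1" and xy: "far x y"
  shows "peripheral 3 x \<or> peripheral 3 y"
proof (rule ccontr)
  assume "\<not> ?thesis"
  then have nx: "\<not> peripheral 3 x" and ny: "\<not> peripheral 3 y" by auto
  note V = diametralD(1,2)[OF uv] and duv = diametralD(3,4)[OF uv] and vu = diametral_sym[OF uv]
  have y: "y \<in> V" using xy unfolding far_def by simp
  have xv: "d x v = 2"
    using not_peripheralD[OF uv nx V(2)] x duv levels[of x u v] by linarith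
  have ux: "d u x = 1" using x xv duv levels[of u x v] by linarith
  have xy2: "d x y = 2" using farD[OF xy V(2)] not_peripheralD[OF uv nx y] xv by linarith
  have vy: "d v y \<le> 1"
  proof (rule ccontr)
    assume "\<not> d v y \<le> 1"
    then have uy: "d u y \<le> 1" using P3_P1_cover[OF free uv, of y] by auto
    have "d u y \<noteq> 0" using xy2 ux levels[of u x y] by linarith
    then have "d u y = 1" using uy by linarith
    then show False using P3_P1_cliques[OF free uv ux, of y] xy2 by simp
  qed
  have yv: "d y v \<le> 1" using vy sym[of v y] by simp
  have uy: "d u y = 2"
    using not_peripheralD[OF uv ny V(1)] yv duv levels[of y u v] by linarith
  then obtain q where q: "q \<in> V" "d u q = 1" "d q y = 1" using down[of u y 2] by auto
  have vq: "d v q \<noteq> 1" using q duv levels[of q u v] by linarith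
  have inner: "d y z = 1" if z: "d v z = 1" "d x z < d x y" for z
  proof -
    have "d y z \<le> 1"
    proof (cases "d v y = 0")
      case True
      then show ?thesis using z levels[of v y z] by linarith
    next
      case False
      then have "d v y = 1" using vy by linarith
      then show ?thesis using P3_P1_cliques[OF free vu _ z(1)] by simp
    qed
    moreover have "d y z \<noteq> 0" using z xy2 levels[of z x y] by linarith
    ultimately show ?thesis by linarith
  qed
  have "d x q \<le> 1" by (rule P3_P1_cliques[OF free uv ux q(2)])
  then show False
    by - (rule no_smaller_inner_degree[OF xy V(2) _ inner q(1)],
      use xv xy2 q vq sym[of y q] in auto)
qed

lemma P3_P1_far:
  assumes free: P3_P1_free and uv: "diametral 3 u v" and xy: "far x y"
  shows "peripheral 3 x \<or> peripheral 3 y"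
  using P3_P1_cover[OF free uv, of x] P3_P1_far_side[OF free uv _ xy]
    P3_P1_far_side[OF free diametral_sym[OF uv] _ xy] by blast

section \<open>The case \<open>P_4 + P_1\<close>, diameter 4\<close>

lemma P4_P1_level3:
  assumes free: P4_P1_free and uv: "diametral 4 u v" and x: "d u x = 3" shows "d v x = 1"
proof (rule ccontr)
  assume n: "d v x \<noteq> 1"
  obtain b where b: "d u b = 2" "d b x = 1" using down[OF x] by auto
  obtain a where a: "d u a = 1" "d a b = 1" using down[OF b(1)] by auto
  \<comment> \<open>A geodesic from \<open>u\<close> to \<open>x\<close> is an induced
    \<open>P_4\<close>, and only its last vertex could be adjacent to \<open>v\<close>.\<close>
  show False
    by (rule P4_P1_freeD[OF free, of u a b x v])
      (use x n a b diametralD[OF uv] levels[of u a x] levels[of u a v] levels[of u b v] levels[of u x v] in linarith)+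
qed

lemma P4_P1_types:
  assumes free: P4_P1_free and uv: "diametral 4 u v" and n: "\<not> peripheral 4 x"
  shows "d u x = 1 \<and> d v x = 3 \<or> d u x = 2 \<and> d v x = 2 \<or> d u x = 3 \<and> d v x = 1"
proof -
  have "d u x < 4" "d v x < 4"
    using not_peripheralD[OF uv n diametralD(1)[OF uv]] not_peripheralD[OF uv n diametralD(2)[OF uv]]
    by (simp_all add: sym)
  moreover have "4 \<le> d u x + d v x" using diametralD(3)[OF uv] levels[of x u v] by linarith
  moreover have "d u x = 3 \<Longrightarrow> d v x = 1" "d v x = 3 \<Longrightarrow> d u x = 1"
    using P4_P1_level3[OF free uv] P4_P1_level3[OF free diametral_sym[OF uv]] by simp_all
  ultimately show ?thesis by presburger
qed

text \<open>Otherwise take neighbours \<open>a\<close>, \<open>b\<close> of \<open>u\<close>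
  adjacent to \<open>x\<close> and \<open>y\<close> respectively. Depending on whether
  \<open>a\<close> and \<open>b\<close> are adjacent, \<open>x\<close>, \<open>a\<close>,
  \<open>b\<close>, \<open>y\<close> or \<open>x\<close>, \<open>a\<close>, \<open>u\<close>,
  \<open>b\<close> is an induced path apart from \<open>v\<close>.\<close>

lemma P4_P1_middle_close:
  assumes free: P4_P1_free and uv: "diametral 4 u v" and x: "d u x = 2" "d v x = 2"
    and y: "d u y = 2" "d v y = 2" and xy: "2 \<le> d x y"
  shows "\<exists>a\<in>V. d u a = 1 \<and> d a x = 1 \<and> d a y = 1"
proof (rule ccontr)
  assume n: "\<not> ?thesis"
  obtain a where a: "a \<in> V" "d u a = 1" "d a x = 1" using down[OF x(1)] by auto
  obtain b where b: "b \<in> V" "d u b = 1" "d b y = 1" using down[OF y(1)] by auto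
  have ay: "d a y \<noteq> 1" and bx: "d b x \<noteq> 1" using n a b by auto
  note f = x y xy a b ay bx diametralD(3,4)[OF uv] levels[of u a v] levels[of u b v] levels[of u a y] levels[of u b x]
    levels[of u a x] levels[of v a y] levels[of v b x] levels[of u a b] levels[of u b y] levels[of v x y]
  show False
  proof (cases "d a b = 1")
    case True
    show ?thesis
      by (rule P4_P1_freeD[OF free, of x a b y v]) (use f True in linarith)+
  next
    case False
    have "2 \<le> d a b" using f False levels[of x a b] by linarith
    then show ?thesis
      by - (rule P4_P1_freeD[OF free, of x a u b v], (use f in linarith)+)
  qed
qed

text \<open>Otherwise \<open>x\<close>, \<open>u\<close>, \<open>a\<close>, \<open>y\<close> would
  be an induced path apart from \<open>v\<close>, for a common neighbour \<open>a\<close> of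
  \<open>u\<close> and \<open>y\<close>.\<close>

lemma P4_P1_side_close:
  assumes free: P4_P1_free and uv: "diametral 4 u v" and x: "d u x = 1" "d v x = 3"
    and y: "d u y = 2" "d v y = 2"
  shows "d x y \<le> 2"
proof (rule ccontr)
  assume n: "\<not> ?thesis"
  obtain a where a: "a \<in> V" "d u a = 1" "d a y = 1" using down[OF y(1)] by auto
  show False
    by (rule P4_P1_freeD[OF free, of x u a y v])
      (use n x y a diametralD(3,4)[OF uv] levels[of u a v] levels[of u x v] levels[of a x y] levels[of u x a] levels[of v x y] in linarith)+
qed

text \<open>With distances from \<open>u\<close> and \<open>v\<close> written as pairs, a farthest
  \<open>y\<close> that is not peripheral has type (3, 1) and ties with \<open>v\<close>. Its
  neighbour \<open>b\<close> on a geodesic from \<open>u\<close> is within distance 2 of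
  \<open>x\<close> but not adjacent to \<open>v\<close>, whereas all inner neighbours of
  \<open>v\<close> are adjacent to \<open>y\<close>.\<close>

lemma P4_P1_far_side:
  assumes free: P4_P1_free and uv: "diametral 4 u v" and x: "d u x = 1" "d v x = 3"
    and nx: "\<not> peripheral 4 x" and xy: "far x y"
  shows "peripheral 4 y"
proof (rule ccontr)
  assume ny: "\<not> peripheral 4 y"
  note V = diametralD(1,2)[OF uv] and duv = diametralD(3,4)[OF uv]
  have y: "y \<in> V" using xy unfolding far_def by simp
  have xy3: "d x y = 3"
    using farD[OF xy V(2)] not_peripheralD[OF uv nx y] x(2) sym[of v x] by linarith
  have ty: "d u y = 3" "d v y = 1"
    using P4_P1_types[OF free uv ny] P4_P1_side_close[OF free uv x, of y] xy3 x levels[of u x y] by linarith+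
  obtain b where b: "b \<in> V" "d u b = 2" "d b y = 1" using down[OF ty(1)] by auto
  have bv: "d v b = 2" using b ty duv levels[of u b v] levels[of y b v] by linarith
  have bx: "d x b \<le> 2" by (rule P4_P1_side_close[OF free uv x b(2) bv])
  have inner: "d y z = 1" if z: "d v z = 1" "d x z < d x y" for z
  proof (rule ccontr)
    assume nz: "d y z \<noteq> 1"
    have xz: "d x z = 2" using z xy3 x sym[of x v] levels[of x z v] by linarith
    have uz: "d u z = 3" using z duv x xz levels[of v u z] levels[of x z u] by linarith
    have yz: "2 \<le> d y z" using nz xz xy3 levels[of x y z] by linarith
    obtain c where c: "d x c = 1" "d c z = 1" using down[OF xz] by auto
    have uc: "d u c = 2" using x c uz levels[of x u c] levels[of z u c] by linarith
    \<comment> \<open>With \<open>z\<close> not adjacent to \<open>y\<close>, the induced path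
      \<open>c\<close>, \<open>z\<close>, \<open>v\<close>, \<open>y\<close> is apart from
      \<open>u\<close>.\<close>
    show False
      by (rule P4_P1_freeD[OF free, of c z v y u])
        (use z x ty xz uz yz c uc duv xy3 levels[of u c v] levels[of x c y] levels[of v z y] levels[of u v y] levels[of u v z] in linarith)+
  qed
  show False
    by (rule no_smaller_inner_degree[OF xy V(2) _ inner b(1)])
      (use x ty b bx bv xy3 sym[of x v] sym[of y b] in auto)
qed

text \<open>Both ends tie with \<open>y\<close> at distance 2 from \<open>x\<close>. The vertex
  \<open>c\<close> next to \<open>v\<close> is an inner neighbour of \<open>y\<close> that
  \<open>u\<close> lacks, and \<open>a\<close> next to \<open>u\<close> is one that \<open>v\<close>
  lacks. So an end whose inner neighbours are all adjacent to \<open>y\<close> would have been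
  preferred.\<close>

lemma P4_P1_far_middle:
  assumes free: P4_P1_free and uv: "diametral 4 u v" and x: "d u x = 2" "d v x = 2"
    and xy: "far x y" and y: "d u y = 2" "d v y = 2"
  shows False
proof -
  note V = diametralD(1,2)[OF uv] and duv = diametralD(3,4)[OF uv]
  have xy2: "2 \<le> d x y" using farD[OF xy V(1)] x sym[of u x] by linarith
  obtain a where a: "a \<in> V" "d u a = 1" "d a x = 1" "d a y = 1"
    using P4_P1_middle_close[OF free uv x y xy2] by auto
  obtain c where c: "c \<in> V" "d v c = 1" "d c x = 1" "d c y = 1"
    using P4_P1_middle_close[OF free diametral_sym[OF uv] x(2,1) y(2,1) xy2] by auto
  have d2: "d x y = 2" using xy2 a levels[of a x y] by linarith
  show False
  proof (cases "\<forall>z. d u z = 1 \<and> d x z < d x y \<longrightarrow> d y z = 1")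
    case True
    have "d u c \<noteq> 1" using c duv levels[of c u v] by linarith
    then show False
      by - (rule no_smaller_inner_degree[OF xy V(1) _ _ c(1)],
        use True x c d2 sym[of x u] sym[of x c] sym[of y c] in auto)
  next
    case F: False
    show False
    proof (cases "\<forall>z. d v z = 1 \<and> d x z < d x y \<longrightarrow> d y z = 1")
      case True
      have "d v a \<noteq> 1" using a duv levels[of a u v] by linarith
      then show False
        by - (rule no_smaller_inner_degree[OF xy V(2) _ _ a(1)],
          use True x a d2 sym[of x v] sym[of x a] sym[of y a] in auto)
    next
      case False
      then obtain t where t: "d v t = 1" "d x t < d x y" "d y t \<noteq> 1" by auto
      obtain s where s: "d u s = 1" "d x s < d x y" "d y s \<noteq> 1" using F by auto
      have "d x s \<noteq> 0" "d x t \<noteq> 0"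
        using s t x levels[of u x s] levels[of v x t] by linarith+
      then have xs: "d x s = 1" and xt: "d x t = 1" using s t d2 by linarith+
      have "d y s \<noteq> 0" "d y t \<noteq> 0"
        using xs xt d2 levels[of x y s] levels[of x y t] by linarith+
      then have ys: "2 \<le> d s y" and yt: "2 \<le> d t y"
        using s(3) t(3) sym[of y s] sym[of y t] by linarith+
      have ut: "3 \<le> d u t" using t(1) duv levels[of u v t] by linarith
      have st: "2 \<le> d s t" using ut s(1) levels[of u s t] by linarith
      \<comment> \<open>Neither end can be compared with \<open>y\<close>; then \<open>u\<close>,
        \<open>s\<close>, \<open>x\<close>, \<open>t\<close> is an induced path apart from
        \<open>y\<close>.\<close>
      show False
        by (rule P4_P1_freeD[OF free, of u s x t y]) (use x y s(1) xs xt ut st ys yt d2 sym[of s x] in linarith)+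
    qed
  qed
qed

text \<open>A move from a vertex of type (2, 2) cannot end at that type again, but may end at type
  (1, 3) or (3, 1); from there the next move reaches a peripheral vertex.\<close>

lemma P4_P1_far:
  assumes free: P4_P1_free and uv: "diametral 4 u v" and xy: "far x y" and yz: "far y z"
  shows "peripheral 4 x \<or> peripheral 4 y \<or> peripheral 4 z"
proof (rule ccontr)
  assume "\<not> ?thesis"
  then have n: "\<not> peripheral 4 x" "\<not> peripheral 4 y" "\<not> peripheral 4 z" by auto
  note vu = diametral_sym[OF uv]
  consider "d u x = 1" "d v x = 3" | "d u x = 3" "d v x = 1" | "d u x = 2" "d v x = 2"
    using P4_P1_types[OF free uv n(1)] by auto
  then show False
  proof cases
    case 1
    then show False using P4_P1_far_side[OF free uv _ _ n(1) xy] n(2) by simp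
  next
    case 2
    then show False using P4_P1_far_side[OF free vu _ _ n(1) xy] n(2) by simp
  next
    case 3
    consider "d u y = 1" "d v y = 3" | "d u y = 3" "d v y = 1" | "d u y = 2" "d v y = 2"
      using P4_P1_types[OF free uv n(2)] by auto
    then show False
    proof cases
      case 1
      then show False using P4_P1_far_side[OF free uv _ _ n(2) yz] n(3) by simp
    next
      case 2
      then show False using P4_P1_far_side[OF free vu _ _ n(2) yz] n(3) by simp
    next
      case y: 3
      show False by (rule P4_P1_far_middle[OF free uv 3 xy y])
    qed
  qed
qed

lemma end_not_peripheral:
  assumes uv: "diametral D u v" and n: "\<not> peripheral D x"
  shows "d u x < D" "d v x < D" "d x u < D" "d x v < D"
  using not_peripheralD[OF uv n diametralD(1)[OF uv]] not_peripheralD[OF uv n diametralD(2)[OF uv]]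
    sym[of x] by simp_all

section \<open>The case \<open>P_3 + 2P_1\<close>, diameter 5\<close>

lemma P3_2P1_middle:
  assumes free: P3_2P1_free and uv: "diametral 5 u v" and y: "d u y = 2" and w: "d u w = 3"
  shows "d y w = 1"
proof (rule ccontr)
  assume n: "d y w \<noteq> 1"
  obtain a where a: "d u a = 1" "d a y = 1" using down[OF y] by auto
  have duv: "d u v = 5" by (rule diametralD(3)[OF uv])
  have yw: "2 \<le> d y w" using n y w levels[of u y w] by linarith
  have aw: "2 \<le> d a w" and av: "2 \<le> d a v" and yv: "2 \<le> d y v" and wv: "2 \<le> d w v"
    using a y w duv levels[of u a w] levels[of u a v] levels[of u y v] levels[of u w v] by linarith+
  \<comment> \<open>The path \<open>u\<close>, \<open>a\<close>, \<open>y\<close> is induced, and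
    \<open>w\<close> and \<open>v\<close> are apart from it and from each other.\<close>
  show False
    by (rule P3_2P1_freeD[OF free, of u a y w v]) (use a y w duv yw aw av yv wv in linarith)+
qed

lemma P3_2P1_level4:
  assumes free: P3_2P1_free and uv: "diametral 5 u v" and w: "d u w = 4"
  shows "d v w = 1"
proof (rule ccontr)
  assume n: "d v w \<noteq> 1"
  obtain c where c: "d u c = 3" "d c w = 1" using down[OF w] by auto
  obtain b where b: "d u b = 2" "d b c = 1" using down[OF c(1)] by auto
  have duv: "d u v = 5" by (rule diametralD(3)[OF uv])
  have "d v w \<noteq> 0" using w duv levels[of w u v] by linarith
  then have wv: "2 \<le> d w v" using n sym[of v w] by linarith
  have bw: "2 \<le> d b w" and bv: "2 \<le> d b v" and cv: "2 \<le> d c v"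
    using b c w duv levels[of u b w] levels[of u b v] levels[of u c v] by linarith+
  \<comment> \<open>Here the path is \<open>b\<close>, \<open>c\<close>, \<open>w\<close>, and the
    two ends are the single vertices.\<close>
  show False
    by (rule P3_2P1_freeD[OF free, of b c w u v])
      (use b c w duv wv bw bv cv sym[of b u] sym[of c u] sym[of w u] in linarith)+
qed

text \<open>Levels 2 and 3 from \<open>u\<close> are completely joined, and neither is empty because
  a geodesic to \<open>v\<close> passes through both.\<close>

lemma P3_2P1_close:
  assumes free: P3_2P1_free and uv: "diametral 5 u v" and x: "d u x = 2 \<or> d u x = 3"
    and y: "d u y = 2 \<or> d u y = 3"
  shows "d x y \<le> 2"
proof -
  obtain c where c: "d u c = 3"
  proof -
    obtain w where w: "d u w = 4" using down[OF diametralD(3)[OF uv]] by auto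
    show thesis using down[OF w] that by auto
  qed
  obtain b where b: "d u b = 2" using down[OF c] by auto
  note m = P3_2P1_middle[OF free uv]
  show ?thesis
    using x y m[OF b, of x] m[OF b, of y] m[OF _ c, of x] m[OF _ c, of y] m[of x y] m[of y x]
      levels(3)[of b x y] levels(3)[of c x y] sym[of x y] sym[of x c] sym[of y c] by auto
qed

text \<open>The neighbour \<open>b\<close> of \<open>x\<close> on a geodesic to \<open>v\<close> has
  level 2, so it is adjacent to all of level 3. This puts level 3 within distance 2 of
  \<open>x\<close> and level 4 within distance 3, while \<open>y\<close> is at distance at least
  4.\<close>

lemma P3_2P1_far_1:
  assumes free: P3_2P1_free and uv: "diametral 5 u v" and x: "d u x = 1" and xy: "far x y"
    and nx: "\<not> peripheral 5 x" and ny: "\<not> peripheral 5 y"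
  shows False
proof -
  note V = diametralD(1,2)[OF uv] and duv = diametralD(3,4)[OF uv]
  have xv: "d x v = 4" using end_not_peripheral[OF uv nx] x duv levels[of x u v] by linarith
  then have "d v x = 4" by (simp add: sym[of v x])
  then obtain b where b: "d v b = 3" "d b x = 1" using down[of v x 4] by auto
  have ub: "d u b = 2" using x b duv levels[of x u b] levels[of b u v] by linarith
  have xy4: "4 \<le> d x y" using farD[OF xy V(2)] xv by simp
  have uy: "3 \<le> d u y" "d u y < 5"
    using xy4 x levels[of u x y] end_not_peripheral[OF uv ny] by linarith+
  have near: "d x c \<le> 2" if "d u c = 3" for c
    using P3_2P1_middle[OF free uv ub that] b levels[of b x c] by linarith
  show False
  proof (cases "d u y = 3")
    case True
    then show False using near[of y] xy4 by simp
  next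
    case False
    then have "d u y = 4" using uy by linarith
    then obtain c where c: "d u c = 3" "d c y = 1" using down[of u y 4] by auto
    show False using near[OF c(1)] c xy4 levels[of c x y] by linarith
  qed
qed

text \<open>No level below 5 can contain a vertex at distance 3 from \<open>x\<close>. Level 4 is
  reached through level 3, which is adjacent to \<open>x\<close>; and for \<open>y\<close> in level
  1, the path \<open>y\<close>, \<open>u\<close>, \<open>a\<close> would be apart from
  \<open>v\<close> and from a vertex \<open>c\<close> of level 3.\<close>

lemma P3_2P1_far_2:
  assumes free: P3_2P1_free and uv: "diametral 5 u v" and x: "d u x = 2" and xy: "far x y"
    and ny: "\<not> peripheral 5 y"
  shows False
proof -
  note V = diametralD(1,2)[OF uv] and duv = diametralD(3,4)[OF uv]
  have xy3: "3 \<le> d x y" using farD[OF xy V(2)] x duv levels[of x u v] by linarith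
  have uy: "d u y < 5" by (rule end_not_peripheral[OF uv ny])
  have "d u y \<noteq> 2" "d u y \<noteq> 3" using P3_2P1_close[OF free uv, of x y] x xy3 by auto
  moreover have "d u y \<noteq> 0" using xy3 x levels[of u x y] by linarith
  moreover have "d u y \<noteq> 4"
  proof
    assume "d u y = 4"
    then obtain c where c: "d u c = 3" "d c y = 1" using down[of u y 4] by auto
    show False using P3_2P1_middle[OF free uv x c(1)] c xy3 levels[of c x y] by linarith
  qed
  moreover have "d u y \<noteq> 1"
  proof
    assume y: "d u y = 1"
    obtain a where a: "d u a = 1" "d a x = 1" using down[OF x] by auto
    have ya: "2 \<le> d y a" using a xy3 levels[of a x y] by linarith
    obtain w where w: "d u w = 4" "d w v = 1" using down[OF duv(1)] by auto
    obtain c where c: "d u c = 3" "d c w = 1" using down[OF w(1)] by auto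
    have yc: "2 \<le> d y c" and yv: "2 \<le> d y v" and ac: "2 \<le> d a c" and av: "2 \<le> d a v"
      and cv: "2 \<le> d c v"
      using y a c duv levels[of u y c] levels[of u y v] levels[of u a c] levels[of u a v] levels[of u c v]
      by linarith+
    show False
      by (rule P3_2P1_freeD[OF free, of y u a c v])
        (use y a c duv ya yc yv ac av cv sym[of u y] in linarith)+
  qed
  ultimately show False using uy by linarith
qed

lemma P3_2P1_types:
  assumes free: P3_2P1_free and uv: "diametral 5 u v" and n: "\<not> peripheral 5 x"
  shows "d u x = 1 \<or> d u x = 2 \<or> d v x = 1 \<or> d v x = 2 \<or> d u x = 3 \<and> d v x = 3"
proof -
  have "d u x < 5" "d v x < 5" by (rule end_not_peripheral[OF uv n])+
  moreover have "5 \<le> d u x + d v x" using diametralD(3)[OF uv] levels[of x u v] by linarith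
  moreover have "d u x = 4 \<Longrightarrow> d v x = 1" "d v x = 4 \<Longrightarrow> d u x = 1"
    using P3_2P1_level4[OF free uv] P3_2P1_level4[OF free diametral_sym[OF uv]] by simp_all
  ultimately show ?thesis by presburger
qed

text \<open>If \<open>y\<close> were adjacent to an end, its neighbour at distance 3 from the other
  end would have level 2 from the first and so be adjacent to \<open>x\<close>. The other types are
  within distance 2 of \<open>x\<close> by \<open>P3_2P1_close\<close>.\<close>

lemma P3_2P1_far_3:
  assumes free: P3_2P1_free and uv: "diametral 5 u v" and x: "d u x = 3" "d v x = 3" and xy: "far x y"
    and ny: "\<not> peripheral 5 y"
  shows False
proof -
  note V = diametralD(1,2)[OF uv] and duv = diametralD(3,4)[OF uv] and vu = diametral_sym[OF uv]
  have xy3: "3 \<le> d x y" using farD[OF xy V(2)] x sym[of v x] by linarith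
  have side: "d s y \<noteq> 1" if st: "diametral 5 s t" and sx: "d s x = 3" for s t
  proof
    assume y: "d s y = 1"
    have ty: "d t y = 4"
      using y end_not_peripheral[OF st ny] diametralD(3)[OF st] levels[of y s t] by linarith
    then obtain b where b: "d t b = 3" "d b y = 1" using down[of t y 4] by auto
    have "d s b = 2" using b y diametralD(3)[OF st] levels[of y s b] levels[of b s t] by linarith
    then show False
      using P3_2P1_middle[OF free st _ sx, of b] b xy3 levels[of b x y] by simp
  qed
  have "d u y \<noteq> 2" "d u y \<noteq> 3" "d v y \<noteq> 2" "d v y \<noteq> 3"
    using P3_2P1_close[OF free uv, of x y] P3_2P1_close[OF free vu, of x y] x xy3 by auto
  then show False
    using P3_2P1_types[OF free uv ny] side[OF uv x(1)] side[OF vu x(2)] by argo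
qed

lemma P3_2P1_far:
  assumes free: P3_2P1_free and uv: "diametral 5 u v" and xy: "far x y"
  shows "peripheral 5 x \<or> peripheral 5 y"
proof (rule ccontr)
  assume "\<not> ?thesis"
  then have nx: "\<not> peripheral 5 x" and ny: "\<not> peripheral 5 y" by auto
  note vu = diametral_sym[OF uv]
  show False
    using P3_2P1_types[OF free uv nx] P3_2P1_far_1[OF free uv _ xy nx ny] P3_2P1_far_1[OF free vu _ xy nx ny]
      P3_2P1_far_2[OF free uv _ xy ny] P3_2P1_far_2[OF free vu _ xy ny] P3_2P1_far_3[OF free uv _ _ xy ny]
    by argo
qed

section \<open>The case \<open>2P_2 + P_1\<close>, diameter 5\<close>

lemma two_P2_P1_level3:
  assumes free: two_P2_P1_free and uv: "diametral 5 u v" and y: "d u y = 3"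
    and e: "d u e = 4" "d v e = 1"
  shows "d y e = 1"
proof (rule ccontr)
  assume n: "d y e \<noteq> 1"
  obtain b where b: "d u b = 2" "d b y = 1" using down[OF y] by auto
  have duv: "d u v = 5" by (rule diametralD(3)[OF uv])
  have ye: "2 \<le> d y e" using n y e levels[of u y e] by linarith
  have be: "2 \<le> d b e" and bv: "2 \<le> d b v" and yv: "2 \<le> d y v"
    using b y e duv levels[of u b e] levels[of u b v] levels[of u y v] by linarith+
  \<comment> \<open>The edges \<open>b y\<close> and \<open>e v\<close> are apart from each other
    and from \<open>u\<close>.\<close>
  show False
    by (rule two_P2_P1_freeD[OF free, of b y e v u])
      (use b y e duv ye be bv yv sym[of b u] sym[of y u] sym[of e u] sym[of v u] sym[of v e] in linarith)+
qed

lemma two_P2_P1_level3_below: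
  assumes free: two_P2_P1_free and uv: "diametral 5 u v" and y: "d u y = 3"
  shows "d v y = 2"
proof -
  have duv: "d u v = 5" "d v u = 5" by (rule diametralD[OF uv])+
  obtain e where e: "d u e = 4" "d e v = 1" using down[OF duv(1)] by auto
  have "d y e = 1" using two_P2_P1_level3[OF free uv y e(1)] e sym[of e v] by simp
  then show ?thesis using e y duv levels[of e v y] levels[of y u v] by linarith
qed

text \<open>An edge inside level 2 is apart from \<open>u\<close> and from an edge between level 4
  and \<open>v\<close>.\<close>

lemma two_P2_P1_level2:
  assumes free: two_P2_P1_free and uv: "diametral 5 u v" and b: "d u b = 2" and c: "d u c = 2"
  shows "d b c \<noteq> 1"
proof
  assume bc: "d b c = 1"
  have duv: "d u v = 5" "d v u = 5" by (rule diametralD[OF uv])+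
  obtain e where e: "d u e = 4" "d e v = 1" using down[OF duv(1)] by auto
  have be: "2 \<le> d b e" and bv: "2 \<le> d b v" and ce: "2 \<le> d c e" and cv: "2 \<le> d c v"
    using b c e duv levels[of u b e] levels[of u b v] levels[of u c e] levels[of u c v] by linarith+
  show False
    by (rule two_P2_P1_freeD[OF free, of b c e v u])
      (use b c e bc duv be bv ce cv sym[of b u] sym[of c u] sym[of e u] in linarith)+
qed

text \<open>Distances (2, 4) would force an edge inside level 2. For (4, 4), the preceding vertex on
  a geodesic from \<open>u\<close> is at distance 2 from \<open>v\<close>, so \<open>x\<close> would
  be at distance at most 3.\<close>

lemma two_P2_P1_types:
  assumes free: two_P2_P1_free and uv: "diametral 5 u v" and n: "\<not> peripheral 5 x"
  shows "d u x = 1 \<and> d v x = 4 \<or> d u x = 2 \<and> d v x = 3 \<or> d u x = 3 \<and> d v x = 2 \<or> d u x = 4 \<and> d v x = 1"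
proof -
  have two_four: "d t x \<noteq> 4" if st: "diametral 5 s t" and sx: "d s x = 2" for s t
  proof
    assume "d t x = 4"
    then obtain p where p: "d t p = 3" "d p x = 1" using down[of t x 4] by auto
    have "d s p = 2" by (rule two_P2_P1_level3_below[OF free diametral_sym[OF st] p(1)])
    then show False using two_P2_P1_level2[OF free st _ sx] p by simp
  qed
  have four_four: "\<not> (d u x = 4 \<and> d v x = 4)"
  proof
    assume x: "d u x = 4 \<and> d v x = 4"
    then obtain p where p: "d u p = 3" "d p x = 1" using down[of u x 4] by auto
    have "d v p = 2" by (rule two_P2_P1_level3_below[OF free uv p(1)])
    then show False using x p levels[of p v x] by linarith
  qed
  note vu = diametral_sym[OF uv]
  have "d u x < 5" "d v x < 5" by (rule end_not_peripheral[OF uv n])+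
  moreover have "5 \<le> d u x + d v x" using diametralD(3)[OF uv] levels[of x u v] by linarith
  moreover have "d u x = 3 \<Longrightarrow> d v x = 2" "d v x = 3 \<Longrightarrow> d u x = 2"
    using two_P2_P1_level3_below[OF free uv] two_P2_P1_level3_below[OF free vu] by simp_all
  ultimately show ?thesis using two_four[OF uv] two_four[OF vu] four_four by presburger
qed

text \<open>By \<open>two_P2_P1_level3\<close> seen from \<open>v\<close>, the vertex
  \<open>x\<close> is adjacent to everything at distance 3 from \<open>v\<close>. Hence it is within
  distance 2 of level 3 and within distance 3 of level 4, which is too close for
  \<open>y\<close>.\<close>

lemma two_P2_P1_far_14:
  assumes free: two_P2_P1_free and uv: "diametral 5 u v" and x: "d u x = 1" "d v x = 4" and xy: "far x y"
    and ny: "\<not> peripheral 5 y"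
  shows False
proof -
  note V = diametralD(1,2)[OF uv] and duv = diametralD(3,4)[OF uv] and vu = diametral_sym[OF uv]
  have xy4: "4 \<le> d x y" using farD[OF xy V(2)] x sym[of v x] by linarith
  have near2: "d x b = 1" if "d v b = 3" for b
    using two_P2_P1_level3[OF free vu that x(2,1)] sym[of x b] by simp
  have near3: "d x c \<le> 2" if c: "d u c = 3" for c
  proof -
    obtain b where b: "d u b = 2" "d b c = 1" using down[OF c] by auto
    have "d v c = 2" by (rule two_P2_P1_level3_below[OF free uv c])
    then have "d v b = 3" using b duv levels[of c v b] levels[of b u v] by linarith
    then show ?thesis using near2[of b] b levels[of b x c] by linarith
  qed
  consider "d u y = 1" | "d v y = 3" | "d u y = 3" | "d u y = 4"
    using two_P2_P1_types[OF free uv ny] by auto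
  then show False
  proof cases
    case 1
    then show False using x xy4 levels[of u x y] by linarith
  next
    case 2
    then show False using near2 xy4 by simp
  next
    case 3
    then show False using near3[of y] xy4 by simp
  next
    case 4
    then obtain c where c: "d u c = 3" "d c y = 1" using down[of u y 4] by auto
    then show False using near3[of c] xy4 levels[of c x y] by linarith
  qed
qed

text \<open>Only type (3, 2) is far enough from \<open>x\<close>, and there \<open>y\<close> ties
  with \<open>v\<close>. Inner neighbours of \<open>v\<close> have type (4, 1) and so are adjacent
  to \<open>y\<close>, but \<open>y\<close> has in addition the inner neighbour \<open>b\<close> at
  distance 3 from \<open>v\<close>.\<close>

lemma two_P2_P1_far_23:
  assumes free: two_P2_P1_free and uv: "diametral 5 u v" and x: "d u x = 2" "d v x = 3" and xy: "far x y"
    and ny: "\<not> peripheral 5 y"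
  shows False
proof -
  note V = diametralD(1,2)[OF uv] and duv = diametralD(3,4)[OF uv] and vu = diametral_sym[OF uv]
  have xv: "d x v = 3" using x sym[of v x] by simp
  have xy3: "3 \<le> d x y" using farD[OF xy V(2)] xv by linarith
  have near1: "d x a = 1" if "d u a = 1" "d v a = 4" for a
    by (rule two_P2_P1_level3[OF free vu x(2) that(2,1)])
  obtain a where "d v a = 4" "d a u = 1" using down[OF duv(2)] by auto
  then have a: "d v a = 4" "d u a = 1" by (simp_all add: sym[of u a])
  have near2: "d x b \<le> 2" if b: "d v b = 3" for b
    using near1[OF a(2,1)] two_P2_P1_level3[OF free vu b a] levels[of a x b] by linarith
  have "d u y \<noteq> 4"
  proof
    assume uy: "d u y = 4"
    then have vy: "d v y = 1" using two_P2_P1_types[OF free uv ny] by auto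
    obtain c where c: "d v c = 2" "d c x = 1" using down[OF x(2)] by auto
    have "d u c = 3" using c x duv levels[of c u v] levels[of x u c] by linarith
    then have "d c y = 1" using two_P2_P1_level3[OF free uv _ uy vy] by simp
    then show False using c xy3 levels[of c x y] by linarith
  qed
  then have y: "d u y = 3" "d v y = 2"
    using two_P2_P1_types[OF free uv ny] near1[of y] near2[of y] xy3 by auto
  obtain b where b: "b \<in> V" "d u b = 2" "d b y = 1" using down[OF y(1)] by auto
  have vb: "d v b = 3" using b y duv levels[of y v b] levels[of b u v] by linarith
  have xb: "d x b \<le> 2" by (rule near2[OF vb])
  have xy_eq: "d x y = 3" using xy3 xb b levels[of b x y] by linarith
  have inner: "d y z = 1" if z: "d v z = 1" "d x z < d x y" for z
  proof -
    have xz: "d x z = 2" using z xv xy_eq levels[of z x v] by linarith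
    then obtain p where p: "d x p = 1" "d p z = 1" using down[of x z 2] by auto
    have "d v p = 2" using p z x levels[of z v p] levels[of p v x] by linarith
    then have "d u p = 3" using p x duv levels[of p u v] levels[of x u p] by linarith
    then have "d u z = 4" using p z duv levels[of p u z] levels[of z u v] by linarith
    then show ?thesis using two_P2_P1_level3[OF free uv y(1)] z by simp
  qed
  show False
    by (rule no_smaller_inner_degree[OF xy V(2) _ inner b(1)])
      (use xv xy_eq b xb vb sym[of b y] in auto)
qed

lemma two_P2_P1_far:
  assumes free: two_P2_P1_free and uv: "diametral 5 u v" and xy: "far x y"
  shows "peripheral 5 x \<or> peripheral 5 y"
proof (rule ccontr)
  assume "\<not> ?thesis"
  then have nx: "\<not> peripheral 5 x" and ny: "\<not> peripheral 5 y" by auto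
  note vu = diametral_sym[OF uv]
  show False
    using two_P2_P1_types[OF free uv nx] two_P2_P1_far_14[OF free uv _ _ xy ny] two_P2_P1_far_14[OF free vu _ _ xy ny]
      two_P2_P1_far_23[OF free uv _ _ xy ny] two_P2_P1_far_23[OF free vu _ _ xy ny]
    by argo
qed

section \<open>The case \<open>P_2 + 3P_1\<close>, diameter 6\<close>

lemma P2_3P1_level1:
  assumes free: P2_3P1_free and uv: "diametral 6 u v" and a: "d u a = 1" and y: "d u y = 2"
  shows "d a y = 1"
proof (rule ccontr)
  assume n: "d a y \<noteq> 1"
  have duv: "d u v = 6" by (rule diametralD[OF uv])
  obtain e where e: "d u e = 5" "d e v = 1" using down[OF duv] by auto
  obtain z where z: "d u z = 4" "d z e = 1" using down[OF e(1)] by auto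
  have ay: "2 \<le> d a y" using n a y levels[of u a y] by linarith
  have az: "2 \<le> d a z" and av: "2 \<le> d a v" and yz: "2 \<le> d y z" and yv: "2 \<le> d y v" and zv: "2 \<le> d z v"
    using a y z duv levels[of u a z] levels[of u a v] levels[of u y z] levels[of u y v] levels[of u z v]
    by linarith+
  \<comment> \<open>The edge \<open>u a\<close> is apart from the pairwise non-adjacent vertices
    \<open>y\<close>, \<open>z\<close> and \<open>v\<close>.\<close>
  show False
    by (rule P2_3P1_freeD[OF free, of u a y z v]) (use a y z duv ay az av yz yv zv in linarith)+
qed

lemma P2_3P1_level2:
  assumes free: P2_3P1_free and uv: "diametral 6 u v" and b: "d u b = 2" and y: "d u y = 2"
  shows "d b y \<noteq> 1"
proof
  assume n: "d b y = 1"
  have duv: "d u v = 6" by (rule diametralD[OF uv])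
  obtain e where e: "d u e = 5" "d e v = 1" using down[OF duv] by auto
  obtain z where z: "d u z = 4" "d z e = 1" using down[OF e(1)] by auto
  have bz: "2 \<le> d b z" and bv: "2 \<le> d b v" and yz: "2 \<le> d y z" and yv: "2 \<le> d y v" and zv: "2 \<le> d z v"
    using b y z duv levels[of u b z] levels[of u b v] levels[of u y z] levels[of u y v] levels[of u z v]
    by linarith+
  show False
    by (rule P2_3P1_freeD[OF free, of b y u z v]) (use n b y z duv bz bv yz yv zv sym[of b u] sym[of y u] in linarith)+
qed

text \<open>If \<open>z\<close> were not adjacent to the level 5 neighbour \<open>e\<close> of
  \<open>v\<close>, the edge \<open>e v\<close> would be apart from \<open>u\<close>,
  \<open>z\<close> and a level 2 vertex \<open>y\<close> on a geodesic to \<open>z\<close>.\<close>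

lemma P2_3P1_level4:
  assumes free: P2_3P1_free and uv: "diametral 6 u v" and z: "d u z = 4"
  shows "d v z = 2"
proof -
  have duv: "d u v = 6" by (rule diametralD[OF uv])
  obtain e where e: "d u e = 5" "d e v = 1" using down[OF duv] by auto
  obtain c where c: "d u c = 3" "d c z = 1" using down[OF z] by auto
  obtain y where y: "d u y = 2" "d y c = 1" using down[OF c(1)] by auto
  have yz: "2 \<le> d y z" and ye: "2 \<le> d y e" and yv: "2 \<le> d y v" and zv: "2 \<le> d z v"
    using y z e duv levels[of u y z] levels[of u y e] levels[of u y v] levels[of u z v] by linarith+
  have "d z e = 1"
  proof (rule ccontr)
    assume n: "d z e \<noteq> 1"
    have ze: "2 \<le> d z e" using n z e levels[of u z e] by linarith
    show False
      by (rule P2_3P1_freeD[OF free, of e v u y z])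
        (use y z e duv yz ye yv zv ze sym[of e u] sym[of e y] sym[of e z] sym[of v u] sym[of v y] sym[of v z] in linarith)+
  qed
  then show ?thesis using e zv sym[of v z] sym[of v e] sym[of z e] levels[of e v z] by linarith
qed

text \<open>The edge \<open>c z\<close> is apart from both ends; so a vertex \<open>y\<close> apart
  from \<open>u\<close>, \<open>v\<close> and \<open>z\<close> has to be adjacent to
  \<open>c\<close>.\<close>

lemma P2_3P1_level3_close:
  assumes free: P2_3P1_free and uv: "diametral 6 u v" and c: "d u c = 3" "d v c = 3" and y: "d u y \<le> 3" "d v y \<ge> 4"
    and z: "d u z = 4" "d c z = 1" and uy: "2 \<le> d u y" and yz: "2 \<le> d y z"
  shows "d y c = 1"
proof (rule ccontr)
  assume n: "d y c \<noteq> 1"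
  have duv: "d u v = 6" by (rule diametralD[OF uv])
  have zv: "d v z = 2" by (rule P2_3P1_level4[OF free uv z(1)])
  have "d y c \<noteq> 0" using y c levels[of y v c] by linarith
  then have "2 \<le> d y c" using n by linarith
  then show False
    by - (rule P2_3P1_freeD[OF free, of c z u y v],
      (use c y z duv zv uy yz sym[of c u] sym[of c v] sym[of c y] sym[of z u] sym[of z v] sym[of z y] sym[of y v] in linarith)+)
qed

text \<open>The hard part is that distance 5 from one end forces distance 1 from the other.
  Distances (5, 2) would put an edge inside level 2 of the second end; for (5, 3),
  \<open>P2_3P1_level3_close\<close> with the ends exchanged would make \<open>x\<close> adjacent to
  a vertex two levels below it.\<close>

lemma P2_3P1_types:
  assumes free: P2_3P1_free and uv: "diametral 6 u v" and n: "\<not> peripheral 6 x"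
  shows "d u x = 1 \<and> d v x = 5 \<or> d u x = 2 \<and> d v x = 4 \<or> d u x = 3 \<and> d v x = 3 \<or>
    d u x = 4 \<and> d v x = 2 \<or> d u x = 5 \<and> d v x = 1"
proof -
  have five: "d t x = 1" if st: "diametral 6 s t" and sx: "d s x = 5" for s t
  proof -
    note ts = diametral_sym[OF st] and dst = diametralD(3,4)[OF st]
    obtain p where p: "d s p = 4" "d p x = 1" using down[OF sx] by auto
    have tp: "d t p = 2" by (rule P2_3P1_level4[OF free st p(1)])
    have "d t x \<noteq> 2" using P2_3P1_level2[OF free ts tp] p by auto
    moreover have "d t x \<noteq> 3"
    proof
      assume tx: "d t x = 3"
      obtain c where c: "d s c = 3" "d c p = 1" using down[OF p(1)] by auto
      have tc: "d t c = 3" using tp c dst levels[of p t c] levels[of c s t] by linarith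
      obtain z where z: "d s z = 2" "d z c = 1" using down[OF c(1)] by auto
      have tz: "d t z = 4" using z tc dst levels[of z s t] levels[of c t z] by linarith
      have "2 \<le> d x z" using sx z levels[of s x z] by linarith
      then have "d x c = 1"
        using P2_3P1_level3_close[OF free ts tc c(1), of x z] tx sx tz z sym[of c z] by simp
      then show False using c sx levels[of x s c] by linarith
    qed
    moreover have "d t x \<noteq> 0" using sx dst levels[of x s t] by linarith
    moreover have "d t x \<le> 3" using tp p levels[of p t x] by linarith
    ultimately show ?thesis by linarith
  qed
  note vu = diametral_sym[OF uv]
  have lt: "d u x < 6" "d v x < 6" by (rule end_not_peripheral[OF uv n])+
  have ge: "6 \<le> d u x + d v x" using diametralD(3)[OF uv] levels[of x u v] by linarith
  have four: "d u x = 4 \<Longrightarrow> d v x = 2" "d v x = 4 \<Longrightarrow> d u x = 2"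
    using P2_3P1_level4[OF free uv] P2_3P1_level4[OF free vu] by simp_all
  consider "d u x = 1" | "d u x = 2" | "d u x = 3" | "d u x = 4" | "d u x = 5"
    using lt ge by linarith
  then show ?thesis
  proof cases
    case 1
    then show ?thesis using lt ge by linarith
  next
    case 2
    then have "d v x \<noteq> 5" using five[OF vu] by auto
    then show ?thesis using 2 lt ge by linarith
  next
    case 3
    then have "d v x \<noteq> 5" "d v x \<noteq> 4" using five[OF vu] four(2) by auto
    then show ?thesis using 3 lt ge by linarith
  next
    case 4
    then show ?thesis using four(1) by simp
  next
    case 5
    then show ?thesis using five[OF uv] by simp
  qed
qed

lemma P2_3P1_middle:
  assumes free: P2_3P1_free and uv: "diametral 6 u v" and y: "d u y = 2" and c: "d u c = 3" "d v c = 3"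
  shows "d y c = 1"
proof -
  note duv = diametralD(3,4)[OF uv]
  obtain z where z: "d v z = 2" "d z c = 1" using down[OF c(2)] by auto
  have uz: "d u z = 4" using z c duv levels[of z u v] levels[of c u z] by linarith
  have "4 \<le> d v y" "2 \<le> d y z" using y z uz duv levels[of y u v] levels[of u y z] by linarith+
  then show ?thesis
    using P2_3P1_level3_close[OF free uv c _ _ uz _ _, of y] y z sym[of c z] by simp
qed

lemma P2_3P1_level3:
  assumes free: P2_3P1_free and uv: "diametral 6 u v" and c: "d u c = 3" and y: "d u y = 4" "d c y = 1"
  shows "d v c = 3"
  using P2_3P1_level4[OF free uv y(1)] c y diametralD(3)[OF uv] levels[of y v c] levels[of c u v] by linarith

text \<open>By induction on the level, starting from the complete join of levels 1 and 2, every
  vertex of level at least 2 is closer to \<open>x\<close> than to \<open>u\<close>. So distance 5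
  from \<open>x\<close> would mean level 6.\<close>

lemma P2_3P1_far_15:
  assumes free: P2_3P1_free and uv: "diametral 6 u v" and x: "d u x = 1" "d v x = 5" and xy: "far x y"
    and ny: "\<not> peripheral 6 y"
  shows False
proof -
  note V = diametralD(1,2)[OF uv]
  have xy5: "5 \<le> d x y" using farD[OF xy V(2)] x sym[of v x] by linarith
  have near: "2 \<le> k \<Longrightarrow> d u z = k \<Longrightarrow> d x z < k" for k z
  proof (induction k arbitrary: z)
    case (Suc k)
    show ?case
    proof (cases "k = 1")
      case True
      then show ?thesis using P2_3P1_level1[OF free uv x(1), of z] Suc.prems by simp
    next
      case False
      obtain w where w: "d u w = k" "d w z = 1" using down[OF Suc.prems(2)] by auto
      have "d x w < k" using Suc.IH[OF _ w(1)] Suc.prems False by simp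
      then show ?thesis using w levels[of w x z] by linarith
    qed
  qed simp
  have "d u y < 6" by (rule end_not_peripheral[OF uv ny])
  then show False using near[of "d u y" y] xy5 x levels[of u x y] by linarith
qed

text \<open>All vertices of type (3, 3) are adjacent to \<open>x\<close>, which puts level 4 within
  distance 2 and level 5 within distance 3. Level 2 is within distance 2 through the common
  neighbour \<open>a\<close>.\<close>

lemma P2_3P1_far_24:
  assumes free: P2_3P1_free and uv: "diametral 6 u v" and x: "d u x = 2" "d v x = 4" and xy: "far x y"
    and ny: "\<not> peripheral 6 y"
  shows False
proof -
  note V = diametralD(1,2)[OF uv]
  have xy4: "4 \<le> d x y" using farD[OF xy V(2)] x sym[of v x] by linarith
  obtain a where a: "d u a = 1" "d a x = 1" using down[OF x(1)] by auto
  have near4: "d x z \<le> 2" if z: "d u z = 4" for z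
  proof -
    obtain c where c: "d u c = 3" "d c z = 1" using down[OF z] by auto
    have "d x c = 1" by (rule P2_3P1_middle[OF free uv x(1) c(1) P2_3P1_level3[OF free uv c(1) z c(2)]])
    then show ?thesis using c levels[of c x z] by linarith
  qed
  consider "d u y = 1" | "d u y = 2" | "d u y = 3" "d v y = 3" | "d u y = 4" | "d u y = 5"
    using P2_3P1_types[OF free uv ny] by auto
  then show False
  proof cases
    case 1
    then show False using x xy4 levels[of u x y] by linarith
  next
    case 2
    then show False using P2_3P1_level1[OF free uv a(1) 2] a xy4 levels[of a x y] by linarith
  next
    case 3
    then show False using P2_3P1_middle[OF free uv x(1) 3] xy4 by linarith
  next
    case 4
    then show False using near4[of y] xy4 by simp
  next
    case 5
    then obtain z where z: "d u z = 4" "d z y = 1" using down[of u y 5] by auto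
    then show False using near4[of z] xy4 levels[of z x y] by linarith
  qed
qed

text \<open>Two vertices of type (3, 3) share a neighbour in level 2. The other types are within
  distance 2 of \<open>x\<close> through a vertex at distance 2 from one of the ends, or lie at that
  distance themselves.\<close>

lemma P2_3P1_far_33:
  assumes free: P2_3P1_free and uv: "diametral 6 u v" and x: "d u x = 3" "d v x = 3" and xy: "far x y"
    and ny: "\<not> peripheral 6 y"
  shows False
proof -
  note V = diametralD(1,2)[OF uv] and vu = diametral_sym[OF uv]
  have xy3: "3 \<le> d x y" using farD[OF xy V(2)] x sym[of v x] by linarith
  have side: "\<not> (d s y = 1 \<and> d t y = 5) \<and> d s y \<noteq> 2"
    if st: "diametral 6 s t" and sx: "d s x = 3" and tx: "d t x = 3" for s t
  proof (intro conjI notI)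
    assume y: "d s y = 1 \<and> d t y = 5"
    then obtain p where p: "d t p = 4" "d p y = 1" using down[of t y 5] by auto
    have "d s p = 2" by (rule P2_3P1_level4[OF free diametral_sym[OF st] p(1)])
    then show False using P2_3P1_middle[OF free st _ sx tx, of p] p xy3 levels[of p x y] by simp
  next
    assume "d s y = 2"
    then show False using P2_3P1_middle[OF free st _ sx tx, of y] xy3 sym[of x y] by simp
  qed
  have "d u y = 3 \<and> d v y = 3"
    using P2_3P1_types[OF free uv ny] side[OF uv x] side[OF vu x(2,1)] by argo
  moreover obtain b where b: "d u b = 2" "d b x = 1" using down[OF x(1)] by auto
  ultimately have "d b y = 1" using P2_3P1_middle[OF free uv b(1)] by simp
  then show False using b xy3 levels[of b x y] by linarith
qed

lemma P2_3P1_far: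
  assumes free: P2_3P1_free and uv: "diametral 6 u v" and xy: "far x y"
  shows "peripheral 6 x \<or> peripheral 6 y"
proof (rule ccontr)
  assume "\<not> ?thesis"
  then have nx: "\<not> peripheral 6 x" and ny: "\<not> peripheral 6 y" by auto
  note vu = diametral_sym[OF uv]
  show False
    using P2_3P1_types[OF free uv nx] P2_3P1_far_15[OF free uv _ _ xy ny] P2_3P1_far_15[OF free vu _ _ xy ny]
      P2_3P1_far_24[OF free uv _ _ xy ny] P2_3P1_far_24[OF free vu _ _ xy ny] P2_3P1_far_33[OF free uv _ _ xy ny]
    by argo
qed

end

section \<open>Distances in connected graphs\<close>

definition adjacency :: "'a ugraph \<Rightarrow> ('a \<times> 'a) set" where
  "adjacency G = {(x, y). {x, y} \<in> edges G}"

text \<open>Powers of the adjacency relation give distances in \<open>nat\<close>, and adding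
  exponents gives the triangle inequality; \<open>distance_eq_gdist\<close> is the link to
  walks.\<close>

definition gdist :: "'a ugraph \<Rightarrow> 'a \<Rightarrow> 'a \<Rightarrow> nat" where
  "gdist G u v = (LEAST k. (u, v) \<in> adjacency G ^^ k)"

lemma walk_Cons:
  assumes "simple_graph G"
  shows "walk G u (x # y # p) v \<longleftrightarrow> x = u \<and> (u, y) \<in> adjacency G \<and> walk G y (y # p) v"
  unfolding walk_def adjacency_def using simple_graph_edge[OF assms] by auto

lemma walk_relpow:
  assumes G: "simple_graph G"
  shows "(\<exists>p. walk G u p v \<and> length p = Suc k) \<longleftrightarrow> u \<in> vertices G \<and> (u, v) \<in> adjacency G ^^ k"
proof (induction k arbitrary: u)
  case 0
  have "walk G u p v \<and> length p = Suc 0 \<longleftrightarrow> u \<in> vertices G \<and> u = v \<and> p = [u]" for p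
    unfolding walk_def by (cases p) auto
  then show ?case by auto
next
  case (Suc k)
  show ?case
  proof
    assume "\<exists>p. walk G u p v \<and> length p = Suc (Suc k)"
    then obtain p where p: "walk G u p v" "length p = Suc (Suc k)" by auto
    then obtain x y q where q: "p = x # y # q" by (metis length_Suc_conv)
    have *: "(u, y) \<in> adjacency G" "walk G y (y # q) v" using p(1) unfolding q walk_Cons[OF G] by auto
    have "\<exists>p. walk G y p v \<and> length p = Suc k"
      using *(2) p(2) q by (intro exI[of _ "y # q"]) simp
    then have "(y, v) \<in> adjacency G ^^ k" using Suc.IH by simp
    moreover have "u \<in> vertices G" using *(1) simple_graph_edge[OF G] unfolding adjacency_def by auto
    ultimately show "u \<in> vertices G \<and> (u, v) \<in> adjacency G ^^ Suc k"
      using *(1) relpow_Suc_I2 by metis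
  next
    assume u: "u \<in> vertices G \<and> (u, v) \<in> adjacency G ^^ Suc k"
    then obtain y where y: "(u, y) \<in> adjacency G" "(y, v) \<in> adjacency G ^^ k"
      using relpow_Suc_D2 by metis
    have "y \<in> vertices G" using y(1) simple_graph_edge[OF G] unfolding adjacency_def by auto
    then obtain p where p: "walk G y p v" "length p = Suc k" using Suc.IH y(2) by auto
    then obtain q where q: "p = y # q" unfolding walk_def by (cases p) auto
    have "walk G u (u # p) v" unfolding q walk_Cons[OF G] using p(1) y(1) q by simp
    then show "\<exists>p. walk G u p v \<and> length p = Suc (Suc k)" using p(2) by (intro exI[of _ "u # p"]) simp
  qed
qed

locale connected_simple_graph =
  fixes G :: "'a ugraph"
  assumes simple: "simple_graph G" and connected: "connected_graph G"
begin

lemma finite_vertices: "finite (vertices G)"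
  using simple unfolding simple_graph_def by simp

lemma reachable:
  assumes "u \<in> vertices G" "v \<in> vertices G"
  shows "(u, v) \<in> adjacency G ^^ gdist G u v"
proof -
  obtain p where p: "walk G u p v" using connected assms unfolding connected_graph_def by blast
  then have "length p = Suc (length p - 1)" unfolding walk_def by (cases p) auto
  then have "(u, v) \<in> adjacency G ^^ (length p - 1)" using p walk_relpow[OF simple] by metis
  then show ?thesis unfolding gdist_def by (rule LeastI)
qed

lemma gdist_le: "(u, v) \<in> adjacency G ^^ k \<Longrightarrow> gdist G u v \<le> k"
  unfolding gdist_def by (rule Least_le)

lemma distance_eq_gdist:
  assumes "u \<in> vertices G" "v \<in> vertices G"
  shows "distance G u v = enat (gdist G u v)"
  unfolding distance_def
proof (intro antisym INF_greatest)
  obtain p where p: "walk G u p v" "length p = Suc (gdist G u v)"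
    using reachable[OF assms] assms walk_relpow[OF simple] by metis
  then show "(INF p\<in>{p. walk G u p v}. enat (length p - 1)) \<le> enat (gdist G u v)"
    by (intro INF_lower2[of p]) auto
  fix p assume "p \<in> {p. walk G u p v}"
  then have p: "walk G u p v" by simp
  then have "length p = Suc (length p - 1)" unfolding walk_def by (cases p) auto
  then have "gdist G u v \<le> length p - 1" using p walk_relpow[OF simple] gdist_le by metis
  then show "enat (gdist G u v) \<le> enat (length p - 1)" by simp
qed

lemma gdist_self [simp]: "gdist G u u = 0"
  using gdist_le[of u u 0] by simp

lemma gdist_eq_0: "\<lbrakk>u \<in> vertices G; v \<in> vertices G\<rbrakk> \<Longrightarrow> gdist G u v = 0 \<longleftrightarrow> u = v"
  using reachable[of u v] by fastforce

lemma gdist_sym: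
  assumes "u \<in> vertices G" "v \<in> vertices G" shows "gdist G u v = gdist G v u"
proof -
  have c: "(x, y) \<in> adjacency G ^^ k \<Longrightarrow> (y, x) \<in> adjacency G ^^ k" for x y k
  proof (induction k arbitrary: y)
    case (Suc k)
    then obtain z where "(x, z) \<in> adjacency G ^^ k" "(z, y) \<in> adjacency G" by auto
    then show ?case using Suc.IH relpow_Suc_I2[of y z "adjacency G" x k]
      by (simp add: adjacency_def insert_commute)
  qed simp
  show ?thesis using gdist_le c reachable assms by (meson antisym)
qed

lemma gdist_tri:
  assumes "u \<in> vertices G" "v \<in> vertices G" "w \<in> vertices G"
  shows "gdist G u w \<le> gdist G u v + gdist G v w"
  using reachable[OF assms(1,2)] reachable[OF assms(2,3)] by (intro gdist_le) (auto simp: relpow_add)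

lemma gdist_eq_1:
  assumes "u \<in> vertices G" "v \<in> vertices G"
  shows "gdist G u v = 1 \<longleftrightarrow> {u, v} \<in> edges G"
proof
  assume "gdist G u v = 1"
  then show "{u, v} \<in> edges G" using reachable[OF assms] unfolding adjacency_def by simp
next
  assume e: "{u, v} \<in> edges G"
  then have "gdist G u v \<le> 1" by (intro gdist_le) (simp add: adjacency_def)
  moreover have "gdist G u v \<noteq> 0" using gdist_eq_0 assms simple_graph_edge[OF simple e] by simp
  ultimately show "gdist G u v = 1" by simp
qed

lemma gdist_predecessor:
  assumes uv: "u \<in> vertices G" "v \<in> vertices G" and k: "gdist G u v = Suc k"
  shows "\<exists>w\<in>vertices G. gdist G u w = k \<and> gdist G w v = 1"
proof -
  have "(u, v) \<in> adjacency G ^^ Suc k" using reachable[OF uv] k by simp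
  then obtain w where w: "(u, w) \<in> adjacency G ^^ k" "(w, v) \<in> adjacency G" by auto
  have wV: "w \<in> vertices G" and e: "{w, v} \<in> edges G"
    using w(2) simple_graph_edge[OF simple] unfolding adjacency_def by auto
  have wv: "gdist G w v = 1" using gdist_eq_1[OF wV uv(2)] e by simp
  have "gdist G u w = k" using gdist_le[OF w(1)] gdist_tri[OF uv(1) wV uv(2)] k wv by simp
  then show ?thesis using wV wv by blast
qed

text \<open>Identifying all points outside the graph with one vertex makes the distance total.\<close>

definition to_vertex :: "'a \<Rightarrow> 'a" where
  "to_vertex x = (if x \<in> vertices G then x else SOME v. v \<in> vertices G)"

lemma to_vertex_in: "to_vertex x \<in> vertices G"
  using connected unfolding to_vertex_def connected_graph_def by (simp add: some_in_eq)

lemma to_vertex_id [simp]: "x \<in> vertices G \<Longrightarrow> to_vertex x = x"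
  unfolding to_vertex_def by simp

definition vdist :: "'a \<Rightarrow> 'a \<Rightarrow> nat" where
  "vdist x y = gdist G (to_vertex x) (to_vertex y)"

sublocale geodesic_metric "vertices G" vdist
proof
  show "finite (vertices G)" by (rule finite_vertices)
  show "vdist x x = 0" for x by (simp add: vdist_def)
  show "vdist x y = vdist y x" for x y
    unfolding vdist_def by (intro gdist_sym to_vertex_in)
  show "vdist x z \<le> vdist x y + vdist y z" for x y z
    unfolding vdist_def by (intro gdist_tri to_vertex_in)
  show "\<exists>z\<in>vertices G. vdist x z = k \<and> vdist z y = 1" if "vdist x y = Suc k" for x y k
    using gdist_predecessor[OF to_vertex_in to_vertex_in, of x y] that unfolding vdist_def by auto
qed

lemma vdist_edge: "\<lbrakk>u \<in> vertices G; v \<in> vertices G\<rbrakk> \<Longrightarrow> vdist u v = 1 \<longleftrightarrow> {u, v} \<in> edges G"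
  unfolding vdist_def using gdist_eq_1 by simp

lemma vdist_eq_0: "\<lbrakk>u \<in> vertices G; v \<in> vertices G\<rbrakk> \<Longrightarrow> vdist u v = 0 \<longleftrightarrow> u = v"
  unfolding vdist_def using gdist_eq_0 by simp

lemma distance_eq_vdist:
  "\<lbrakk>u \<in> vertices G; v \<in> vertices G\<rbrakk> \<Longrightarrow> distance G u v = enat (vdist u v)"
  unfolding vdist_def by (simp add: distance_eq_gdist)

lemma diameter_le_iff: "diameter G \<le> enat D \<longleftrightarrow> (\<forall>u v. vdist u v \<le> D)"
proof -
  have "diameter G \<le> enat D \<longleftrightarrow> (\<forall>u\<in>vertices G. \<forall>v\<in>vertices G. distance G u v \<le> enat D)"
    unfolding diameter_def by (simp add: SUP_le_iff)
  also have "\<dots> \<longleftrightarrow> (\<forall>u\<in>vertices G. \<forall>v\<in>vertices G. vdist u v \<le> D)"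
    by (simp add: distance_eq_vdist)
  also have "\<dots> \<longleftrightarrow> (\<forall>u v. vdist u v \<le> D)"
    using to_vertex_in unfolding vdist_def by (metis to_vertex_id)
  finally show ?thesis .
qed

text \<open>A diameter above \<open>D - 1\<close> is witnessed by a pair at distance at least
  \<open>D\<close>. For \<open>D = 0\<close> there is no smaller bound to refute, and any vertex is
  a witness.\<close>

lemma diameter_eq_iff:
  assumes le: "diameter G \<le> enat D"
  shows "diameter G = enat D \<longleftrightarrow> (\<exists>u\<in>vertices G. \<exists>v\<in>vertices G. vdist u v = D)"
proof
  assume eq: "diameter G = enat D"
  obtain x where x: "x \<in> vertices G" using connected unfolding connected_graph_def by auto
  show "\<exists>u\<in>vertices G. \<exists>v\<in>vertices G. vdist u v = D"
  proof (cases D)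
    case 0
    then show ?thesis using x refl by blast
  next
    case (Suc k)
    then have "\<not> diameter G \<le> enat k" using eq by simp
    then obtain u v where "\<not> vdist u v \<le> k" unfolding diameter_le_iff by blast
    moreover have "vdist u v \<le> D" using le unfolding diameter_le_iff by blast
    ultimately have "vdist u v = D" using Suc by simp
    then have "vdist (to_vertex u) (to_vertex v) = D" unfolding vdist_def by (simp add: to_vertex_in)
    then show ?thesis using to_vertex_in by blast
  qed
next
  assume "\<exists>u\<in>vertices G. \<exists>v\<in>vertices G. vdist u v = D"
  then obtain u v where uv: "u \<in> vertices G" "v \<in> vertices G" "distance G u v = enat D"
    using distance_eq_vdist by metis
  then have "enat D \<le> diameter G" unfolding diameter_def by (intro SUP_upper2[of u] SUP_upper2[of v]) auto
  then show "diameter G = enat D" using le by simp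
qed

text \<open>Distance 1 means adjacent, and distance at least 2 means neither adjacent nor equal;
  injectivity is thus included.\<close>

lemma linear_forest_embed:
  assumes "finite T" "f ` T \<subseteq> vertices G"
    and f: "\<And>i j. i \<in> T \<Longrightarrow> j \<in> T \<Longrightarrow> i < j \<Longrightarrow> if j = Suc i then vdist (f i) (f j) = 1 else 2 \<le> vdist (f i) (f j)"
  shows "linear_forest T \<subseteq>\<^sub>i G"
  unfolding induced_subgraph_iff[OF simple_linear_forest[OF assms(1)] simple] vertices_linear_forest
proof (intro exI[of _ f] conjI ballI)
  have pos: "vdist (f i) (f j) \<noteq> 0" if "i \<in> T" "j \<in> T" "i < j" for i j
    using f[OF that] by (auto split: if_splits)
  show "inj_on f T" by (rule linorder_inj_onI') (metis pos refl)
  show "f ` T \<subseteq> vertices G" by fact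
  fix i j assume ij: "i \<in> T" "j \<in> T"
  then have V: "f i \<in> vertices G" "f j \<in> vertices G" using assms(2) by auto
  show "{i, j} \<in> edges (linear_forest T) \<longleftrightarrow> {f i, f j} \<in> edges G"
    unfolding vdist_edge[OF V, symmetric] edges_linear_forest
    using f[of i j] f[of j i] ij refl[of "f i"] sym[of "f i" "f j"]
    by (cases i j rule: linorder_cases) (auto split: if_splits)
qed

lemma geodesic:
  assumes "u \<in> vertices G"
  shows "v \<in> vertices G \<Longrightarrow> vdist u v = k \<Longrightarrow> \<exists>f. f k = v \<and> (\<forall>i\<le>k. f i \<in> vertices G \<and> vdist u (f i) = i) \<and>
    (\<forall>i<k. vdist (f i) (f (Suc i)) = 1)"
proof (induction k arbitrary: v)
  case 0
  then show ?case by (intro exI[of _ "\<lambda>_. v"]) simp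
next
  case (Suc k)
  obtain w where w: "w \<in> vertices G" "vdist u w = k" "vdist w v = 1"
    using predecessor[OF Suc.prems(2)] by blast
  obtain f where f: "f k = w" "\<forall>i\<le>k. f i \<in> vertices G \<and> vdist u (f i) = i"
    "\<forall>i<k. vdist (f i) (f (Suc i)) = 1"
    using Suc.IH[OF w(1,2)] by blast
  show ?case
    using f w(3) Suc.prems by (intro exI[of _ "f(Suc k := v)"]) (auto simp: le_Suc_eq less_Suc_eq)
qed

text \<open>The first \<open>D + 2\<close> vertices of a longer geodesic induce a path, since a
  chord would shorten it.\<close>

lemma diameter_bound:
  assumes "\<not> path_graph (D + 2) \<subseteq>\<^sub>i G"
  shows "diameter G \<le> enat D"
proof (rule ccontr)
  assume "\<not> diameter G \<le> enat D"
  then obtain x y where "\<not> vdist x y \<le> D" unfolding diameter_le_iff by blast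
  then have far: "D < vdist (to_vertex x) (to_vertex y)" by (simp add: vdist_def to_vertex_in)
  obtain f where f: "\<And>i. i \<le> vdist (to_vertex x) (to_vertex y) \<Longrightarrow> f i \<in> vertices G \<and> vdist (to_vertex x) (f i) = i"
    "\<And>i. i < vdist (to_vertex x) (to_vertex y) \<Longrightarrow> vdist (f i) (f (Suc i)) = 1"
    using geodesic[OF to_vertex_in to_vertex_in, of x y] by blast
  have "linear_forest {..<D + 2} \<subseteq>\<^sub>i G"
  proof (rule linear_forest_embed[of _ f])
    show "f ` {..<D + 2} \<subseteq> vertices G" using f(1) far by auto
    show "if j = Suc i then vdist (f i) (f j) = 1 else 2 \<le> vdist (f i) (f j)"
      if "i \<in> {..<D + 2}" "j \<in> {..<D + 2}" "i < j" for i j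
      using that f(2)[of i] f(1)[of i] f(1)[of j] far levels(1,2)[of "to_vertex x" "f i" "f j"] by auto
  qed simp
  then show False using assms by (simp add: path_graph_linear_forest)
qed

end

lemma path_graph_connected_simple: "0 < n \<Longrightarrow> connected_simple_graph (path_graph n)"
proof
  assume n: "0 < n"
  show simple: "simple_graph (path_graph n)" by (rule simple_path_graph)
  let ?R = "adjacency (path_graph n)"
  have up: "j + k < n \<Longrightarrow> (j, j + k) \<in> ?R ^^ k" and down: "j + k < n \<Longrightarrow> (j + k, j) \<in> ?R ^^ k" for j k
  proof (induction k)
    case (Suc k)
    have e: "(j + k, j + Suc k) \<in> ?R" "(j + Suc k, j + k) \<in> ?R" if "j + Suc k < n"
      using that unfolding adjacency_def path_graph_linear_forest by (simp_all add: edges_linear_forest)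
    {
      case 1
      then show ?case using Suc.IH e(1) by (simp only: relpow.simps) (rule relcompI, simp_all)
    next
      case 2
      then show ?case using Suc.IH e(2) relpow_Suc_I2 by (metis Suc_lessD add_Suc_right)
    }
  qed simp_all
  have "\<exists>p. walk (path_graph n) u p v" if uv: "u \<in> vertices (path_graph n)" "v \<in> vertices (path_graph n)" for u v
  proof -
    have "(u, v) \<in> ?R ^^ (v - u + (u - v))"
      using up[of u "v - u"] down[of v "u - v"] uv
      by (cases "u \<le> v") (simp_all add: path_graph_linear_forest)
    then show ?thesis using walk_relpow[OF simple, of u v] uv(1) by blast
  qed
  moreover have "vertices (path_graph n) \<noteq> {}" using n by (auto simp: path_graph_linear_forest)
  ultimately show "connected_graph (path_graph n)" unfolding connected_graph_def by blast
qed

lemma diameter_path_graph: "enat D \<le> diameter (path_graph (D + 1))"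
proof -
  interpret connected_simple_graph "path_graph (D + 1)" by (rule path_graph_connected_simple) simp
  have le: "(u, v) \<in> adjacency (path_graph (D + 1)) ^^ k \<Longrightarrow> v \<le> u + k" for u v k
  proof (induction k arbitrary: v)
    case (Suc k)
    then obtain w where w: "(u, w) \<in> adjacency (path_graph (D + 1)) ^^ k" "(w, v) \<in> adjacency (path_graph (D + 1))"
      by auto
    then show ?case using Suc.IH[OF w(1)] unfolding adjacency_def path_graph_linear_forest
      by (auto simp: edges_linear_forest)
  qed simp
  have V: "0 \<in> vertices (path_graph (D + 1))" "D \<in> vertices (path_graph (D + 1))"
    by (simp_all add: path_graph_linear_forest)
  have "D \<le> vdist 0 D" using le[OF reachable[OF V]] unfolding vdist_def to_vertex_id[OF V(1)] to_vertex_id[OF V(2)] by simp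
  then have "enat D \<le> distance (path_graph (D + 1)) 0 D" using distance_eq_vdist[OF V] by simp
  then show ?thesis unfolding diameter_def using V
    by (intro SUP_upper2[OF V(1)] SUP_upper2[OF V(2)])
qed

text \<open>The path on \<open>D + 1\<close> vertices lies in the class and attains the bound; the
  path on \<open>D + 2\<close> vertices contains \<open>H\<close> and so is not induced in any graph
  of the class.\<close>

lemma d_max_connected_free:
  assumes H: "simple_graph H" and sub: "H \<subseteq>\<^sub>i path_graph (D + 2)" and n: "\<not> H \<subseteq>\<^sub>i path_graph (D + 1)"
  shows "d_max (connected_free H) = enat D"
    and "G \<in> connected_free H \<Longrightarrow> diameter G \<le> enat D"
proof -
  show le: "diameter G \<le> enat D" if G: "G \<in> connected_free H" for G
  proof -
    interpret connected_simple_graph G using G unfolding connected_free_def by unfold_locales auto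
    have "\<not> path_graph (D + 2) \<subseteq>\<^sub>i G"
      using induced_subgraph_trans[OF H simple_path_graph simple sub] G unfolding connected_free_def by blast
    then show ?thesis by (rule diameter_bound)
  qed
  have "path_graph (D + 1) \<in> connected_free H"
    using path_graph_connected_simple[of "D + 1"] n
    unfolding connected_free_def connected_simple_graph_def by simp
  then show "d_max (connected_free H) = enat D"
    unfolding d_max_def using le diameter_path_graph
    by (intro antisym SUP_least SUP_upper2[of "path_graph (D + 1)"]) auto
qed

context connected_simple_graph begin

lemma vdist_to_vertex [simp]: "vdist (to_vertex x) y = vdist x y" "vdist x (to_vertex y) = vdist x y"
  unfolding vdist_def by (simp_all add: to_vertex_in)

lemma linear_forest_embed_total:
  assumes T: "finite T" and
    f: "\<And>i j. i \<in> T \<Longrightarrow> j \<in> T \<Longrightarrow> i < j \<Longrightarrow> if j = Suc i then vdist (f i) (f j) = 1 else 2 \<le> vdist (f i) (f j)"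
  shows "linear_forest T \<subseteq>\<^sub>i G"
  by (rule linear_forest_embed[OF T, of "\<lambda>i. to_vertex (f i)"])
    (use f in \<open>auto simp: to_vertex_in\<close>)

lemma P3_P1_freeI: "\<not> linear_forest {0, 1, 2, 4} \<subseteq>\<^sub>i G \<Longrightarrow> P3_P1_free"
  unfolding P3_P1_free_def
proof (intro notI, elim notE exE conjE)
  fix p q r x
  assume "vdist p q = 1" "vdist q r = 1" "2 \<le> vdist p r" "2 \<le> vdist p x" "2 \<le> vdist q x" "2 \<le> vdist r x"
  then show "linear_forest {0, 1, 2, 4} \<subseteq>\<^sub>i G"
    by (intro linear_forest_embed_total[of _ "\<lambda>i. if i = 0 then p else if i = 1 then q else if i = 2 then r else x"])
      auto
qed

lemma P4_P1_freeI: "\<not> linear_forest {0, 1, 2, 3, 5} \<subseteq>\<^sub>i G \<Longrightarrow> P4_P1_free"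
  unfolding P4_P1_free_def
proof (intro notI, elim notE exE conjE)
  fix p q r s x
  assume "vdist p q = 1" "vdist q r = 1" "vdist r s = 1" "2 \<le> vdist p r" "2 \<le> vdist p s" "2 \<le> vdist q s"
    "2 \<le> vdist p x" "2 \<le> vdist q x" "2 \<le> vdist r x" "2 \<le> vdist s x"
  then show "linear_forest {0, 1, 2, 3, 5} \<subseteq>\<^sub>i G"
    by (intro linear_forest_embed_total[of _ "\<lambda>i. if i = 0 then p else if i = 1 then q else if i = 2 then r
      else if i = 3 then s else x"]) auto
qed

lemma P3_2P1_freeI: "\<not> linear_forest {0, 1, 2, 4, 6} \<subseteq>\<^sub>i G \<Longrightarrow> P3_2P1_free"
  unfolding P3_2P1_free_def
proof (intro notI, elim notE exE conjE)
  fix p q r x y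
  assume "vdist p q = 1" "vdist q r = 1" "2 \<le> vdist p r" "2 \<le> vdist p x" "2 \<le> vdist q x" "2 \<le> vdist r x"
    "2 \<le> vdist p y" "2 \<le> vdist q y" "2 \<le> vdist r y" "2 \<le> vdist x y"
  then show "linear_forest {0, 1, 2, 4, 6} \<subseteq>\<^sub>i G"
    by (intro linear_forest_embed_total[of _ "\<lambda>i. if i = 0 then p else if i = 1 then q else if i = 2 then r
      else if i = 4 then x else y"]) auto
qed

lemma two_P2_P1_freeI: "\<not> linear_forest {0, 1, 3, 4, 6} \<subseteq>\<^sub>i G \<Longrightarrow> two_P2_P1_free"
  unfolding two_P2_P1_free_def
proof (intro notI, elim notE exE conjE)
  fix p q r s x
  assume "vdist p q = 1" "vdist r s = 1" "2 \<le> vdist p r" "2 \<le> vdist p s" "2 \<le> vdist q r" "2 \<le> vdist q s"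
    "2 \<le> vdist p x" "2 \<le> vdist q x" "2 \<le> vdist r x" "2 \<le> vdist s x"
  then show "linear_forest {0, 1, 3, 4, 6} \<subseteq>\<^sub>i G"
    by (intro linear_forest_embed_total[of _ "\<lambda>i. if i = 0 then p else if i = 1 then q else if i = 3 then r
      else if i = 4 then s else x"]) auto
qed

lemma P2_3P1_freeI: "\<not> linear_forest {0, 1, 3, 5, 7} \<subseteq>\<^sub>i G \<Longrightarrow> P2_3P1_free"
  unfolding P2_3P1_free_def
proof (intro notI, elim notE exE conjE)
  fix p q x y z
  assume "vdist p q = 1" "2 \<le> vdist p x" "2 \<le> vdist p y" "2 \<le> vdist p z" "2 \<le> vdist q x" "2 \<le> vdist q y"
    "2 \<le> vdist q z" "2 \<le> vdist x y" "2 \<le> vdist x z" "2 \<le> vdist y z"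
  then show "linear_forest {0, 1, 3, 5, 7} \<subseteq>\<^sub>i G"
    by (intro linear_forest_embed_total[of _ "\<lambda>i. if i = 0 then p else if i = 1 then q else if i = 3 then x
      else if i = 5 then y else z"]) auto
qed

text \<open>The four values of \<open>D\<close> are the path orders 5 to 8. Order 7 belongs to two
  forests, \<open>P_3 + 2P_1\<close> and \<open>2P_2 + P_1\<close>, hence the alternative for
  \<open>D = 5\<close>.\<close>

lemma three_sweeps:
  assumes D: "3 \<le> D" "D \<le> 6"
    and free: "\<not> linear_forest (set (pattern (D + 2))) \<subseteq>\<^sub>i G \<or> D = 5 \<and> \<not> linear_forest {0, 1, 3, 4, 6} \<subseteq>\<^sub>i G"
    and uv: "diametral D u v" and xy: "far x y" and yz: "far y z"
  shows "peripheral D x \<or> peripheral D y \<or> peripheral D z"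
proof -
  have free': "\<not> linear_forest (set (pattern (D + 2))) \<subseteq>\<^sub>i G \<or> \<not> linear_forest {0, 1, 3, 4, 6} \<subseteq>\<^sub>i G" if "D = 5"
    using free by blast
  consider "D = 3" | "D = 4" | "D = 5" | "D = 6" using D by linarith
  then show ?thesis
  proof cases
    case 1
    then have P3_P1_free using free by (intro P3_P1_freeI) (auto simp: pattern_def)
    then show ?thesis using P3_P1_far[OF _ uv[unfolded 1] xy] 1 by blast
  next
    case 2
    then have P4_P1_free using free by (intro P4_P1_freeI) (auto simp: pattern_def)
    then show ?thesis using P4_P1_far[OF _ uv[unfolded 2] xy yz] 2 by blast
  next
    case 3
    then have "P3_2P1_free \<or> two_P2_P1_free"
      using free'[OF 3] P3_2P1_freeI two_P2_P1_freeI by (auto simp: pattern_def)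
    then show ?thesis using P3_2P1_far[OF _ uv[unfolded 3] xy] two_P2_P1_far[OF _ uv[unfolded 3] xy] 3 by blast
  next
    case 4
    then have P2_3P1_free using free by (intro P2_3P1_freeI) (auto simp: pattern_def)
    then show ?thesis using P2_3P1_far[OF _ uv[unfolded 4] xy] 4 by blast
  qed
qed

end

section \<open>Running time of programs\<close>

definition runs :: "nat \<Rightarrow> com \<Rightarrow> state \<Rightarrow> nat \<Rightarrow> (state \<Rightarrow> bool) \<Rightarrow> bool" where
  "runs w c s T Q \<longleftrightarrow> (\<exists>t s'. exec w c s t s' \<and> t \<le> T \<and> Q s')"

lemma runs_mono: "runs w c s T Q \<Longrightarrow> T \<le> T' \<Longrightarrow> (\<And>s'. Q s' \<Longrightarrow> Q' s') \<Longrightarrow> runs w c s T' Q'"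
  unfolding runs_def by (meson order_trans)

lemma runs_Seq:
  assumes "runs w c s T1 P" "\<And>s'. P s' \<Longrightarrow> runs w d s' T2 Q" "1 + T1 + T2 \<le> T"
  shows "runs w (Seq c d) s T Q"
proof -
  obtain t s' where c: "exec w c s t s'" "t \<le> T1" "P s'" using assms(1) unfolding runs_def by blast
  obtain t' s'' where d: "exec w d s' t' s''" "t' \<le> T2" "Q s''"
    using assms(2)[OF c(3)] unfolding runs_def by blast
  have "exec w (Seq c d) s (1 + t + t') s''" using c(1) d(1) by (rule exec.Seq)
  moreover have "1 + t + t' \<le> T" using c(2) d(2) assms(3) by linarith
  ultimately show ?thesis unfolding runs_def using d(3) by blast
qed

text \<open>The invariant counts iterations, and each iteration has its own bound
  \<open>T k\<close>; this allows the degrees to be summed over the vertices.\<close>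

lemma runs_While:
  assumes step: "\<And>k s. k < N \<Longrightarrow> I k s \<Longrightarrow> bval w b s \<and> runs w c s (T k) (I (Suc k))"
    and stop: "\<And>s. I N s \<Longrightarrow> \<not> bval w b s" and init: "I 0 s"
  shows "runs w (While b c) s ((\<Sum>k<N. 1 + bcost b + T k) + (1 + bcost b)) (I N)"
proof -
  have "runs w (While b c) s ((\<Sum>k\<in>{j..<N}. 1 + bcost b + T k) + (1 + bcost b)) (I N)"
    if "j \<le> N" "I j s" for j s
    using that
  proof (induction arbitrary: s rule: inc_induct)
    case base
    then show ?case unfolding runs_def using exec.WhileFalse[OF stop[OF base]] by fastforce
  next
    case (step j)
    obtain t s' where c: "exec w c s t s'" "t \<le> T j" "I (Suc j) s'" and b: "bval w b s"
      using assms(1)[OF step.hyps(2) step.prems] unfolding runs_def by blast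
    obtain t' s'' where l: "exec w (While b c) s' t' s''" "I N s''"
      "t' \<le> (\<Sum>k\<in>{Suc j..<N}. 1 + bcost b + T k) + (1 + bcost b)"
      using step.IH[OF c(3)] unfolding runs_def by blast
    have "exec w (While b c) s (1 + bcost b + t + t') s''" by (rule exec.WhileTrue[OF b c(1) l(1)])
    moreover have "1 + bcost b + t + t' \<le> (\<Sum>k\<in>{j..<N}. 1 + bcost b + T k) + (1 + bcost b)"
      using c(2) l(3) sum.atLeast_Suc_lessThan[OF step.hyps(2), of "\<lambda>k. 1 + bcost b + T k"] by linarith
    ultimately show ?case unfolding runs_def using l(2) by blast
  qed
  from this[of 0 s] init show ?thesis by (simp add: atLeast0LessThan)
qed

fun loop_free :: "com \<Rightarrow> bool" where
  "loop_free (Seq c d) \<longleftrightarrow> loop_free c \<and> loop_free d"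
| "loop_free (Cond b c d) \<longleftrightarrow> loop_free c \<and> loop_free d"
| "loop_free (While b c) \<longleftrightarrow> False"
| "loop_free _ \<longleftrightarrow> True"

text \<open>Symbolic execution of code without loops, so that simplification computes the final
  state. The equation for \<open>While\<close> is a dummy, excluded by
  \<open>loop_free\<close>.\<close>

fun effect :: "nat \<Rightarrow> com \<Rightarrow> state \<Rightarrow> state" where
  "effect w Skip s = s"
| "effect w (Assign r x) s = set_reg r (aval w x s) s"
| "effect w (Store a i x) s = set_array a (aval w i s) (aval w x s) s"
| "effect w (Seq c d) s = effect w d (effect w c s)"
| "effect w (Cond b c d) s = (if bval w b s then effect w c s else effect w d s)"
| "effect w (While b c) s = s"

fun cost_bound :: "com \<Rightarrow> nat" where
  "cost_bound Skip = 1"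
| "cost_bound (Assign r x) = 1 + acost x"
| "cost_bound (Store a i x) = 1 + acost i + acost x"
| "cost_bound (Seq c d) = 1 + cost_bound c + cost_bound d"
| "cost_bound (Cond b c d) = 1 + bcost b + max (cost_bound c) (cost_bound d)"
| "cost_bound (While b c) = 0"

lemma runs_loop_free_aux:
  "loop_free c \<Longrightarrow> \<exists>t\<le>cost_bound c. exec w c s t (effect w c s)"
proof (induction c arbitrary: s)
  case (Seq c d)
  then obtain t t' where "t \<le> cost_bound c" "exec w c s t (effect w c s)"
    "t' \<le> cost_bound d" "exec w d (effect w c s) t' (effect w d (effect w c s))"
    by (meson loop_free.simps(1))
  then show ?case using exec.Seq by (intro exI[of _ "1 + t + t'"]) fastforce
next
  case (Cond b c d)
  then obtain t t' where t: "t \<le> cost_bound c" "exec w c s t (effect w c s)"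
    "t' \<le> cost_bound d" "exec w d s t' (effect w d s)"
    by (meson loop_free.simps(2))
  show ?case
  proof (cases "bval w b s")
    case True
    then show ?thesis using t exec.CondTrue[OF True t(2)] by (intro exI[of _ "1 + bcost b + t"]) auto
  next
    case False
    then show ?thesis using t exec.CondFalse[OF False t(4)] by (intro exI[of _ "1 + bcost b + t'"]) auto
  qed
next
  case Skip
  show ?case using exec.Skip[of w s] by auto
next
  case (Assign r x)
  show ?case using exec.Assign[of w r x s] by auto
next
  case (Store a i x)
  show ?case using exec.Store[of w a i x s] by auto
qed simp

lemma runs_loop_free:
  "\<lbrakk>loop_free c; Q (effect w c s); cost_bound c \<le> T\<rbrakk> \<Longrightarrow> runs w c s T Q"
  using runs_loop_free_aux[of c w s] unfolding runs_def by (meson order_trans)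

lemma regs_set [simp]:
  "regs (set_reg r x s) = (regs s)(r := x)" "arrays (set_reg r x s) = arrays s"
  "regs (set_array a i x s) = regs s" "arrays (set_array a i x s) = (arrays s)(a := (arrays s a)(i := x))"
  by (cases s; simp)+

text \<open>
  Register \<open>1\<close> holds the current vertex, \<open>2\<close> the position in array \<open>1\<close>, \<open>3\<close> the neighbour, \<open>4\<close> the key of the
  vertex, \<open>5\<close> the best key, \<open>6\<close> the vertex with that key, \<open>7\<close> the answer and \<open>8\<close> the source.
\<close>

definition scan :: "com \<Rightarrow> com \<Rightarrow> com \<Rightarrow> com" where
  "scan pre body post =
    Seq (Assign 1 (Lit 0))
      (While (Less (Reg 1) (Reg 0))
        (Seq (Seq pre (Assign 2 (Load 0 (Reg 1))))
          (Seq (While (Less (Reg 2) (Load 0 (Add (Reg 1) (Lit 1))))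
                 (Seq (Assign 3 (Load 1 (Reg 2))) (Seq body (Assign 2 (Add (Reg 2) (Lit 1))))))
            (Seq post (Assign 1 (Add (Reg 1) (Lit 1)))))))"

text \<open>The exponent 4 is what \<open>word_bounds\<close> draws on: keys are at most
  \<open>8 * n\<close>, the product compared with the degree sum is below \<open>n * n\<close>,
  positions are at most \<open>2 * m\<close>, and literals are below 16.\<close>

locale machine_input = connected_simple_graph G for G :: "nat ugraph" +
  fixes L :: "nat list list" and w :: nat
  assumes adjacency_lists: "adjacency_lists G L"
    and word_size: "(card (vertices G) + card (edges G) + 1) ^ 4 \<le> 2 ^ w"
begin

abbreviation n :: nat where "n \<equiv> length L"

abbreviation m :: nat where "m \<equiv> card (edges G)"

definition offset :: "nat \<Rightarrow> nat" where "offset i = length (concat (take i L))"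

lemma vertices_eq: "vertices G = {..<n}"
  using adjacency_lists unfolding adjacency_lists_def by simp

lemma card_vertices [simp]: "card (vertices G) = n"
  by (simp add: vertices_eq)

lemma n_pos: "0 < n"
  using connected vertices_eq unfolding connected_graph_def by auto

lemma set_adjacency: "v < n \<Longrightarrow> set (L ! v) = {u. {u, v} \<in> edges G}"
  and distinct_adjacency: "v < n \<Longrightarrow> distinct (L ! v)"
  using adjacency_lists unfolding adjacency_lists_def neighbours_def by auto

lemma adjacency_iff: "v < n \<Longrightarrow> u \<in> set (L ! v) \<longleftrightarrow> u < n \<and> vdist v u = 1"
  using simple_graph_edge[OF simple, of u v] vdist_edge[of v u]
  by (auto simp: set_adjacency vertices_eq insert_commute)

lemma offset_0 [simp]: "offset 0 = 0"
  unfolding offset_def by simp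

lemma offset_Suc: "i < n \<Longrightarrow> offset (Suc i) = offset i + length (L ! i)"
  unfolding offset_def by (simp add: take_Suc_conv_app_nth)

lemma offset_sum: "i \<le> n \<Longrightarrow> offset i = (\<Sum>j<i. length (L ! j))"
  by (induction i) (simp_all add: offset_Suc)

lemma offset_mono: "i \<le> n \<Longrightarrow> offset i \<le> offset n"
  by (simp add: offset_sum sum_mono2)

lemma concat_nth:
  assumes "i < n" "j < length (L ! i)" shows "concat L ! (offset i + j) = L ! i ! j"
proof -
  have "concat L = concat (take i L) @ L ! i @ concat (drop (Suc i) L)"
    using arg_cong[OF id_take_nth_drop[OF assms(1)], of concat] by simp
  then show ?thesis using assms(2) unfolding offset_def by (simp add: nth_append)
qed

lemma offset_less: "i < n \<Longrightarrow> j < length (L ! i) \<Longrightarrow> offset i + j < length (concat L)"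
  using offset_mono[of "Suc i"] offset_Suc[of i] unfolding offset_def by simp

text \<open>An entry \<open>u\<close> in the list of \<open>v\<close> is determined by its edge and
  one bit telling which endpoint is smaller.\<close>

lemma degree_sum: "offset n \<le> 2 * m"
proof -
  let ?A = "SIGMA v:{..<n}. set (L ! v)"
  have fin: "finite (edges G)"
    using simple finite_vertices finite_subset[of "edges G" "Pow (vertices G)"]
    by (auto elim: simple_graph_edgeE)
  have "offset n = card ?A"
    by (simp add: offset_sum distinct_adjacency distinct_card)
  also have "\<dots> \<le> card (edges G \<times> (UNIV :: bool set))"
  proof (rule card_inj_on_le[of "\<lambda>(v, u). ({u, v}, v < u)"])
    show "inj_on (\<lambda>(v, u). ({u, v}, v < u)) ?A"
      by (auto simp: inj_on_def doubleton_eq_iff)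
    show "(\<lambda>(v, u). ({u, v}, v < u)) ` ?A \<subseteq> edges G \<times> UNIV"
      by (auto simp: set_adjacency)
    show "finite (edges G \<times> (UNIV :: bool set))" using fin by simp
  qed
  finally show ?thesis by (simp add: card_cartesian_product)
qed

lemma word_bounds: "8 * n < 2 ^ w" "2 * m + 1 < 2 ^ w" "n * n < 2 ^ w" "16 \<le> (2 :: nat) ^ w"
proof -
  define N where "N = n + m + 1"
  have N: "2 \<le> N" "n \<le> N" using n_pos unfolding N_def by linarith+
  have 4: "4 \<le> N * N" using mult_le_mono[OF N(1) N(1)] by simp
  have 8: "8 \<le> N * (N * N)" using mult_le_mono[OF N(1) 4] by simp
  have big: "N * N * (N * N) \<le> 2 ^ w"
    using word_size unfolding card_vertices N_def[symmetric] by (simp add: power4_eq_xxxx ac_simps)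
  have "N * 8 \<le> N * N * (N * N)" using mult_le_mono[OF order_refl[of N] 8] by (simp add: ac_simps)
  then have eight: "N * 8 \<le> 2 ^ w" using big by (rule order_trans)
  show "8 * n < 2 ^ w" by (rule less_le_trans[OF _ eight]) (simp add: N_def)
  show "2 * m + 1 < 2 ^ w" by (rule less_le_trans[OF _ eight]) (simp add: N_def)
  have "N * N * 4 \<le> N * N * (N * N)" using 4 by (intro mult_le_mono order_refl)
  then have "N * N * 4 \<le> 2 ^ w" using big by (rule order_trans)
  moreover have "n * n < N * N * 4" using mult_le_mono[OF N(2) N(2)] 4 by linarith
  ultimately show "n * n < 2 ^ w" by simp
  show "16 \<le> (2 :: nat) ^ w" using order_trans[OF mult_le_mono[OF 4 4] big] by simp
qed

lemma word_pos: "0 < w"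
  using word_bounds(4) by (intro gr0I) simp

lemma literal: "k < 16 \<Longrightarrow> k mod 2 ^ w = (k :: nat)"
  using word_bounds(4) by (intro mod_less) (rule less_le_trans)

definition intact :: "state \<Rightarrow> bool" where
  "intact s \<longleftrightarrow> regs s 0 = n \<and> arrays s 0 = arrays (input_state L) 0 \<and> arrays s 1 = arrays (input_state L) 1"

lemma intactD:
  assumes "intact s"
  shows "regs s 0 = n" "i \<le> n \<Longrightarrow> arrays s 0 i = offset i"
    "i < n \<Longrightarrow> j < length (L ! i) \<Longrightarrow> arrays s 1 (offset i + j) = L ! i ! j"
  using assms offset_less[of i j] concat_nth[of i j] unfolding intact_def input_state_def offset_def by simp_all

lemma intact_input: "intact (input_state L)"
  unfolding intact_def input_state_def by simp

lemma intact_set [simp]: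
  "r \<noteq> 0 \<Longrightarrow> intact (set_reg r x s) \<longleftrightarrow> intact s"
  "a \<noteq> 0 \<Longrightarrow> a \<noteq> 1 \<Longrightarrow> intact (set_array a i x s) \<longleftrightarrow> intact s"
  unfolding intact_def by simp_all

text \<open>\<open>K i\<close> holds after \<open>i\<close> vertices, \<open>J i j\<close> after
  \<open>j\<close> neighbours of vertex \<open>i\<close>. Neither may depend on registers 1 to 3,
  which the loops themselves change. Inner iterations number at most \<open>2 * m\<close> in total,
  and constant overhead is absorbed since \<open>n\<close> is positive.\<close>

lemma scan_rule:
  assumes lf: "loop_free pre" "loop_free body" "loop_free post"
    and start: "intact s" "K 0 s"
    and pre: "\<And>i s. \<lbrakk>i < n; intact s; regs s 1 = i; K i s\<rbrakk> \<Longrightarrow>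
      intact (effect w pre s) \<and> regs (effect w pre s) 1 = i \<and> J i 0 (effect w pre s)"
    and body: "\<And>i j s. \<lbrakk>i < n; j < length (L ! i); intact s; regs s 1 = i; regs s 3 = L ! i ! j; J i j s\<rbrakk> \<Longrightarrow>
      intact (effect w body s) \<and> regs (effect w body s) 1 = i \<and> regs (effect w body s) 2 = regs s 2 \<and>
      J i (Suc j) (effect w body s)"
    and post: "\<And>i s. \<lbrakk>i < n; intact s; regs s 1 = i; J i (length (L ! i)) s\<rbrakk> \<Longrightarrow>
      intact (effect w post s) \<and> regs (effect w post s) 1 = i \<and> K (Suc i) (effect w post s)"
    and J: "\<And>i j r x s. r \<in> {1, 2, 3} \<Longrightarrow> J i j (set_reg r x s) = J i j s"
    and K: "\<And>i r x s. r \<in> {1, 2, 3} \<Longrightarrow> K i (set_reg r x s) = K i s"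
    and T: "cost_bound pre + cost_bound post + 2 * cost_bound body + 60 \<le> c"
  shows "runs w (scan pre body post) s (c * (n + m)) (\<lambda>s'. intact s' \<and> K n s')"
proof -
  let ?p = "cost_bound pre" and ?q = "cost_bound post" and ?b = "cost_bound body"
  note 1 = literal[of 1, simplified] word_pos
  define I where "I i s \<longleftrightarrow> intact s \<and> regs s 1 = i \<and> K i s" for i s
  define I' where "I' i j s \<longleftrightarrow> intact s \<and> regs s 1 = i \<and> regs s 2 = offset i + j \<and> J i j s" for i j s
  have next_offset: "aval w (Load 0 (Add (Reg 1) (Lit 1))) s = offset (Suc i)"
    if "intact s" "regs s 1 = i" "i < n" for s i
    using that intactD(2)[OF that(1), of "Suc i"] word_bounds(1) 1 by simp
  have inner: "runs w (While (Less (Reg 2) (Load 0 (Add (Reg 1) (Lit 1))))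
      (Seq (Assign 3 (Load 1 (Reg 2))) (Seq body (Assign 2 (Add (Reg 2) (Lit 1)))))) s
      ((\<Sum>j<length (L ! i). 7 + (9 + ?b)) + 7) (I' i (length (L ! i)))"
    if i: "i < n" and s: "I' i 0 s" for i s
  proof -
    let ?cond = "Less (Reg 2) (Load 0 (Add (Reg 1) (Lit 1)))"
    have step: "bval w ?cond s \<and> runs w (Seq (Assign 3 (Load 1 (Reg 2))) (Seq body (Assign 2 (Add (Reg 2) (Lit 1))))) s
        (9 + ?b) (I' i (Suc j))"
      if j: "j < length (L ! i)" and s: "I' i j s" for j s
    proof -
      have s': "intact s" "regs s 1 = i" "regs s 2 = offset i + j" "J i j s" using s unfolding I'_def by auto
      have cond: "bval w ?cond s"
        using next_offset[OF s'(1,2) i] s'(3) offset_Suc[OF i] j by simp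
      let ?s = "effect w body (set_reg 3 (L ! i ! j) s)"
      have b: "intact ?s \<and> regs ?s 1 = i \<and> regs ?s 2 = offset i + j \<and> J i (Suc j) ?s"
        using body[of i j "set_reg 3 (L ! i ! j) s"] i j s' J by simp
      have "offset i + j < 2 * m"
        using offset_less[OF i j] degree_sum unfolding offset_def by simp
      then have small: "Suc (offset i + j) mod 2 ^ w = Suc (offset i + j)" using word_bounds(2) by simp
      have "effect w (Seq (Assign 3 (Load 1 (Reg 2))) (Seq body (Assign 2 (Add (Reg 2) (Lit 1))))) s =
          set_reg 2 (Suc (offset i + j)) ?s"
        using intactD(3)[OF s'(1) i j] s'(3) b 1 small by simp
      moreover have "I' i (Suc j) (set_reg 2 (Suc (offset i + j)) ?s)"
        unfolding I'_def using b J by simp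
      ultimately have "runs w (Seq (Assign 3 (Load 1 (Reg 2))) (Seq body (Assign 2 (Add (Reg 2) (Lit 1))))) s
          (9 + ?b) (I' i (Suc j))"
        by (intro runs_loop_free) (use lf in simp_all)
      then show ?thesis using cond by simp
    qed
    have stop: "\<not> bval w ?cond s" if s: "I' i (length (L ! i)) s" for s
      using next_offset[of s i] i s offset_Suc[OF i] unfolding I'_def by simp
    show ?thesis
      by (rule runs_mono[OF runs_While[of "length (L ! i)" "I' i" w ?cond _ "\<lambda>_. 9 + ?b", OF step stop s]])
        simp_all
  qed
  have outer_step: "bval w (Less (Reg 1) (Reg 0)) s \<and>
      runs w (Seq (Seq pre (Assign 2 (Load 0 (Reg 1))))
          (Seq (While (Less (Reg 2) (Load 0 (Add (Reg 1) (Lit 1))))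
                 (Seq (Assign 3 (Load 1 (Reg 2))) (Seq body (Assign 2 (Add (Reg 2) (Lit 1))))))
            (Seq post (Assign 1 (Add (Reg 1) (Lit 1)))))) s
        (?p + ?q + 20 + (16 + ?b) * length (L ! i)) (I (Suc i))"
    if i: "i < n" and s: "I i s" for i s
  proof -
    have s': "intact s" "regs s 1 = i" "K i s" using s unfolding I_def by auto
    have A: "runs w (Seq pre (Assign 2 (Load 0 (Reg 1)))) s (?p + 4) (I' i 0)"
    proof (rule runs_loop_free)
      have p: "intact (effect w pre s)" "regs (effect w pre s) 1 = i" "J i 0 (effect w pre s)"
        using pre[OF i s'] by auto
      then show "I' i 0 (effect w (Seq pre (Assign 2 (Load 0 (Reg 1)))) s)"
        unfolding I'_def using J intactD(2)[OF p(1), of i] i by simp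
    qed (use lf in simp_all)
    have B: "runs w (Seq post (Assign 1 (Add (Reg 1) (Lit 1)))) s' (?q + 5) (I (Suc i))"
      if "I' i (length (L ! i)) s'" for s'
    proof (rule runs_loop_free)
      have q: "intact (effect w post s')" "regs (effect w post s') 1 = i" "K (Suc i) (effect w post s')"
        using post[of i s'] that i unfolding I'_def by auto
      have "Suc i mod 2 ^ w = Suc i" using i word_bounds(1) by simp
      then show "I (Suc i) (effect w (Seq post (Assign 1 (Add (Reg 1) (Lit 1)))) s')"
        unfolding I_def using q K 1 by simp
    qed (use lf in simp_all)
    show ?thesis
    proof
      show "bval w (Less (Reg 1) (Reg 0)) s" using i s' intactD(1)[OF s'(1)] by simp
    qed (rule runs_Seq[OF A runs_Seq[OF inner[OF i] B order_refl]], simp_all)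
  qed
  have loop: "runs w (While (Less (Reg 1) (Reg 0))
      (Seq (Seq pre (Assign 2 (Load 0 (Reg 1))))
          (Seq (While (Less (Reg 2) (Load 0 (Add (Reg 1) (Lit 1))))
                 (Seq (Assign 3 (Load 1 (Reg 2))) (Seq body (Assign 2 (Add (Reg 2) (Lit 1))))))
            (Seq post (Assign 1 (Add (Reg 1) (Lit 1))))))) (set_reg 1 0 s)
      ((\<Sum>i<n. 1 + 3 + (?p + ?q + 20 + (16 + ?b) * length (L ! i))) + (1 + 3)) (I n)"
  proof (rule runs_mono[OF runs_While[of n I w "Less (Reg 1) (Reg 0)" _ "\<lambda>i. ?p + ?q + 20 + (16 + ?b) * length (L ! i)", OF outer_step]])
    show "I 0 (set_reg 1 0 s)" unfolding I_def using start K by simp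
    show "\<And>s. I n s \<Longrightarrow> \<not> bval w (Less (Reg 1) (Reg 0)) s" unfolding I_def using intactD(1) by simp
  qed simp_all
  have init: "runs w (Assign 1 (Lit 0)) s 2 (\<lambda>s'. s' = set_reg 1 0 s)"
    by (rule runs_loop_free) simp_all
  have "runs w (scan pre body post) s
      (1 + 2 + ((\<Sum>i<n. 1 + 3 + (?p + ?q + 20 + (16 + ?b) * length (L ! i))) + (1 + 3))) (I n)"
    unfolding scan_def by (rule runs_Seq[OF init _ order_refl]) (use loop in simp)
  then show ?thesis
  proof (rule runs_mono)
    have "(\<Sum>i<n. 1 + 3 + (?p + ?q + 20 + (16 + ?b) * length (L ! i))) = n * (?p + ?q + 24) + (16 + ?b) * offset n"
      by (simp add: sum.distrib offset_sum sum_distrib_left algebra_simps)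
    also have "\<dots> \<le> n * (?p + ?q + 24) + (16 + ?b) * (2 * m)" using degree_sum by simp
    finally have "1 + 2 + ((\<Sum>i<n. 1 + 3 + (?p + ?q + 20 + (16 + ?b) * length (L ! i))) + (1 + 3))
      \<le> 7 * n + n * (?p + ?q + 24) + (16 + ?b) * (2 * m)" using n_pos by linarith
    also have "\<dots> = (?p + ?q + 31) * n + (32 + 2 * ?b) * m" by (simp add: algebra_simps)
    also have "\<dots> \<le> c * n + c * m" using T by (intro add_mono mult_le_mono1) linarith+
    finally show "1 + 2 + ((\<Sum>i<n. 1 + 3 + (?p + ?q + 20 + (16 + ?b) * length (L ! i))) + (1 + 3)) \<le> c * (n + m)"
      by (simp add: algebra_simps)
  qed (simp add: I_def)
qed

end

section \<open>The algorithm\<close>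

text \<open>Array \<open>a\<close> stores the distance plus one; \<open>0\<close> marks the vertices not yet reached.\<close>

definition bfs_round :: "nat \<Rightarrow> nat \<Rightarrow> com" where
  "bfs_round a k = scan Skip
    (Cond (Conj (Equal (Load a (Reg 1)) (Lit 0)) (Equal (Load a (Reg 3)) (Lit (Suc k))))
      (Store a (Reg 1) (Lit (Suc (Suc k)))) Skip) Skip"

fun bfs_rounds :: "nat \<Rightarrow> nat \<Rightarrow> com" where
  "bfs_rounds a 0 = Skip"
| "bfs_rounds a (Suc k) = Seq (bfs_rounds a k) (bfs_round a k)"

text \<open>The key \<open>(dist + 1) n - inner_degree\<close> orders the vertices lexicographically, since
  inner degrees are less than \<open>n\<close>.\<close>

definition select_far :: "nat \<Rightarrow> com" where
  "select_far a = Seq (Assign 5 (Lit 0))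
    (scan (Assign 4 (Mul (Load a (Reg 1)) (Reg 0)))
      (Cond (Less (Load a (Reg 3)) (Load a (Reg 1))) (Assign 4 (Sub (Reg 4) (Lit 1))) Skip)
      (Cond (Less (Reg 5) (Reg 4)) (Seq (Assign 5 (Reg 4)) (Assign 6 (Reg 1))) Skip))"

definition sweep :: "nat \<Rightarrow> nat \<Rightarrow> com" where
  "sweep a D = Seq (Store a (Reg 8) (Lit 1)) (Seq (bfs_rounds a D) (Seq (select_far a)
    (Seq (Assign 8 (Reg 6)) (Cond (Equal (Load a (Reg 8)) (Lit (Suc D))) (Assign 7 (Lit 1)) Skip))))"

context machine_input begin

definition reached :: "nat \<Rightarrow> nat \<Rightarrow> nat \<Rightarrow> nat" where
  "reached x k v = (if vdist x v \<le> k then Suc (vdist x v) else 0)"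

definition framed :: "nat \<Rightarrow> state \<Rightarrow> state \<Rightarrow> bool" where
  "framed a s t \<longleftrightarrow> regs t 7 = regs s 7 \<and> regs t 8 = regs s 8 \<and> (\<forall>b. b \<noteq> a \<longrightarrow> arrays t b = arrays s b)"

lemma framed_refl [simp]: "framed a s s"
  unfolding framed_def by simp

lemma framed_trans: "framed a s t \<Longrightarrow> framed a t r \<Longrightarrow> framed a s r"
  unfolding framed_def by simp

lemma framed_set [simp]:
  "r < 7 \<Longrightarrow> framed a s (set_reg r x t) \<longleftrightarrow> framed a s t"
  "framed a s (set_array a i x t) \<longleftrightarrow> framed a s t"
  unfolding framed_def by auto

text \<open>Although the array is updated in place, a pass advances by exactly one level: new
  entries are \<open>k + 2\<close>, hence differ from the tested value \<open>k + 1\<close>.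
  \<open>?hit v j\<close> says that one of the first \<open>j\<close> neighbours of \<open>v\<close>
  is at distance \<open>k\<close>.\<close>

lemma bfs_round_correct:
  assumes a: "2 \<le> a" and k: "k < 14" and x: "x < n" and s: "intact s" "\<forall>v<n. arrays s a v = reached x k v"
  shows "runs w (bfs_round a k) s (100 * (n + m))
    (\<lambda>t. intact t \<and> framed a s t \<and> (\<forall>v<n. arrays t a v = reached x (Suc k) v))"
proof -
  let ?hit = "\<lambda>v j. \<exists>j'<j. vdist x (L ! v ! j') = k"
  define K where "K i t \<longleftrightarrow> framed a s t \<and> (\<forall>v<n. arrays t a v =
    (if vdist x v \<le> k then Suc (vdist x v) else if v < i \<and> ?hit v (length (L ! v)) then k + 2 else 0))" for i t
  define J where "J i j t \<longleftrightarrow> framed a s t \<and> (\<forall>v<n. arrays t a v =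
    (if vdist x v \<le> k then Suc (vdist x v)
     else if v < i \<and> ?hit v (length (L ! v)) \<or> v = i \<and> ?hit v j then k + 2 else 0))" for i j t
  have lit: "Suc k mod 2 ^ w = Suc k" "Suc (Suc k) mod 2 ^ w = Suc (Suc k)"
    using k by (simp_all add: literal)
  have "runs w (bfs_round a k) s (100 * (n + m)) (\<lambda>t. intact t \<and> K n t)"
    unfolding bfs_round_def
  proof (rule scan_rule[where J = J])
    show "K 0 s" unfolding K_def using s(2) by (simp add: reached_def)
  next
    fix i t assume "i < n" "intact t" "regs t 1 = i" "K i t"
    then show "intact (effect w Skip t) \<and> regs (effect w Skip t) 1 = i \<and> J i 0 (effect w Skip t)"
      unfolding J_def K_def by simp
  next
    fix i j t assume i: "i < n" and j: "j < length (L ! i)" and t: "intact t" "regs t 1 = i" "regs t 3 = L ! i ! j"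
      and J: "J i j t"
    let ?y = "L ! i ! j"
    let ?c = "Cond (Conj (Equal (Load a (Reg 1)) (Lit 0)) (Equal (Load a (Reg 3)) (Lit (Suc k))))
      (Store a (Reg 1) (Lit (Suc (Suc k)))) Skip"
    have y: "?y < n" using adjacency_iff[OF i, of ?y] nth_mem[OF j] by simp
    have fr: "framed a s t" and val: "\<And>v. v < n \<Longrightarrow> arrays t a v = (if vdist x v \<le> k then Suc (vdist x v)
     else if v < i \<and> ?hit v (length (L ! v)) \<or> v = i \<and> ?hit v j then k + 2 else 0)"
      using J unfolding J_def by auto
    have hit_Suc: "?hit v (Suc j) \<longleftrightarrow> ?hit v j \<or> vdist x (L ! v ! j) = k" for v
      by (auto simp: less_Suc_eq)
    have cond1: "arrays t a i = 0 \<longleftrightarrow> k < vdist x i \<and> \<not> ?hit i j" using val[OF i] by auto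
    have cond2: "arrays t a ?y = Suc k \<longleftrightarrow> vdist x ?y = k" using val[OF y] by auto
    have eff: "effect w ?c t = (if arrays t a i = 0 \<and> arrays t a ?y = Suc k then set_array a i (k + 2) t else t)"
      using t lit by simp
    have J': "J i (Suc j) (effect w ?c t)"
    proof (cases "arrays t a i = 0 \<and> arrays t a ?y = Suc k")
      case True
      then have "k < vdist x i" "vdist x ?y = k" using cond1 cond2 by auto
      then show ?thesis unfolding J_def eff using True fr val by (auto simp: hit_Suc)
    next
      case False
      then have "vdist x i \<le> k \<or> ?hit i j \<or> vdist x ?y \<noteq> k" using cond1 cond2 by auto
      then show ?thesis unfolding J_def eff using False fr val by (auto simp: hit_Suc)
    qed
    show "intact (effect w ?c t) \<and> regs (effect w ?c t) 1 = i \<and> regs (effect w ?c t) 2 = regs t 2 \<and>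
       J i (Suc j) (effect w ?c t)"
      using J' t a unfolding eff by simp
  next
    fix i t assume i: "i < n" and "intact t" "regs t 1 = i" and J: "J i (length (L ! i)) t"
    moreover have "K (Suc i) t"
      using J unfolding J_def K_def by (auto simp: less_Suc_eq)
    ultimately show "intact (effect w Skip t) \<and> regs (effect w Skip t) 1 = i \<and> K (Suc i) (effect w Skip t)" by simp
  next
    show "J i j (set_reg r y t) = J i j t" if "r \<in> {1, 2, 3}" for i j r y t
      using that unfolding J_def by auto
    show "K i (set_reg r y t) = K i t" if "r \<in> {1, 2, 3}" for i r y t
      using that unfolding K_def by auto
  qed (use s in simp_all)
  then show ?thesis
  proof (rule runs_mono)
    fix t assume t: "intact t \<and> K n t"
    have "?hit v (length (L ! v)) \<longleftrightarrow> vdist x v = Suc k" if v: "v < n" "k < vdist x v" for v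
    proof
      assume "?hit v (length (L ! v))"
      then obtain u where u: "u \<in> set (L ! v)" "vdist x u = k" using nth_mem by blast
      then have "vdist v u = 1" using adjacency_iff[OF v(1)] by simp
      then show "vdist x v = Suc k" using levels(2)[of x u v] sym[of u v] u(2) v(2) by linarith
    next
      assume "vdist x v = Suc k"
      then obtain u where u: "u \<in> vertices G" "vdist x u = k" "vdist u v = 1" using predecessor by blast
      then have "u \<in> set (L ! v)" using adjacency_iff[OF v(1)] by (simp add: vertices_eq sym[of v u])
      then show "?hit v (length (L ! v))" using u(2) by (metis in_set_conv_nth)
    qed
    then show "intact t \<and> framed a s t \<and> (\<forall>v<n. arrays t a v = reached x (Suc k) v)"
      using t unfolding K_def reached_def by (auto simp: le_Suc_eq)
  qed simp
qed

lemma bfs_rounds_correct: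
  assumes a: "2 \<le> a" and x: "x < n" and s: "intact s" "\<forall>v<n. arrays s a v = reached x 0 v"
  shows "k \<le> 14 \<Longrightarrow> runs w (bfs_rounds a k) s ((102 * k + 1) * (n + m))
    (\<lambda>t. intact t \<and> framed a s t \<and> (\<forall>v<n. arrays t a v = reached x k v))"
proof (induction k)
  case 0
  show ?case using s n_pos by (intro runs_loop_free) (auto simp: Suc_le_eq)
next
  case (Suc k)
  show ?case
    unfolding bfs_rounds.simps
  proof (rule runs_Seq[OF Suc.IH])
    fix t assume t: "intact t \<and> framed a s t \<and> (\<forall>v<n. arrays t a v = reached x k v)"
    show "runs w (bfs_round a k) t (100 * (n + m))
      (\<lambda>t. intact t \<and> framed a s t \<and> (\<forall>v<n. arrays t a v = reached x (Suc k) v))"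
      by (rule runs_mono[OF bfs_round_correct[OF a _ x]]) (use t Suc.prems in \<open>auto intro: framed_trans\<close>)
  next
    have "1 \<le> n + m" using n_pos by linarith
    then show "1 + (102 * k + 1) * (n + m) + 100 * (n + m) \<le> (102 * Suc k + 1) * (n + m)"
      by (simp add: algebra_simps)
  qed (use Suc.prems in simp)
qed

definition key :: "nat \<Rightarrow> nat \<Rightarrow> nat" where
  "key x v = Suc (vdist x v) * n - inner_degree x v"

lemma inner_degree_less:
  assumes "v < n" shows "inner_degree x v < n"
proof -
  have "{z \<in> vertices G. vdist v z = 1 \<and> vdist x z < vdist x v} \<subset> vertices G"
    using assms refl[of v] vertices_eq by auto
  then have "inner_degree x v < card (vertices G)"
    unfolding inner_degree_def by (rule psubset_card_mono[OF finite_vertices])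
  then show ?thesis by simp
qed

lemma inner_degree_list:
  assumes "v < n"
  shows "inner_degree x v = card {j. j < length (L ! v) \<and> vdist x (L ! v ! j) < vdist x v}"
proof -
  have "{z \<in> vertices G. vdist v z = 1 \<and> vdist x z < vdist x v} =
      (\<lambda>j. L ! v ! j) ` {j. j < length (L ! v) \<and> vdist x (L ! v ! j) < vdist x v}"
    using adjacency_iff[OF assms] unfolding vertices_eq by (auto simp: in_set_conv_nth image_iff) metis
  moreover have "inj_on (\<lambda>j. L ! v ! j) {j. j < length (L ! v) \<and> vdist x (L ! v ! j) < vdist x v}"
    using distinct_adjacency[OF assms] by (auto simp: inj_on_def nth_eq_iff_index_eq)
  ultimately show ?thesis unfolding inner_degree_def by (simp add: card_image)
qed

text \<open>One more unit of distance adds \<open>n\<close> to the key, which is more than any inner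
  degree takes away.\<close>

lemma far_if_key_max:
  assumes y: "y < n" and max: "\<forall>v<n. key x v \<le> key x y"
  shows "far x y"
  unfolding far_def
proof (intro conjI ballI)
  show "y \<in> vertices G" using y vertices_eq by auto
  fix z assume "z \<in> vertices G"
  then have z: "z < n" using vertices_eq by auto
  have k: "key x z \<le> key x y" using max z by blast
  have iz: "inner_degree x z < n" by (rule inner_degree_less[OF z])
  show "vdist x z < vdist x y \<or> vdist x z = vdist x y \<and> inner_degree x y \<le> inner_degree x z"
  proof (cases "vdist x y < vdist x z")
    case True
    then have "Suc (vdist x y) * n + n \<le> Suc (vdist x z) * n"
      using mult_le_mono1[of "Suc (Suc (vdist x y))" "Suc (vdist x z)" n] by simp
    then have "key x y < key x z" unfolding key_def using iz by linarith
    then show ?thesis using k by simp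
  next
    case False
    show ?thesis
    proof (cases "vdist x z = vdist x y")
      case True
      have "inner_degree x y < Suc (vdist x y) * n" "inner_degree x z < Suc (vdist x y) * n"
        using inner_degree_less[OF y, of x] iz by (simp_all add: trans_less_add1)
      then show ?thesis using k True unfolding key_def by simp
    qed (use False in simp)
  qed
qed

lemma select_far_correct:
  assumes a: "2 \<le> a" and x: "x < n" and s: "intact s" "\<forall>v<n. arrays s a v = Suc (vdist x v)"
    and bound: "\<forall>v. vdist x v < 8"
  shows "runs w (select_far a) s (102 * (n + m))
    (\<lambda>t. intact t \<and> framed a s t \<and> arrays t a = arrays s a \<and> regs t 6 < n \<and> far x (regs t 6))"
proof -
  \<comment> \<open>The best key starts at \<open>0\<close>, so a positive key ensures that the
    first vertex is taken and register 6 is meaningful afterwards.\<close>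
  have key_pos: "0 < key x v" if "v < n" for v
    using inner_degree_less[OF that, of x] unfolding key_def by (simp add: trans_less_add1)
  define best where "best i t \<longleftrightarrow> (i = 0 \<and> regs t 5 = 0 \<or> 0 < i \<and> regs t 6 < i \<and>
    regs t 5 = key x (regs t 6) \<and> (\<forall>v<i. key x v \<le> key x (regs t 6)))" for i t
  define K where "K i t \<longleftrightarrow> framed a s t \<and> arrays t a = arrays s a \<and> best i t" for i t
  define J where "J i j t \<longleftrightarrow> K i t \<and> regs t 4 = Suc (vdist x i) * n -
    card {j'. j' < j \<and> vdist x (L ! i ! j') < vdist x i}" for i j t
  have K_set: "K i (set_reg r y t) = K i t" if "r \<in> {1, 2, 3, 4}" for i r y t
    using that unfolding K_def best_def by auto
  let ?pre = "Assign 4 (Mul (Load a (Reg 1)) (Reg 0))"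
  let ?body = "Cond (Less (Load a (Reg 3)) (Load a (Reg 1))) (Assign 4 (Sub (Reg 4) (Lit 1))) Skip"
  let ?post = "Cond (Less (Reg 5) (Reg 4)) (Seq (Assign 5 (Reg 4)) (Assign 6 (Reg 1))) Skip"
  have scan: "runs w (scan ?pre ?body ?post) t (99 * (n + m)) (\<lambda>t. intact t \<and> K n t)"
    if t: "intact t" "K 0 t" for t
  proof (rule scan_rule[where J = J and K = K])
    fix i t assume i: "i < n" and t: "intact t" "regs t 1 = i" and K: "K i t"
    \<comment> \<open>Distances below 8 keep the product from wrapping around.\<close>
    have "Suc (vdist x i) * n \<le> 8 * n" using bound by (intro mult_le_mono1) (simp add: Suc_le_eq)
    then have "Suc (vdist x i) * n mod 2 ^ w = Suc (vdist x i) * n"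
      by (intro mod_less) (rule le_less_trans[OF _ word_bounds(1)])
    moreover have "arrays t a i = Suc (vdist x i)" using K s(2) i unfolding K_def by simp
    ultimately have eff: "effect w ?pre t = set_reg 4 (Suc (vdist x i) * n) t"
      using t intactD(1)[OF t(1)] by simp
    show "intact (effect w ?pre t) \<and> regs (effect w ?pre t) 1 = i \<and> J i 0 (effect w ?pre t)"
      unfolding eff J_def using K K_set t by simp
  next
    fix i j t assume i: "i < n" and j: "j < length (L ! i)" and t: "intact t" "regs t 1 = i" "regs t 3 = L ! i ! j"
      and J: "J i j t"
    let ?y = "L ! i ! j"
    have y: "?y < n" using adjacency_iff[OF i, of ?y] nth_mem[OF j] by simp
    have K: "K i t" and r4: "regs t 4 = Suc (vdist x i) * n - card {j'. j' < j \<and> vdist x (L ! i ! j') < vdist x i}"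
      using J unfolding J_def by auto
    have arr: "arrays t a v = Suc (vdist x v)" if "v < n" for v using K s(2) that unfolding K_def by simp
    have eff: "effect w ?body t = (if vdist x ?y < vdist x i then set_reg 4 (regs t 4 - 1) t else t)"
      using t arr[OF i] arr[OF y] word_pos by simp
    have set_eq: "{j'. j' < Suc j \<and> vdist x (L ! i ! j') < vdist x i} =
      (if vdist x ?y < vdist x i then insert j {j'. j' < j \<and> vdist x (L ! i ! j') < vdist x i}
       else {j'. j' < j \<and> vdist x (L ! i ! j') < vdist x i})"
      by (auto simp: less_Suc_eq)
    have "J i (Suc j) (effect w ?body t)"
      unfolding eff J_def set_eq using K K_set r4 by simp
    then show "intact (effect w ?body t) \<and> regs (effect w ?body t) 1 = i \<and>
        regs (effect w ?body t) 2 = regs t 2 \<and> J i (Suc j) (effect w ?body t)"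
      using t unfolding eff by simp
  next
    fix i t assume i: "i < n" and t: "intact t" "regs t 1 = i" and J: "J i (length (L ! i)) t"
    have K: "K i t" and r4: "regs t 4 = key x i"
      using J inner_degree_list[OF i] unfolding J_def key_def by auto
    have eff: "effect w ?post t = (if regs t 5 < key x i then set_reg 6 i (set_reg 5 (key x i) t) else t)"
      using t r4 by simp
    have "best (Suc i) (effect w ?post t)"
      using K key_pos[OF i] unfolding K_def best_def eff by (auto simp: less_Suc_eq)
    then show "intact (effect w ?post t) \<and> regs (effect w ?post t) 1 = i \<and> K (Suc i) (effect w ?post t)"
      using K t unfolding K_def eff by simp
  next
    show "J i j (set_reg r y t) = J i j t" if "r \<in> {1, 2, 3}" for i j r y t
      using that K_set unfolding J_def by auto
    show "K i (set_reg r y t) = K i t" if "r \<in> {1, 2, 3}" for i r y t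
      using that K_set by auto
  qed (use t in simp_all)
  have init: "runs w (Assign 5 (Lit 0)) s 2 (\<lambda>t. intact t \<and> K 0 t)"
    by (rule runs_loop_free) (use s in \<open>simp_all add: K_def best_def\<close>)
  have "runs w (select_far a) s (1 + 2 + 99 * (n + m)) (\<lambda>t. intact t \<and> K n t)"
    unfolding select_far_def by (rule runs_Seq[OF init scan order_refl]) simp_all
  then show ?thesis
  proof (rule runs_mono)
    have "1 + 2 + 99 * N \<le> 102 * N" if "1 \<le> N" for N :: nat using that by linarith
    moreover have "1 \<le> n + m" using n_pos by linarith
    ultimately show "1 + 2 + 99 * (n + m) \<le> 102 * (n + m)" by blast
    fix t assume t: "intact t \<and> K n t"
    then have "best n t" unfolding K_def by simp
    then have "regs t 6 < n" "\<forall>v<n. key x v \<le> key x (regs t 6)" using n_pos unfolding best_def by auto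
    then show "intact t \<and> framed a s t \<and> arrays t a = arrays s a \<and> regs t 6 < n \<and> far x (regs t 6)"
      using t far_if_key_max unfolding K_def by blast
  qed
qed

text \<open>Array \<open>a\<close> has to be zero on entry because zero marks unreached vertices, so
  each sweep gets its own array. As \<open>y\<close> is farthest from \<open>x\<close>, its stored
  value decides whether the source \<open>x\<close> is peripheral.\<close>

lemma sweep_correct:
  assumes a: "2 \<le> a" and D: "D < 8" and x: "x < n" and s: "intact s" "regs s 8 = x" "arrays s a = (\<lambda>_. 0)"
    and bound: "\<forall>u v. vdist u v \<le> D"
  shows "runs w (sweep a D) s ((102 * D + 150) * (n + m))
    (\<lambda>t. intact t \<and> (\<exists>y<n. far x y \<and> regs t 8 = y \<and> regs t 7 = (if vdist x y = D then 1 else regs s 7)) \<and>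
      (\<forall>b. b \<noteq> a \<longrightarrow> arrays t b = arrays s b))"
proof -
  let ?T = "n + m"
  have T: "1 \<le> ?T" using n_pos by linarith
  define P where "P t \<longleftrightarrow> intact t \<and> framed a s t \<and> (\<forall>v<n. arrays t a v = Suc (vdist x v))" for t
  have start: "runs w (Store a (Reg 8) (Lit 1)) s 3
    (\<lambda>t. intact t \<and> framed a s t \<and> (\<forall>v<n. arrays t a v = reached x 0 v))"
  proof (rule runs_loop_free)
    have "vdist x v = 0 \<longleftrightarrow> v = x" if "v < n" for v
      using vdist_eq_0[of x v] that x vertices_eq by auto
    then show "intact (effect w (Store a (Reg 8) (Lit 1)) s) \<and> framed a s (effect w (Store a (Reg 8) (Lit 1)) s) \<and>
      (\<forall>v<n. arrays (effect w (Store a (Reg 8) (Lit 1)) s) a v = reached x 0 v)"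
      using s a word_pos unfolding reached_def by simp
  qed simp_all
  have bfs: "runs w (bfs_rounds a D) t ((102 * D + 1) * ?T) P"
    if "intact t \<and> framed a s t \<and> (\<forall>v<n. arrays t a v = reached x 0 v)" for t
    by (rule runs_mono[OF bfs_rounds_correct[OF a x, of t D]])
      (use that D bound in \<open>auto simp: P_def reached_def intro: framed_trans\<close>)
  define Q where "Q t \<longleftrightarrow> P t \<and> regs t 6 < n \<and> far x (regs t 6)" for t
  have select: "runs w (select_far a) t (102 * ?T) Q" if t: "P t" for t
    by (rule runs_mono[OF select_far_correct[OF a x, of t]])
      (use t bound D in \<open>auto simp: P_def Q_def intro: framed_trans le_less_trans\<close>)
  let ?end = "Seq (Assign 8 (Reg 6)) (Cond (Equal (Load a (Reg 8)) (Lit (Suc D))) (Assign 7 (Lit 1)) Skip)"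
  have finish: "runs w ?end t 20
    (\<lambda>t. intact t \<and> (\<exists>y<n. far x y \<and> regs t 8 = y \<and> regs t 7 = (if vdist x y = D then 1 else regs s 7)) \<and>
      (\<forall>b. b \<noteq> a \<longrightarrow> arrays t b = arrays s b))" if t: "Q t" for t
  proof (rule runs_loop_free)
    have "Suc D mod 2 ^ w = Suc D" using D by (simp add: literal)
    then have "effect w ?end t = (if vdist x (regs t 6) = D then set_reg 7 1 (set_reg 8 (regs t 6) t)
        else set_reg 8 (regs t 6) t)"
      using t word_pos unfolding Q_def P_def by simp
    then show "intact (effect w ?end t) \<and> (\<exists>y<n. far x y \<and> regs (effect w ?end t) 8 = y \<and>
        regs (effect w ?end t) 7 = (if vdist x y = D then 1 else regs s 7)) \<and>
      (\<forall>b. b \<noteq> a \<longrightarrow> arrays (effect w ?end t) b = arrays s b)"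
      using t unfolding Q_def P_def framed_def by simp
  qed simp_all
  show ?thesis
    unfolding sweep_def
    by (rule runs_Seq[OF start runs_Seq[OF bfs runs_Seq[OF select finish order_refl] order_refl]])
      (use T in \<open>simp_all add: algebra_simps\<close>)
qed

end

text \<open>\<open>Load 0 (Reg 0)\<close> is the end of the last adjacency list, that is, the sum of
  the degrees. The sweeps pass on the source in register 8, initially vertex 0, and the answer in
  register 7.\<close>

definition diameter_program :: "nat \<Rightarrow> com" where
  "diameter_program D = (
     if D = 0 then Assign 0 (Lit 1)
     else if D = 1 then Cond (Less (Lit 1) (Reg 0)) (Assign 0 (Lit 1)) (Assign 0 (Lit 0))
     else if D = 2 then Cond (Less (Load 0 (Reg 0)) (Mul (Reg 0) (Sub (Reg 0) (Lit 1))))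
       (Assign 0 (Lit 1)) (Assign 0 (Lit 0))
     else Seq (sweep 2 D) (Seq (sweep 3 D) (Seq (sweep 4 D) (Assign 0 (Reg 7)))))"

context machine_input begin

lemma size_pos: "1 \<le> n + m"
  using n_pos by linarith

lemma diameter_1_iff:
  assumes "diameter G \<le> enat 1" shows "diameter G = enat 1 \<longleftrightarrow> 1 < n"
proof -
  have "(\<exists>u\<in>vertices G. \<exists>v\<in>vertices G. vdist u v = 1) \<longleftrightarrow> 1 < n"
  proof
    assume "\<exists>u\<in>vertices G. \<exists>v\<in>vertices G. vdist u v = 1"
    then obtain u v where uv: "u \<in> vertices G" "v \<in> vertices G" "vdist u v = 1" by blast
    then have "u \<noteq> v" using refl[of u] by auto
    moreover have "u < n" "v < n" using uv vertices_eq by auto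
    ultimately show "1 < n" by linarith
  next
    assume "1 < n"
    then have V: "0 \<in> vertices G" "1 \<in> vertices G" unfolding vertices_eq lessThan_iff by linarith+
    then have "vdist 0 1 \<noteq> 0" using vdist_eq_0[of 0 1] by simp
    moreover have "vdist 0 1 \<le> 1" using assms unfolding diameter_le_iff by blast
    ultimately have "vdist 0 1 = 1" by linarith
    then show "\<exists>u\<in>vertices G. \<exists>v\<in>vertices G. vdist u v = 1" using V by blast
  qed
  then show ?thesis using diameter_eq_iff[OF assms] by simp
qed

text \<open>Each list has at most \<open>n - 1\<close> entries, so the sum falls short exactly if
  some vertex misses another one, which is then at distance 2.\<close>

lemma diameter_2_iff:
  assumes "diameter G \<le> enat 2" shows "diameter G = enat 2 \<longleftrightarrow> offset n < n * (n - 1)"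
proof -
  have sub: "set (L ! i) \<subseteq> {..<n} - {i}" if "i < n" for i
  proof
    fix u assume "u \<in> set (L ! i)"
    then have u: "u < n" "vdist i u = 1" using adjacency_iff[OF that] by simp_all
    then have "u \<noteq> i" using refl[of i] by auto
    then show "u \<in> {..<n} - {i}" using u(1) by simp
  qed
  have len: "length (L ! i) = card (set (L ! i))" if "i < n" for i
    using distinct_adjacency[OF that] by (simp add: distinct_card)
  have le: "length (L ! i) \<le> n - 1" if "i < n" for i
    using card_mono[OF _ sub[OF that]] len[OF that] that by simp
  have bound: "vdist u v \<le> 2" for u v using assms unfolding diameter_le_iff by blast
  have "(\<exists>u\<in>vertices G. \<exists>v\<in>vertices G. vdist u v = 2) \<longleftrightarrow> offset n < n * (n - 1)"
  proof
    assume "\<exists>u\<in>vertices G. \<exists>v\<in>vertices G. vdist u v = 2"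
    then obtain u v where V: "u \<in> vertices G" "v \<in> vertices G" and d: "vdist u v = 2" by blast
    then have uv: "u < n" "v < n" by (simp_all add: vertices_eq)
    have "v \<noteq> u" using d refl[of u] by auto
    moreover have "v \<notin> set (L ! u)" using d adjacency_iff[OF uv(1), of v] by simp
    ultimately have "set (L ! u) \<subset> {..<n} - {u}" using sub[OF uv(1)] uv(2) by blast
    then have "length (L ! u) < n - 1"
      using psubset_card_mono[of "{..<n} - {u}" "set (L ! u)"] len[OF uv(1)] uv(1) by simp
    then have "(\<Sum>i<n. length (L ! i)) < (\<Sum>i<n. n - 1)"
      using uv(1) le by (intro sum_strict_mono_ex1) auto
    then show "offset n < n * (n - 1)" by (simp add: offset_sum)
  next
    assume lt: "offset n < n * (n - 1)"
    show "\<exists>u\<in>vertices G. \<exists>v\<in>vertices G. vdist u v = 2"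
    proof (rule ccontr)
      assume no: "\<not> ?thesis"
      have "length (L ! i) = n - 1" if i: "i < n" for i
      proof -
        have "vdist i v = 1" if v: "v < n" "v \<noteq> i" for v
        proof -
          have V: "i \<in> vertices G" "v \<in> vertices G" using i v(1) by (simp_all add: vertices_eq)
          then have "vdist i v \<noteq> 0" using vdist_eq_0[OF V] v(2) by simp
          moreover have "vdist i v \<noteq> 2" using no V by blast
          ultimately show ?thesis using bound[of i v] by linarith
        qed
        then have "set (L ! i) = {..<n} - {i}" using sub[OF i] adjacency_iff[OF i] by blast
        then show ?thesis using len[OF i] i by simp
      qed
      then have "offset n = n * (n - 1)" by (simp add: offset_sum)
      then show False using lt by simp
    qed
  qed
  then show ?thesis using diameter_eq_iff[OF assms] by simp
qed

lemma peripheral_iff: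
  assumes "far x y" "\<forall>u v. vdist u v \<le> D"
  shows "peripheral D x \<longleftrightarrow> vdist x y = D"
  using assms farD[OF assms(1)] unfolding peripheral_def far_def by (metis le_antisym)

lemma small_diameter_program_correct:
  assumes le: "diameter G \<le> enat D" and D: "D \<le> 2"
  shows "runs w (diameter_program D) (input_state L) (20 * (n + m))
    (\<lambda>s. regs s 0 = (if diameter G = enat D then 1 else 0))"
proof (rule runs_loop_free)
  consider "D = 0" | "D = 1" | "D = 2" using D by linarith
  then show "regs (effect w (diameter_program D) (input_state L)) 0 = (if diameter G = enat D then 1 else 0)"
  proof cases
    case 1
    then have "diameter G = enat D" using le by (simp add: zero_enat_def[symmetric])
    then show ?thesis using 1 word_pos by (simp add: diameter_program_def)
  next
    case 2
    then show ?thesis using diameter_1_iff le word_pos intactD(1)[OF intact_input]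
      by (simp add: diameter_program_def)
  next
    case 3
    have "n * (n - 1) mod 2 ^ w = n * (n - 1)"
      by (intro mod_less) (rule le_less_trans[OF _ word_bounds(3)], simp)
    then show ?thesis
      using 3 diameter_2_iff le word_pos intactD(1)[OF intact_input] intactD(2)[OF intact_input, of n] by (simp add: diameter_program_def)
  qed
  have D': "D = 0 \<or> D = 1 \<or> D = 2" using D by linarith
  then have "cost_bound (diameter_program D) \<le> 20 * 1" unfolding diameter_program_def by auto
  also have "\<dots> \<le> 20 * (n + m)" by (rule mult_le_mono2[OF size_pos])
  finally show "cost_bound (diameter_program D) \<le> 20 * (n + m)" .
  show "loop_free (diameter_program D)" using D' unfolding diameter_program_def by auto
qed

lemma large_diameter_program_correct:
  assumes le: "diameter G \<le> enat D" and D: "3 \<le> D" "D \<le> 6"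
    and free: "\<not> linear_forest (set (pattern (D + 2))) \<subseteq>\<^sub>i G \<or> D = 5 \<and> \<not> linear_forest {0, 1, 3, 4, 6} \<subseteq>\<^sub>i G"
  shows "runs w (diameter_program D) (input_state L) ((3 * (102 * D + 150) + 10) * (n + m))
    (\<lambda>s. regs s 0 = (if diameter G = enat D then 1 else 0))"
proof -
  let ?T = "(102 * D + 150) * (n + m)" and ?s = "input_state L"
  have bound: "\<forall>u v. vdist u v \<le> D" using le unfolding diameter_le_iff by blast
  have D8: "D < 8" using D by simp
  define A where "A a x s s' \<longleftrightarrow> intact s' \<and> (\<exists>y<n. far x y \<and> regs s' 8 = y \<and>
    regs s' 7 = (if peripheral D x then 1 else regs s 7)) \<and> (\<forall>b. b \<noteq> a \<longrightarrow> arrays s' b = arrays s b)" for a x s s'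
  have sweep: "runs w (sweep a D) s ?T (A a (regs s 8) s)"
    if "2 \<le> a" "regs s 8 < n" "intact s" "arrays s a = (\<lambda>_. 0)" for a s
    by (rule runs_mono[OF sweep_correct[OF that(1) D8 that(2,3) _ that(4) bound]])
      (use peripheral_iff[OF _ bound] in \<open>auto simp: A_def\<close>)
  have empty: "arrays ?s a = (\<lambda>_. 0)" if "2 \<le> a" for a
    using that by (auto simp: input_state_def)
  have start: "regs ?s 8 = 0" "regs ?s 7 = 0" by (simp_all add: input_state_def)
  \<comment> \<open>The assertions between sweeps record which arrays are still empty and keep the
    visited vertices, all but the initial one, existentially quantified.\<close>
  define P1 where "P1 s \<longleftrightarrow> intact s \<and> arrays s 3 = (\<lambda>_. 0) \<and> arrays s 4 = (\<lambda>_. 0) \<and>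
    (\<exists>y<n. far 0 y \<and> regs s 8 = y \<and> regs s 7 = (if peripheral D 0 then 1 else 0))" for s
  define P2 where "P2 s \<longleftrightarrow> intact s \<and> arrays s 4 = (\<lambda>_. 0) \<and>
    (\<exists>y z. z < n \<and> far 0 y \<and> far y z \<and> regs s 8 = z \<and>
      regs s 7 = (if peripheral D 0 \<or> peripheral D y then 1 else 0))" for s
  define P3 where "P3 s \<longleftrightarrow> (\<exists>y z. far 0 y \<and> far y z \<and>
      regs s 7 = (if peripheral D 0 \<or> peripheral D y \<or> peripheral D z then 1 else 0))" for s
  have 1: "runs w (sweep 2 D) ?s ?T P1"
    by (rule runs_mono[OF sweep[of 2 ?s]])
      (use start n_pos intact_input empty in \<open>auto simp: A_def P1_def\<close>)
  have 2: "runs w (sweep 3 D) s ?T P2" if "P1 s" for s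
    by (rule runs_mono[OF sweep[of 3 s]]) (use that in \<open>auto simp: A_def P1_def P2_def\<close>)
  have 3: "runs w (sweep 4 D) s ?T P3" if s: "P2 s" for s
  proof -
    obtain y z where yz: "z < n" "far 0 y" "far y z" "regs s 8 = z"
      "regs s 7 = (if peripheral D 0 \<or> peripheral D y then 1 else 0)" "intact s" "arrays s 4 = (\<lambda>_. 0)"
      using s unfolding P2_def by blast
    have "P3 s'" if "A 4 z s s'" for s'
      unfolding P3_def by (rule exI[of _ y], rule exI[of _ z]) (use that yz in \<open>auto simp: A_def\<close>)
    then show ?thesis using yz(1,4,6,7) by (intro runs_mono[OF sweep[of 4 s]]) auto
  qed
  have 4: "runs w (Assign 0 (Reg 7)) s 2 (\<lambda>s. regs s 0 = (if diameter G = enat D then 1 else 0))" if s: "P3 s" for s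
  proof (rule runs_loop_free)
    obtain y z where yz: "far 0 y" "far y z"
      "regs s 7 = (if peripheral D 0 \<or> peripheral D y \<or> peripheral D z then 1 else 0)"
      using s unfolding P3_def by blast
    have V: "0 \<in> vertices G" "y \<in> vertices G" "z \<in> vertices G"
      using n_pos vertices_eq yz unfolding far_def by auto
    have "diameter G = enat D \<longleftrightarrow> peripheral D 0 \<or> peripheral D y \<or> peripheral D z"
    proof
      assume "diameter G = enat D"
      then obtain u v where "diametral D u v"
        using diameter_eq_iff[OF le] bound unfolding diametral_def by auto
      then show "peripheral D 0 \<or> peripheral D y \<or> peripheral D z"
        using three_sweeps[OF D free _ yz(1,2)] by blast
    next
      assume "peripheral D 0 \<or> peripheral D y \<or> peripheral D z"
      then show "diameter G = enat D"
        using diameter_eq_iff[OF le] V unfolding peripheral_def by blast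
    qed
    then show "regs (effect w (Assign 0 (Reg 7)) s) 0 = (if diameter G = enat D then 1 else 0)"
      using yz(3) by simp
  qed simp_all
  have prog: "diameter_program D = Seq (sweep 2 D) (Seq (sweep 3 D) (Seq (sweep 4 D) (Assign 0 (Reg 7))))"
    using D unfolding diameter_program_def by simp
  have "1 + X * N + (1 + X * N + (1 + X * N + 2)) \<le> (3 * X + 10) * N" if "1 \<le> N" for N X :: nat
    using that by (simp add: algebra_simps)
  then have T: "1 + ?T + (1 + ?T + (1 + ?T + 2)) \<le> (3 * (102 * D + 150) + 10) * (n + m)"
    using size_pos by blast
  show ?thesis
    unfolding prog by (rule runs_Seq[OF 1 runs_Seq[OF 2 runs_Seq[OF 3 4 order_refl] order_refl] T])
qed

end

lemma solvable_in_linear_timeI: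
  assumes run: "\<And>G L w. \<lbrakk>G \<in> \<G>; machine_input G L w\<rbrakk> \<Longrightarrow>
      runs w prog (input_state L) (c * (length L + card (edges G))) (\<lambda>s. regs s 0 = (if P G then 1 else 0))"
    and conn: "\<And>G. G \<in> \<G> \<Longrightarrow> simple_graph G \<and> connected_graph G"
  shows "solvable_in_linear_time \<G> P"
  unfolding solvable_in_linear_time_def Let_def
proof (rule exI[of _ prog], rule exI[of _ 4], rule exI[of _ c], intro ballI allI impI)
  fix G and L :: "nat list list" and w
  assume G: "G \<in> \<G>"
    and inp: "adjacency_lists G L \<and> (card (vertices G) + card (edges G) + 1) ^ 4 \<le> 2 ^ w"
  interpret machine_input G L w using conn[OF G] inp by unfold_locales auto
  show "\<exists>t s. exec w prog (input_state L) t s \<and> t \<le> c * (card (vertices G) + card (edges G)) \<and>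
      regs s 0 = (if P G then 1 else 0)"
    using run[OF G machine_input_axioms] unfolding runs_def card_vertices by blast
qed

lemma d_max_diameter_linear_time:
  assumes H: "simple_graph H" and D: "D \<le> 6"
    and path: "H \<subseteq>\<^sub>i path_graph (D + 2)" "\<not> H \<subseteq>\<^sub>i path_graph (D + 1)"
    and sub: "H \<subseteq>\<^sub>i linear_forest (set (pattern (D + 2))) \<or> D = 5 \<and> H \<subseteq>\<^sub>i linear_forest {0, 1, 3, 4, 6}"
  shows "solvable_in_linear_time (connected_free H) (d_max_diameter (connected_free H))"
proof (rule solvable_in_linear_timeI[where prog = "diameter_program D" and c = "3 * (102 * D + 150) + 20"])
  fix G L w assume G: "G \<in> connected_free H" and inp: "machine_input G L w"
  interpret machine_input G L w by (rule inp)
  have le: "diameter G \<le> enat D" by (rule d_max_connected_free(2)[OF H path G])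
  have answer: "d_max_diameter (connected_free H) G \<longleftrightarrow> diameter G = enat D"
    unfolding d_max_diameter_def d_max_connected_free(1)[OF H path] ..
  have "\<not> H \<subseteq>\<^sub>i G" using G unfolding connected_free_def by simp
  then have "\<not> linear_forest T \<subseteq>\<^sub>i G" if "H \<subseteq>\<^sub>i linear_forest T" "finite T" for T
    using induced_subgraph_trans[OF H simple_linear_forest[OF that(2)] simple that(1)] by blast
  then have free: "\<not> linear_forest (set (pattern (D + 2))) \<subseteq>\<^sub>i G \<or> D = 5 \<and> \<not> linear_forest {0, 1, 3, 4, 6} \<subseteq>\<^sub>i G"
    using sub by auto
  show "runs w (diameter_program D) (input_state L) ((3 * (102 * D + 150) + 20) * (length L + card (edges G)))
      (\<lambda>s. regs s 0 = (if d_max_diameter (connected_free H) G then 1 else 0))"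
  proof (cases "D \<le> 2")
    case True
    show ?thesis unfolding answer
      by (rule runs_mono[OF small_diameter_program_correct[OF le True]]) (intro mult_le_mono1, simp_all)
  next
    case False
    then have D3: "3 \<le> D" by simp
    show ?thesis unfolding answer
      by (rule runs_mono[OF large_diameter_program_correct[OF le D3 D free]]) (intro mult_le_mono1, simp_all)
  qed
qed (simp add: connected_free_def)

text \<open>Such an \<open>H\<close> has at most one vertex, while a connected graph has at least
  one; the claim about the class is then vacuous.\<close>

lemma connected_free_empty:
  assumes H: "simple_graph H" and sub: "H \<subseteq>\<^sub>i linear_forest {0}"
  shows "connected_free H = {}"
proof (rule ccontr)
  assume "connected_free H \<noteq> {}"
  then obtain G where G: "G \<in> connected_free H" by blast
  interpret connected_simple_graph G using G unfolding connected_free_def by unfold_locales auto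
  have "linear_forest {0} \<subseteq>\<^sub>i G" by (rule linear_forest_embed_total) auto
  then have "H \<subseteq>\<^sub>i G" using induced_subgraph_trans[OF H simple_linear_forest simple sub] by simp
  then show False using G unfolding connected_free_def by simp
qed

lemma pattern_path: "2 \<le> t \<Longrightarrow> t \<le> 8 \<Longrightarrow> set (pattern t) \<subseteq> {..<t}"
  unfolding pattern_def by auto

theorem theorem4:
  fixes H :: "'h ugraph"
  assumes "simple_graph H"
    and "isomorphic H (graph_sum (copies 2 (path_graph 2)) (path_graph 1)) \<or>
         H \<subseteq>\<^sub>i graph_sum (path_graph 2) (copies 3 (path_graph 1)) \<or>
         H \<subseteq>\<^sub>i graph_sum (path_graph 3) (copies 2 (path_graph 1)) \<or>
         H \<subseteq>\<^sub>i graph_sum (path_graph 4) (path_graph 1)"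
  shows "solvable_in_linear_time (connected_free H) (d_max_diameter (connected_free H))"
proof -
  note H = assms(1)
  have path: "H \<subseteq>\<^sub>i path_graph t" if "H \<subseteq>\<^sub>i linear_forest T" "T \<subseteq> {..<t}" for T t
    unfolding path_graph_linear_forest
    using induced_subgraph_trans[OF H simple_linear_forest simple_linear_forest that(1)
        linear_forest_mono[OF _ that(2)]] finite_subset[OF that(2)] by simp
  from forbidden_graph_cases[OF assms] show ?thesis
  proof (elim disjE exE conjE)
    assume sub: "H \<subseteq>\<^sub>i linear_forest {0, 1, 3, 4, 6}" and n: "\<not> H \<subseteq>\<^sub>i path_graph 6"
    have "H \<subseteq>\<^sub>i path_graph 7" by (rule path[OF sub]) auto
    then show ?thesis using d_max_diameter_linear_time[OF H, of 5] sub n by simp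
  next
    fix t assume t: "t \<le> 8" "t \<le> 1" and sub: "H \<subseteq>\<^sub>i linear_forest (set (pattern t))"
    then have "connected_free H = {}" by (intro connected_free_empty[OF H]) (simp add: pattern_def)
    then show ?thesis unfolding solvable_in_linear_time_def by simp
  next
    fix t assume t: "t \<le> 8" and n: "\<not> H \<subseteq>\<^sub>i path_graph (t - 1)"
      and sub: "H \<subseteq>\<^sub>i linear_forest (set (pattern t))"
    show ?thesis
    proof (cases "t \<le> 1")
      case True
      then have "connected_free H = {}" using sub by (intro connected_free_empty[OF H]) (simp add: pattern_def)
      then show ?thesis unfolding solvable_in_linear_time_def by simp
    next
      case False
      define D where "D = t - 2"
      have D: "t = D + 2" "t - 1 = D + 1" using False unfolding D_def by simp_all
      have "H \<subseteq>\<^sub>i path_graph t" using path[OF sub] pattern_path t False by simp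
      then show ?thesis using d_max_diameter_linear_time[OF H, of D] sub n t unfolding D by simp
    qed
  qed
qed

end
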